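(* Let $G$ be a $Z$-group and let $X\subset G^{m+n}$ be a $\emptyset$-definable Presburger set. Then there exists a finite partition $\mathcal{P}$ of $X$ into $\emptyset$-definable Presburger sets such that for each $A\in\mathcal{P}$ there is a set $B\subset G^{m+n}$ with $\pi_m(A)=\pi_m(B)$, an integer $l\ge0$ depending only on $A$, and a $\emptyset$-definable family $\{f_\lambda\}_{\lambda\in\pi_m(A)}$ of linear bijections $f_\lambda:A_\lambda\to B_\lambda$ (with $A_\lambda,B_\lambda\subset G^n$), where for each $\lambda$ the set $B_\lambda$ is of the form $H^l\times\Lambda_\lambda$ with $\Lambda_\lambda$ a bounded $\lambda$-definable set.
   Context: A $Z$-group is a structure elementarily equivalent to $\mathbb{Z}$ in the Presburger language $\mathcal{L}_{Pres}=\langle +,\leq,\{\equiv\pmod n\}_{n>0},0,1\rangle$; Presburger sets are $\mathcal{L}_{Pres}$-definable sets, $\emptyset$-definable means definable without parameters, $\lambda$-definable means definable with the parameters $\lambda$. $H=\{x\in G\mid x\ge0\}$, $H^0=\{0\}$. $\pi_m:G^{m+n}\to G^m$ is the projection onto the first $m$ coordinates, and for $Y\subset G^{m+n}$ and $\lambda\in\pi_m(Y)$, $Y_\lambda=\{y\in G^n\mid (\lambda,y)\in Y\}$. A set $Y\subset G^k$ is bounded if there is $z\in H^k$ with $-z_i\le y_i\le z_i$ for all $y\in Y$ and all $i$. For $y\equiv0\pmod n$, $y/n$ is the unique $z$ with $nz=y$. A function $f:X\subset G^k\to G$ is linear if there are $\gamma\in G$ and integers $a_i$, $0\le c_i<n_i$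 with $x_i\equiv c_i\pmod{n_i}$ and $f(x)=\sum_i a_i\frac{x_i-c_i}{n_i}+\gamma$ for all $x\in X$; a map into $G^n$ is linear if each coordinate is linear. *)

theory Defs
  imports Main "HOL-Library.Disjoint_Sets"
begin

text \<open>
  The universe of an \<open>L_Pres\<close>-structure is a type \<open>'a\<close> carrying a linearly ordered abelian
  group with a distinguished element 1. Requiring these classes is no restriction: the axioms of
  linearly ordered abelian groups are first-order sentences of the language that hold in the
  integers, hence in every structure elementarily equivalent to them. For the same reason the
  relation \<open>\<equiv> (mod n)\<close> of such a structure is necessarily congruence modulo \<open>n\<close>-fold multiples.
\<close>

primrec nmult :: "nat \<Rightarrow> 'a::comm_monoid_add \<Rightarrow> 'a" where
  "nmult 0 x = 0"
| "nmult (Suc n) x = x + nmult n x"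

definition zmult :: "int \<Rightarrow> 'a::ab_group_add \<Rightarrow> 'a" where
  "zmult a x = (if 0 \<le> a then nmult (nat a) x else - nmult (nat (- a)) x)"

definition gcong :: "nat \<Rightarrow> 'a::ab_group_add \<Rightarrow> 'a \<Rightarrow> bool" where
  "gcong n x y \<longleftrightarrow> (\<exists>z. x - y = nmult n z)"

definition gdiv :: "'a::comm_monoid_add \<Rightarrow> nat \<Rightarrow> 'a" where
  "gdiv y n = (THE z. nmult n z = y)"


datatype pterm = Var nat | Zero | One | Add pterm pterm

text \<open>\<open>Cong n s t\<close> is the atom \<open>s \<equiv> t (mod n + 1)\<close>, so that exactly the positive moduli occur.\<close>

datatype pform =
    Eq pterm pterm
  | Le pterm pterm
  | Cong nat pterm pterm
  | Neg pform
  | Conj pform pform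
  | Exists nat pform

primrec tvars :: "pterm \<Rightarrow> nat set" where
  "tvars (Var i) = {i}"
| "tvars Zero = {}"
| "tvars One = {}"
| "tvars (Add s t) = tvars s \<union> tvars t"

primrec fvars :: "pform \<Rightarrow> nat set" where
  "fvars (Eq s t) = tvars s \<union> tvars t"
| "fvars (Le s t) = tvars s \<union> tvars t"
| "fvars (Cong n s t) = tvars s \<union> tvars t"
| "fvars (Neg \<phi>) = fvars \<phi>"
| "fvars (Conj \<phi> \<psi>) = fvars \<phi> \<union> fvars \<psi>"
| "fvars (Exists i \<phi>) = fvars \<phi> - {i}"

primrec tval :: "(nat \<Rightarrow> 'a::{linordered_ab_group_add,one}) \<Rightarrow> pterm \<Rightarrow> 'a" where
  "tval e (Var i) = e i"
| "tval e Zero = 0"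
| "tval e One = 1"
| "tval e (Add s t) = tval e s + tval e t"

primrec sat :: "(nat \<Rightarrow> 'a::{linordered_ab_group_add,one}) \<Rightarrow> pform \<Rightarrow> bool" where
  "sat e (Eq s t) \<longleftrightarrow> tval e s = tval e t"
| "sat e (Le s t) \<longleftrightarrow> tval e s \<le> tval e t"
| "sat e (Cong n s t) \<longleftrightarrow> gcong (Suc n) (tval e s) (tval e t)"
| "sat e (Neg \<phi>) \<longleftrightarrow> \<not> sat e \<phi>"
| "sat e (Conj \<phi> \<psi>) \<longleftrightarrow> sat e \<phi> \<and> sat e \<psi>"
| "sat e (Exists i \<phi>) \<longleftrightarrow> (\<exists>x. sat (e(i := x)) \<phi>)"

definition elem_equiv ::
  "'a::{linordered_ab_group_add,one} itself \<Rightarrow> 'b::{linordered_ab_group_add,one} itself \<Rightarrow> bool" where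
  "elem_equiv _ _ \<longleftrightarrow> (\<forall>\<phi>. fvars \<phi> = {} \<longrightarrow>
     (\<forall>e::nat \<Rightarrow> 'a. sat e \<phi>) = (\<forall>e::nat \<Rightarrow> 'b. sat e \<phi>))"

definition Z_group :: "'a::{linordered_ab_group_add,one} itself \<Rightarrow> bool" where
  "Z_group G \<longleftrightarrow> elem_equiv G TYPE(int)"


text \<open>
  Points of \<open>G\<^sup>k\<close> are lists of length \<open>k\<close>; the pair \<open>(x, y)\<close> of a point of \<open>G\<^sup>m\<close> and a point of
  \<open>G\<^sup>n\<close> is \<open>x @ y\<close>.
\<close>

definition Gpow :: "nat \<Rightarrow> 'a list set" where
  "Gpow k = {x. length x = k}"

definition Hpow :: "nat \<Rightarrow> 'a::linordered_ab_group_add list set" where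
  "Hpow k = {x \<in> Gpow k. \<forall>i<k. 0 \<le> x ! i}"

definition proj_first :: "nat \<Rightarrow> 'a list set \<Rightarrow> 'a list set" where
  "proj_first m Y = take m ` Y"

definition fiber :: "'a list set \<Rightarrow> 'a list \<Rightarrow> 'a list set" where
  "fiber Y p = {y. p @ y \<in> Y}"

definition cart_prod :: "'a list set \<Rightarrow> 'a list set \<Rightarrow> 'a list set" where
  "cart_prod U V = {u @ v | u v. u \<in> U \<and> v \<in> V}"

text \<open>
  \<open>definable p k Y\<close>: the set \<open>Y \<subseteq> G\<^sup>k\<close> is definable with the parameters \<open>p\<close>. The parameters are
  the values of the first \<open>length p\<close> variables; \<open>p = []\<close> is definability without parameters.
\<close>

definition definable :: "'a::{linordered_ab_group_add,one} list \<Rightarrow> nat \<Rightarrow> 'a list set \<Rightarrow> bool" where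
  "definable p k Y \<longleftrightarrow> (\<exists>\<phi>. fvars \<phi> \<subseteq> {..<length p + k} \<and>
     Y = {y \<in> Gpow k. sat (nth (p @ y)) \<phi>})"

definition gbounded :: "nat \<Rightarrow> 'a::linordered_ab_group_add list set \<Rightarrow> bool" where
  "gbounded k Y \<longleftrightarrow> Y \<subseteq> Gpow k \<and>
     (\<exists>z\<in>Hpow k. \<forall>y\<in>Y. \<forall>i<k. - (z ! i) \<le> y ! i \<and> y ! i \<le> z ! i)"

text \<open>In the next definition the integer \<open>c i\<close> is the element \<open>nmult (c i) 1\<close> of \<open>G\<close>.\<close>

definition linear_on ::
  "nat \<Rightarrow> 'a::{linordered_ab_group_add,one} list set \<Rightarrow> ('a list \<Rightarrow> 'a) \<Rightarrow> bool" where
  "linear_on k X f \<longleftrightarrow> X \<subseteq> Gpow k \<and>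
     (\<exists>(\<gamma>::'a) (a::nat \<Rightarrow> int) (c::nat \<Rightarrow> nat) (d::nat \<Rightarrow> nat).
        (\<forall>i<k. c i < d i) \<and>
        (\<forall>x\<in>X. (\<forall>i<k. gcong (d i) (x ! i) (nmult (c i) 1)) \<and>
           f x = (\<Sum>i<k. zmult (a i) (gdiv (x ! i - nmult (c i) 1) (d i))) + \<gamma>))"

definition linear_map_on ::
  "nat \<Rightarrow> nat \<Rightarrow> 'a::{linordered_ab_group_add,one} list set \<Rightarrow> ('a list \<Rightarrow> 'a list) \<Rightarrow> bool" where
  "linear_map_on k n X f \<longleftrightarrow> f ` X \<subseteq> Gpow n \<and> (\<forall>j<n. linear_on k X (\<lambda>x. f x ! j))"

text \<open>
  A family of maps \<open>f p : fiber A p \<rightarrow> G\<^sup>n\<close>, with \<open>p\<close> ranging over \<open>proj_first m A\<close> and \<open>A \<subseteq> G\<^sup>m\<^sup>+\<^sup>k\<close>, is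
  definable without parameters if the graph of \<open>(p, x) \<mapsto> f p x\<close> is.
\<close>

definition definable_family ::
  "nat \<Rightarrow> nat \<Rightarrow> nat \<Rightarrow> 'a::{linordered_ab_group_add,one} list set
    \<Rightarrow> ('a list \<Rightarrow> 'a list \<Rightarrow> 'a list) \<Rightarrow> bool" where
  "definable_family m k n A f \<longleftrightarrow>
     definable [] (m + k + n) {p @ x @ f p x | p x. p \<in> proj_first m A \<and> x \<in> fiber A p}"

end

(* Coordinates are split one at a time. Cooper's argument decomposes a definable set into cells
   alpha <= t <= beta over a set of lower dimension. After passing to residue classes in every
   coordinate separately, the bounds are integral and affine, and from then on only unimodular
   changes of coordinates occur. This is essential: a linear map in the sense of the theorem divides
   each coordinate on its own, so maps such as (x + y)/2 must never arise. By induction the base of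
   the cell becomes a product of H^l and a bounded set, and the wedge 0 <= t <= beta(y) over it is
   subdivided into unimodular pieces, by cutting along t = y_i as long as y_i has a positive
   coefficient in beta. *)

theory Submission
  imports Defs "HOL.Modules"
begin

section \<open>Integer multiples and Z-groups\<close>

text \<open>Points are environments on all of \<open>nat\<close>, so that adding a coordinate means
  adding an index to \<open>V\<close>; the coordinates in \<open>W\<close> are to be straightened
  and those in \<open>V - W\<close> are parameters. The two kinds obey different rules. The constant
  \<gamma> may depend on \<lambda> in any definable way, so a quotient such as (p + q)/2 of
  parameters is harmless, and every rounding is arranged to concern parameters alone. A coordinate
  in \<open>W\<close> is only ever divided by itself, by replacing x with D x + c. The isomorphisms
  are therefore asymmetric: the map to the box may divide source coordinates, its inverse is
  integral, and all cutting happens on the side of the box, where denominators are 1. The cutting of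
  a wedge stops because its upper bound is nonnegative on the base. On a nonempty box the
  coefficient of a coordinate that runs over all of H cannot be negative, so each such coefficient
  is eventually lowered to 0. Then the bound involves only bounded coordinates and parameters, and
  the new coordinate is bounded in each fibre.\<close>

lemma nmult_add: "nmult (m + n) x = nmult m x + nmult n x"
  by (induction m) (auto simp: algebra_simps)

lemma nmult_add_right: "nmult n (x + y) = nmult n x + nmult n y"
  by (induction n) (auto simp: algebra_simps)

lemma nmult_mult: "nmult (m * n) x = nmult m (nmult n x)"
  by (induction m) (auto simp: nmult_add)

lemma nmult_comm: "nmult m (nmult n x) = nmult n (nmult m x)"
  by (simp add: nmult_mult[symmetric] mult.commute)

text \<open>Confines the sign distinction of \<open>zmult\<close>: with integers written as
  differences of naturals, the module laws become identities for \<open>nmult\<close>.\<close>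

lemma zmult_diff: "zmult (int m - int n) x = nmult m x - nmult n x"
proof (cases "n \<le> m")
  case True
  then obtain k where "m = n + k" using le_Suc_ex by blast
  then show ?thesis by (simp add: zmult_def nmult_add)
next
  case False
  then obtain k where "n = m + k" by (metis le_Suc_ex nat_le_linear)
  then show ?thesis using False by (auto simp: zmult_def nmult_add)
qed

lemma zmult_int: "zmult (int n) x = nmult n x"
  by (simp add: zmult_def)

interpretation zm: module "zmult :: int \<Rightarrow> 'a::ab_group_add \<Rightarrow> 'a"
proof
  fix a b :: int and x y :: 'a
  obtain m n where a: "a = int m - int n" by (rule int_diff_cases)
  obtain k l where b: "b = int k - int l" by (rule int_diff_cases)
  show "zmult a (x + y) = zmult a x + zmult a y"
    unfolding a zmult_diff by (simp add: nmult_add_right algebra_simps)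
  have *: "a + b = int (m + k) - int (n + l)" using a b by simp
  show "zmult (a + b) x = zmult a x + zmult b x"
    unfolding * unfolding a b zmult_diff by (simp add: nmult_add algebra_simps)
  have neg: "nmult i (u - v) = nmult i u - nmult i v" for i and u v :: 'a
    using nmult_add_right[of i "u - v" v] by (simp add: algebra_simps)
  have **: "a * b = int (m * k + n * l) - int (m * l + n * k)" unfolding a b by (simp add: algebra_simps)
  show "zmult a (zmult b x) = zmult (a * b) x"
    unfolding ** unfolding a b zmult_diff
    by (simp add: nmult_add nmult_mult neg nmult_comm[of l] nmult_comm[of k] algebra_simps)
  show "zmult 1 x = x" by (simp add: zmult_def)
qed

notation zmult (infixr "\<cdot>" 75)

lemmas zs = zm.scale_left_distrib zm.scale_right_distrib zm.scale_left_diff_distrib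
  zm.scale_right_diff_distrib

lemma zmult_nonneg: "0 \<le> a \<Longrightarrow> 0 \<le> (x::'a::linordered_ab_group_add) \<Longrightarrow> 0 \<le> a \<cdot> x"
proof -
  have "0 \<le> nmult n x" if "0 \<le> x" for n using that by (induction n) auto
  then show "0 \<le> a \<Longrightarrow> 0 \<le> x \<Longrightarrow> 0 \<le> a \<cdot> x" by (simp add: zmult_def)
qed

lemma zmult_pos: 
  assumes "0 < a" "0 < (x::'a::linordered_ab_group_add)" shows "0 < a \<cdot> x"
proof -
  have "a \<cdot> x = x + (a - 1) \<cdot> x" by (simp add: zs)
  moreover have "0 \<le> (a - 1) \<cdot> x" using assms by (intro zmult_nonneg) auto
  ultimately show ?thesis using assms(2) by (simp add: add_pos_nonneg)
qed

lemma zmult_less_iff: 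
  fixes x y :: "'a::linordered_ab_group_add"
  assumes "0 < a" shows "a \<cdot> x < a \<cdot> y \<longleftrightarrow> x < y"
proof -
  have lt: "a \<cdot> x < a \<cdot> y" if "x < y" for x y :: 'a
    using zmult_pos[OF assms, of "y - x"] that by (simp add: zs)
  show ?thesis using lt[of x y] lt[of y x] by (metis less_irrefl less_linear less_asym)
qed

lemma zmult_le_iff: 
  fixes x y :: "'a::linordered_ab_group_add"
  assumes "0 < a" shows "a \<cdot> x \<le> a \<cdot> y \<longleftrightarrow> x \<le> y"
  using zmult_less_iff[OF assms, of y x] by (simp add: not_less[symmetric])

lemma zmult_cancel: 
  fixes x y :: "'a::linordered_ab_group_add"
  assumes "0 < a" shows "a \<cdot> x = a \<cdot> y \<longleftrightarrow> x = y"
  using zmult_le_iff[OF assms] by (metis order_antisym order_refl)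

lemma zmult_left_mono:
  fixes x :: "'a::linordered_ab_group_add"
  assumes "0 \<le> x" "a \<le> b" shows "a \<cdot> x \<le> b \<cdot> x"
  using zmult_nonneg[of "b - a" x] assms by (simp add: zs)

text \<open>Congruence as a condition on a single element, with an integer modulus, so that it
  applies to values of linear forms.\<close>

definition dvg :: "int \<Rightarrow> 'a::ab_group_add \<Rightarrow> bool" where
  "dvg N x \<longleftrightarrow> (\<exists>z. x = N \<cdot> z)"

lemma gcong_dvg: "gcong n x y \<longleftrightarrow> dvg (int n) (x - y)"
  by (simp add: gcong_def dvg_def zmult_int)

lemma dvg_add: "dvg N x \<Longrightarrow> dvg N y \<Longrightarrow> dvg N (x + y)"
  unfolding dvg_def by (metis zm.scale_right_distrib)

lemma dvg_diff: "dvg N x \<Longrightarrow> dvg N y \<Longrightarrow> dvg N (x - y)"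
  unfolding dvg_def by (metis zm.scale_right_diff_distrib)

lemma dvg_diff_iff: "dvg N y \<Longrightarrow> dvg N (x - y) \<longleftrightarrow> dvg N x"
  using dvg_add[of N "x - y" y] dvg_diff[of N x y] by auto

lemma dvg_mult: "dvg N x \<Longrightarrow> dvg N (a \<cdot> x)"
  unfolding dvg_def by (metis mult.commute zm.scale_scale)

lemma dvg_scale: "dvg N (N \<cdot> x)"
  unfolding dvg_def by blast

lemma dvg_trans: "M dvd N \<Longrightarrow> dvg N x \<Longrightarrow> dvg M x"
  unfolding dvg_def by (metis dvdE zm.scale_scale)

text \<open>An ordered group is torsion-free, so the factor \<open>K\<close> cancels. This is how
  denominators are cleared inside congruences.\<close>

lemma dvg_cancel: 
  fixes x :: "'a::linordered_ab_group_add"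
  shows "0 < K \<Longrightarrow> dvg (K * N) (K \<cdot> x) \<longleftrightarrow> dvg N x"
  unfolding dvg_def by (metis zm.scale_scale zmult_cancel)

text \<open>The only consequences of elementary equivalence with the integers that are used: 1 is
  the least positive element, and division with remainder by each standard positive integer is
  possible. Together with the order axioms of the class these are the usual axioms of Presburger
  arithmetic.\<close>

locale zgroup =
  fixes G :: "'a::{linordered_ab_group_add,one} itself"
  assumes one_pos: "0 < (1::'a)"
    and discrete: "0 < (x::'a) \<Longrightarrow> 1 \<le> x"
    and residue_ex: "0 < N \<Longrightarrow> \<exists>r\<in>{0..<N}. dvg N ((x::'a) - r \<cdot> 1)"
begin

lemma less_iff: "(x::'a) < y \<longleftrightarrow> x + 1 \<le> y"
  using discrete[of "y - x"] one_pos
  by (metis add.commute diff_gt_0_iff_gt le_diff_eq less_add_same_cancel1 order_less_le_trans)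

lemma int_one_le: "a \<cdot> (1::'a) \<le> b \<cdot> 1 \<longleftrightarrow> a \<le> b"
proof -
  have "a \<cdot> (1::'a) < b \<cdot> 1" if "a < b" for a b
    using zmult_pos[of "b - a" "1::'a"] that one_pos by (simp add: zs)
  then show ?thesis by (metis le_less_linear less_le_not_le order_refl linorder_neqE)
qed

lemma int_one_less: "a \<cdot> (1::'a) < b \<cdot> 1 \<longleftrightarrow> a < b"
  using int_one_le[of b a] by (simp add: not_le[symmetric])

text \<open>If r = N z with 0 \<le> r < N, then 0 \<le> z < 1, and discreteness leaves only z = 0.
  Hence residues are unique.\<close>

lemma dvg_small: 
  assumes "dvg N (r \<cdot> (1::'a))" "0 \<le> r" "r < N" shows "r = 0"
proof -
  obtain z where z: "r \<cdot> (1::'a) = N \<cdot> z" using assms(1) by (auto simp: dvg_def)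
  have "N > 0" using assms by simp
  have "N \<cdot> 0 \<le> N \<cdot> z" using int_one_le[of 0 r] assms(2) z by simp
  then have "0 \<le> z" using zmult_le_iff[OF \<open>N > 0\<close>] by blast
  have "N \<cdot> z < N \<cdot> 1" using int_one_less[of r N] assms(3) z by simp
  then have "z < 1" using zmult_less_iff[OF \<open>N > 0\<close>] by blast
  then have "z = 0" using \<open>0 \<le> z\<close> discrete[of z] by (metis leD order_le_less)
  then show ?thesis using z int_one_le[of r 0] assms(2) by simp
qed

lemma residue_unique:
  assumes "dvg N ((x::'a) - r \<cdot> 1)" "dvg N (x - s \<cdot> 1)" "r \<in> {0..<N}" "s \<in> {0..<N}"
  shows "r = s"
proof -
  have "dvg N ((s - r) \<cdot> (1::'a))" "dvg N ((r - s) \<cdot> (1::'a))" 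
    using dvg_diff[OF assms(1,2)] dvg_diff[OF assms(2,1)] by (simp_all add: zs)
  then show ?thesis using dvg_small[of N "s - r"] dvg_small[of N "r - s"] assms(3,4)
    by (cases "r \<le> s") auto
qed

text \<open>Here \<open>z\<close> is the ceiling of \<open>y / K\<close>.\<close>

lemma ceil_le_iff:
  assumes "y + r \<cdot> (1::'a) = K \<cdot> z" "r \<in> {0..<K}"
  shows "y \<le> K \<cdot> x \<longleftrightarrow> z \<le> x"
proof
  have K: "0 < K" using assms(2) by auto
  have r: "0 \<le> r \<cdot> (1::'a)" "r \<cdot> (1::'a) < K \<cdot> 1" 
    using assms(2) int_one_le[of 0 r] int_one_less[of r K] by auto
  show "z \<le> x \<Longrightarrow> y \<le> K \<cdot> x"
    using assms(1) r zmult_le_iff[OF K, of z x] by (metis add_increasing2 le_add_same_cancel1 order_trans)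
  assume "y \<le> K \<cdot> x"
  then have "K \<cdot> z < K \<cdot> (x + 1)"
    using assms(1) r(2) by (simp add: zs) (metis add_le_less_mono)
  then have "z < x + 1" using zmult_less_iff[OF K] by blast
  then show "z \<le> x" by (simp add: less_iff)
qed

end

text \<open>Each axiom is transferred as a sentence; division with remainder needs one sentence for
  each modulus.\<close>

lemma zgroup_if_Z_group:
  assumes "Z_group TYPE('a::{linordered_ab_group_add,one})"
  shows "zgroup TYPE('a)"
proof
  have EE: "(\<forall>e::nat \<Rightarrow> 'a. sat e \<phi>) = (\<forall>e::nat \<Rightarrow> int. sat e \<phi>)" if "fvars \<phi> = {}" for \<phi>
    using assms that by (simp add: Z_group_def elem_equiv_def)
  have "(\<forall>e::nat \<Rightarrow> 'a. sat e (Neg (Le One Zero)))" by (subst EE) auto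
  then show pos: "0 < (1::'a)" by (simp add: not_le)
  have "(\<forall>e::nat \<Rightarrow> 'a. sat e (Neg (Exists 0 (Conj (Neg (Le (Var 0) Zero)) (Neg (Le One (Var 0)))))))"
    by (subst EE) auto
  then have "\<forall>x::'a. x \<le> 0 \<or> 1 \<le> x" by (simp add: not_le not_less)
  then have disc: "1 \<le> x" if "0 < x" for x :: 'a using that by (meson leD)
  show "0 < x \<Longrightarrow> 1 \<le> x" for x :: 'a by (rule disc)
  fix N :: int and x :: 'a assume N: "0 < N"
  define n where "n = nat N"
  have n: "0 < n" "N = int n" using N by (auto simp: n_def)
  \<comment> \<open>The closed term 1 + ... + 1 with \<open>n\<close> summands, since the language
    has no numerals beyond 0 and 1.\<close>
  define T where "T = ((\<lambda>s. Add One s) ^^ n) Zero"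
  have T: "tvars T = {}" "tval e T = nmult n 1" for e :: "nat \<Rightarrow> 'b::{linordered_ab_group_add,one}"
  proof -
    have "tvars (((\<lambda>s. Add One s) ^^ n) Zero) = {}" for n by (induction n) auto
    then show "tvars T = {}" by (simp add: T_def)
    have "tval e (((\<lambda>s. Add One s) ^^ n) Zero) = nmult n 1" for n by (induction n) auto
    then show "tval e T = nmult n 1" by (simp add: T_def)
  qed
  have nm: "nmult k (z::int) = int k * z" for k z by (induction k) (auto simp: algebra_simps)
  \<comment> \<open>Every x is congruent to some y with 0 \<le> y < n; the index
    \<open>n - 1\<close> in \<open>Cong\<close> encodes the modulus \<open>n\<close>.\<close>
  let ?\<phi> = "Neg (Exists 0 (Neg (Exists 1 (Conj (Conj (Le Zero (Var 1)) (Neg (Le T (Var 1))))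
     (Cong (n - 1) (Var 0) (Var 1))))))"
  have "(\<forall>e::nat \<Rightarrow> 'a. sat e ?\<phi>)"
  proof (subst EE)
    show "fvars ?\<phi> = {}" using T by auto
    show "\<forall>e::nat \<Rightarrow> int. sat e ?\<phi>"
    proof (simp add: T gcong_def nm n del: nmult.simps, intro allI)
      fix x :: int
      have "0 \<le> x mod int n \<and> \<not> int n \<le> x mod int n \<and> x - x mod int n = int n * (x div int n)"
        using n by (simp add: minus_mod_eq_mult_div not_le)
      then show "\<exists>xa\<ge>0. \<not> int n \<le> xa \<and> (\<exists>z. x - xa = int n * z)" by blast
    qed
  qed
  then have "\<exists>y\<ge>0. \<not> nmult n 1 \<le> y \<and> gcong n x y"
    using n by (simp add: T del: nmult.simps)
  then obtain y where y: "0 \<le> y" "y < nmult n 1" "gcong n x y" by (auto simp: not_le)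
  \<comment> \<open>The sentence yields only an element of \<open>G\<close> between 0 and
    \<open>n\<close>. Discreteness shows, by subtracting 1 repeatedly, that it is a standard
    number.\<close>
  have "\<exists>r<k. y = nmult r 1" if "0 \<le> y" "y < nmult k 1" for k and y :: 'a
    using that
  proof (induction k arbitrary: y)
    case (Suc k)
    show ?case
    proof (cases "y = 0")
      case False
      then have "1 \<le> y" using disc Suc by (simp add: order_less_le)
      then have "\<exists>r<k. y - 1 = nmult r 1" using Suc.prems by (intro Suc.IH) (auto simp: algebra_simps)
      then obtain r where r: "r < k" "y - 1 = nmult r 1" by auto
      then have "y = nmult (Suc r) 1" by (simp add: algebra_simps)
      then show ?thesis using r by blast
    qed (auto intro: exI[of _ 0])
  qed auto
  then obtain r where r: "r < n" "y = nmult r 1" using y by blast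
  then have "dvg N (x - int r \<cdot> 1)" using y n by (simp add: gcong_dvg zmult_int)
  then show "\<exists>r\<in>{0..<N}. dvg N (x - r \<cdot> 1)" using r n by (intro bexI[of _ "int r"]) auto
qed

section \<open>Linear forms and quantifier-free sets\<close>

text \<open>A set of environments stands for the set of points given by the coordinates in \<open>V\<close>.\<close>

inductive_set LF :: "nat set \<Rightarrow> ((nat \<Rightarrow> 'a::{linordered_ab_group_add,one}) \<Rightarrow> 'a) set" for V where
  LF_one: "(\<lambda>e. 1) \<in> LF V"
| LF_var: "i \<in> V \<Longrightarrow> (\<lambda>e. e i) \<in> LF V"
| LF_add: "L \<in> LF V \<Longrightarrow> L' \<in> LF V \<Longrightarrow> (\<lambda>e. L e + L' e) \<in> LF V"
| LF_minus: "L \<in> LF V \<Longrightarrow> (\<lambda>e. - L e) \<in> LF V"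

lemma LF_diff: "L \<in> LF V \<Longrightarrow> L' \<in> LF V \<Longrightarrow> (\<lambda>e. L e - L' e) \<in> LF V"
  using LF_add[OF _ LF_minus] by fastforce

lemma LF_zero: "(\<lambda>e. 0) \<in> LF V"
  using LF_diff[OF LF_one LF_one] by simp

lemma LF_scale: "L \<in> LF V \<Longrightarrow> (\<lambda>e. a \<cdot> L e) \<in> LF V"
proof (induction a rule: int_induct[of _ 0])
  case (step1 i)
  then show ?case using LF_add[of "\<lambda>e. i \<cdot> L e" V L] by (simp add: zs)
next
  case (step2 i)
  then show ?case using LF_diff[of "\<lambda>e. i \<cdot> L e" V L] by (simp add: zs)
qed (simp add: LF_zero)

lemma LF_const: "(\<lambda>e. a \<cdot> 1) \<in> LF V"
  by (intro LF_scale LF_one)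

lemmas LF_intros = LF_one LF_var LF_add LF_minus LF_diff LF_zero LF_scale

lemma LF_mono: "L \<in> LF V \<Longrightarrow> V \<subseteq> V' \<Longrightarrow> L \<in> LF V'"
  by (induction rule: LF.induct) (auto intro: LF_intros)

lemma LF_local: "L \<in> LF V \<Longrightarrow> (\<And>i. i \<in> V \<Longrightarrow> e i = e' i) \<Longrightarrow> L e = L e'"
  by (induction rule: LF.induct) auto

lemma LF_split_var: 
  "L \<in> LF (insert t V) \<Longrightarrow> \<exists>a. \<exists>L'\<in>LF V. \<forall>e. L e = a \<cdot> e t + L' e"
proof (induction rule: LF.induct)
  case LF_one
  show ?case by (rule exI[of _ 0], rule bexI[of _ "\<lambda>e. 1"]) (auto intro: LF_intros)
next
  case (LF_var i)
  show ?case
  proof (cases "i = t")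
    case True
    then show ?thesis by (intro exI[of _ 1] bexI[of _ "\<lambda>e. 0"]) (auto intro: LF_intros)
  next
    case False
    then show ?thesis using LF_var
      by (intro exI[of _ 0] bexI[of _ "\<lambda>e. e i"]) (auto intro: LF_intros)
  qed
next
  case (LF_add L L')
  then obtain a b M M' where "M \<in> LF V" "M' \<in> LF V" "\<forall>e. L e = a \<cdot> e t + M e" 
    "\<forall>e. L' e = b \<cdot> e t + M' e" by blast
  then show ?case 
    by (intro exI[of _ "a + b"] bexI[of _ "\<lambda>e. M e + M' e"]) (auto intro: LF_intros simp: zs)
next
  case (LF_minus L)
  then obtain a M where "M \<in> LF V" "\<forall>e. L e = a \<cdot> e t + M e" by blast
  then show ?case 
    by (intro exI[of _ "- a"] bexI[of _ "\<lambda>e. - M e"]) (auto intro: LF_intros simp: zs)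
qed

text \<open>Rational coefficients without a division function: on \<open>A\<close> a positive
  multiple of \<open>u\<close> is a form. Exact quotients on a residue class are of this kind, and
  torsion-freeness makes the form determine \<open>u\<close> on \<open>A\<close>.\<close>

definition qlin where
  "qlin V A u \<longleftrightarrow> (\<exists>N>0. \<exists>L\<in>LF V. \<forall>e\<in>A. N \<cdot> u e = L e)"

lemma qlinI: "0 < N \<Longrightarrow> L \<in> LF V \<Longrightarrow> (\<And>e. e \<in> A \<Longrightarrow> N \<cdot> u e = L e) \<Longrightarrow> qlin V A u"
  unfolding qlin_def by blast

lemma qlin_LF: "L \<in> LF V \<Longrightarrow> qlin V A L"
  by (rule qlinI[of 1 L]) auto

lemma qlin_add: 
  assumes "qlin V A u" "qlin V A v" shows "qlin V A (\<lambda>e. u e + v e)"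
proof -
  from assms(1) obtain N L where 1: "0 < N" "L \<in> LF V" "\<And>e. e \<in> A \<Longrightarrow> N \<cdot> u e = L e" unfolding qlin_def by blast
  from assms(2) obtain M K where 2: "0 < M" "K \<in> LF V" "\<And>e. e \<in> A \<Longrightarrow> M \<cdot> v e = K e" unfolding qlin_def by blast
  show ?thesis
  proof (rule qlinI[of "M * N" "\<lambda>e. M \<cdot> L e + N \<cdot> K e"])
    fix e assume e: "e \<in> A"
    show "(M * N) \<cdot> (u e + v e) = M \<cdot> L e + N \<cdot> K e"
      unfolding 1(3)[OF e, symmetric] 2(3)[OF e, symmetric] by (simp add: zs mult.commute)
  qed (use 1 2 in \<open>auto intro: LF_intros\<close>)
qed

lemma qlin_scale: 
  assumes "qlin V A u" shows "qlin V A (\<lambda>e. a \<cdot> u e)"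
proof -
  from assms(1) obtain N L where 1: "0 < N" "L \<in> LF V" "\<And>e. e \<in> A \<Longrightarrow> N \<cdot> u e = L e" unfolding qlin_def by blast
  show ?thesis
  proof (rule qlinI[of N "\<lambda>e. a \<cdot> L e"])
    fix e assume e: "e \<in> A"
    show "N \<cdot> a \<cdot> u e = a \<cdot> L e"
      unfolding 1(3)[OF e, symmetric] by (simp add: mult.commute)
  qed (use 1 in \<open>auto intro: LF_intros\<close>)
qed

lemma qlin_minus: "qlin V A u \<Longrightarrow> qlin V A (\<lambda>e. - u e)"
  using qlin_scale[of V A u "- 1"] by (simp add: zs)

lemma qlin_mono: "qlin V A u \<Longrightarrow> V \<subseteq> V' \<Longrightarrow> A' \<subseteq> A \<Longrightarrow> qlin V' A' u"
  unfolding qlin_def using LF_mono by (metis subsetD)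

lemma qlin_cong: "qlin V A u \<Longrightarrow> (\<And>e. e \<in> A \<Longrightarrow> u e = v e) \<Longrightarrow> qlin V A v"
  unfolding qlin_def by metis

lemma qlin_local: 
  assumes "qlin V A u" "e \<in> A" "e' \<in> A" "\<And>i. i \<in> V \<Longrightarrow> e i = e' i" 
  shows "u e = u e'"
proof -
  obtain N L where L: "0 < N" "L \<in> LF V" "\<And>e. e \<in> A \<Longrightarrow> N \<cdot> u e = L e"
    using assms(1) unfolding qlin_def by blast
  have "N \<cdot> u e = N \<cdot> u e'" using L(3) assms(2,3) LF_local[OF L(2) assms(4)] by simp
  then show ?thesis using zmult_cancel[OF L(1)] by blast
qed

lemma qlin_compose: 
  assumes "L \<in> LF V" "\<And>i. i \<in> V \<Longrightarrow> qlin V' A (\<lambda>e. h e i)"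
  shows "qlin V' A (\<lambda>e. L (h e))"
  using assms
  by (induction rule: LF.induct) (auto intro: qlin_add qlin_minus qlin_LF[OF LF_one])

text \<open>Quantifier-free definability without parameters, expressed on sets of environments so
  that no formulas occur until \<open>QF_sat\<close> and \<open>sat_QF\<close>. Inequalities and
  congruences suffice as atoms.\<close>

inductive QF :: "nat set \<Rightarrow> (nat \<Rightarrow> 'a::{linordered_ab_group_add,one}) set \<Rightarrow> bool" for V where
  QF_ge: "L \<in> LF V \<Longrightarrow> QF V {e. 0 \<le> L e}"
| QF_dvg: "L \<in> LF V \<Longrightarrow> 0 < N \<Longrightarrow> QF V {e. dvg N (L e)}"
| QF_Compl: "QF V A \<Longrightarrow> QF V (- A)"
| QF_Int: "QF V A \<Longrightarrow> QF V B \<Longrightarrow> QF V (A \<inter> B)"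

lemma QF_Diff: "QF V A \<Longrightarrow> QF V B \<Longrightarrow> QF V (A - B)"
  by (simp add: Diff_eq QF_Int QF_Compl)

lemma QF_Un: "QF V A \<Longrightarrow> QF V B \<Longrightarrow> QF V (A \<union> B)"
  using QF_Compl[OF QF_Int[OF QF_Compl QF_Compl]] by fastforce

lemma QF_UNIV: "QF V UNIV"
  using QF_ge[OF LF_zero, of V] by simp

lemma QF_empty: "QF V {}"
  using QF_Compl[OF QF_UNIV] by simp

lemma QF_le: "L \<in> LF V \<Longrightarrow> L' \<in> LF V \<Longrightarrow> QF V {e. L e \<le> L' e}"
  using QF_ge[OF LF_diff[of L' V L]] by simp

lemma QF_eq: "L \<in> LF V \<Longrightarrow> L' \<in> LF V \<Longrightarrow> QF V {e. L e = L' e}"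
proof -
  assume L: "L \<in> LF V" "L' \<in> LF V"
  have "{e. L e = L' e} = {e. L e \<le> L' e} \<inter> {e. L' e \<le> L e}" by auto
  then show ?thesis using QF_Int[OF QF_le QF_le, OF L L(2,1)] by simp
qed

lemma QF_UN: "finite I \<Longrightarrow> (\<And>i. i \<in> I \<Longrightarrow> QF V (A i)) \<Longrightarrow> QF V (\<Union>i\<in>I. A i)"
  by (induction I rule: finite_induct) (auto intro: QF_empty QF_Un)

lemma QF_INT: "finite I \<Longrightarrow> (\<And>i. i \<in> I \<Longrightarrow> QF V (A i)) \<Longrightarrow> QF V (\<Inter>i\<in>I. A i)"
  by (induction I rule: finite_induct) (auto intro: QF_UNIV QF_Int)

lemma QF_mono: "QF V A \<Longrightarrow> V \<subseteq> V' \<Longrightarrow> QF V' A"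
  by (induction rule: QF.induct) (auto intro: QF.intros LF_mono)

lemma QF_local: "QF V A \<Longrightarrow> (\<And>i. i \<in> V \<Longrightarrow> e i = e' i) \<Longrightarrow> e \<in> A \<longleftrightarrow> e' \<in> A"
proof (induction rule: QF.induct)
  case (QF_ge L)
  have "L e = L e'" using LF_local[OF QF_ge(1)] QF_ge(2) by blast
  then show ?case by simp
next
  case (QF_dvg L N)
  have "L e = L e'" using LF_local[OF QF_dvg(1)] QF_dvg(3) by blast
  then show ?case by simp
qed auto

lemma QF_upd: "QF V A \<Longrightarrow> t \<notin> V \<Longrightarrow> e(t := x) \<in> A \<longleftrightarrow> e \<in> A"
  by (rule QF_local) auto

lemma QF_qlin_le:
  assumes A: "QF V A" and "qlin V A u" "qlin V A v" 
  shows "QF V {e \<in> A. u e \<le> v e}"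
proof -
  have "qlin V A (\<lambda>e. v e + - u e)" by (intro qlin_add qlin_minus assms)
  then obtain N L where L: "0 < N" "L \<in> LF V" "\<And>e. e \<in> A \<Longrightarrow> N \<cdot> (v e + - u e) = L e" unfolding qlin_def by blast
  have "u e \<le> v e \<longleftrightarrow> 0 \<le> L e" if "e \<in> A" for e
    using zmult_le_iff[OF L(1), of 0 "v e + - u e"] L(3)[OF that] by simp
  then have "{e \<in> A. u e \<le> v e} = A \<inter> {e. 0 \<le> L e}" by auto
  then show ?thesis using A L(2) by (simp add: QF_Int QF_ge)
qed

text \<open>Substituting rational forms for coordinates stays quantifier-free: with denominator
  \<open>N\<close>, a congruence modulo \<open>M\<close> becomes one modulo \<open>N * M\<close> for
  the form with the denominator cleared.\<close>

lemma QF_pullback: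
  assumes "QF V' P" and A: "QF V A" and h: "\<And>i. i \<in> V' \<Longrightarrow> qlin V A (\<lambda>e. h e i)"
  shows "QF V {e \<in> A. h e \<in> P}"
  using assms(1)
proof (induction rule: QF.induct)
  case (QF_ge L)
  have "qlin V A (\<lambda>e. L (h e))" by (rule qlin_compose[OF QF_ge h])
  from QF_qlin_le[OF A qlin_LF[OF LF_zero] this] show ?case by simp
next
  case (QF_dvg L M)
  have "qlin V A (\<lambda>e. L (h e))" by (rule qlin_compose[OF QF_dvg(1) h])
  then obtain N K where K: "0 < N" "K \<in> LF V" "\<And>e. e \<in> A \<Longrightarrow> N \<cdot> L (h e) = K e" unfolding qlin_def by blast
  have "{e \<in> A. h e \<in> {e. dvg M (L e)}} = A \<inter> {e. dvg (N * M) (K e)}"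
    using K(3)[symmetric] by (auto simp: dvg_cancel[OF K(1)])
  then show ?case using A K QF_dvg(2) by (auto intro!: QF_Int QF.QF_dvg)
next
  case (QF_Compl P)
  have "{e \<in> A. h e \<in> - P} = A - {e \<in> A. h e \<in> P}" by auto
  then show ?case using QF_Diff[OF A QF_Compl(2)] by simp
next
  case (QF_Int P Q)
  have "{e \<in> A. h e \<in> P \<inter> Q} = {e \<in> A. h e \<in> P} \<inter> {e \<in> A. h e \<in> Q}" by auto
  then show ?case using QF.QF_Int[OF QF_Int(3,4)] by simp
qed

section \<open>Finite disjoint unions\<close>

inductive fdu :: "'b set set \<Rightarrow> 'b set \<Rightarrow> bool" for S where
  fdu_empty: "fdu S {}"
| fdu_base: "A \<in> S \<Longrightarrow> fdu S A"
| fdu_Un: "fdu S A \<Longrightarrow> fdu S B \<Longrightarrow> A \<inter> B = {} \<Longrightarrow> fdu S (A \<union> B)"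

lemma fdu_UN:
  "finite I \<Longrightarrow> (\<And>i. i \<in> I \<Longrightarrow> fdu S (A i)) \<Longrightarrow> disjoint_family_on A I \<Longrightarrow> fdu S (\<Union>i\<in>I. A i)"
proof (induction I rule: finite_induct)
  case (insert i I)
  have "A i \<inter> (\<Union>i\<in>I. A i) = {}" using insert by (auto simp: disjoint_family_on_def)
  moreover have "fdu S (\<Union>i\<in>I. A i)" using insert by (auto simp: disjoint_family_on_def)
  ultimately show ?case using insert by (auto intro: fdu_Un)
qed (auto intro: fdu_empty)

lemma fdu_split: "fdu S (A \<inter> Z) \<Longrightarrow> fdu S (A - Z) \<Longrightarrow> fdu S A"
  using fdu_Un[of S "A \<inter> Z" "A - Z"] by (simp add: Int_Diff_Un Int_Diff_disjoint)

text \<open>Decompositions are refined piece by piece: it suffices to treat the part of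
  \<open>C\<close> in each piece. With \<open>C = UNIV\<close> this turns pieces of one kind into
  pieces of another.\<close>

lemma fdu_induct_set:
  assumes "fdu S A" "\<And>B. B \<in> S \<Longrightarrow> B \<subseteq> A \<Longrightarrow> fdu T (B \<inter> C)"
  shows "fdu T (A \<inter> C)"
  using assms
proof (induction rule: fdu.induct)
  case (fdu_Un A B)
  have "fdu T (A \<inter> C)" "fdu T (B \<inter> C)" using fdu_Un by blast+
  then have "fdu T ((A \<inter> C) \<union> (B \<inter> C))" using fdu_Un.hyps(3) by (intro fdu.fdu_Un) auto
  then show ?case by (simp add: Int_Un_distrib2)
qed (auto intro: fdu_empty)

lemma fdu_Int:
  assumes "\<And>A B. A \<in> S \<Longrightarrow> B \<in> S \<Longrightarrow> fdu S (A \<inter> B)" "fdu S A" "fdu S B"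
  shows "fdu S (A \<inter> B)"
proof (rule fdu_induct_set[OF assms(2)])
  fix C assume "C \<in> S"
  then show "fdu S (C \<inter> B)"
    using fdu_induct_set[OF assms(3), of S C] assms(1) by (simp add: Int_commute)
qed

lemma fdu_partition: "fdu S A \<Longrightarrow> \<exists>P. finite P \<and> partition_on A P \<and> P \<subseteq> S"
proof (induction rule: fdu.induct)
  case fdu_empty
  show ?case by (rule exI[of _ "{}"]) (auto simp: partition_on_def)
next
  case (fdu_base A)
  show ?case
  proof (cases "A = {}")
    case True
    then show ?thesis by (intro exI[of _ "{}"]) (simp add: partition_on_def)
  next
    case False
    then show ?thesis using fdu_base by (intro exI[of _ "{A}"]) (simp add: partition_on_def)
  qed
next
  case (fdu_Un A B)
  then obtain P Q where "finite P" "partition_on A P" "P \<subseteq> S" "finite Q" "partition_on B Q" "Q \<subseteq> S"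
    by blast
  moreover from this have "partition_on (A \<union> B) (P \<union> Q)"
    using fdu_Un.hyps(3) by (simp add: partition_on_def disjoint_union)
  ultimately show ?case by blast
qed

text \<open>By division with remainder the \<open>K\<close> residue classes of \<open>u\<close>
  cover everything, and uniqueness of residues makes them disjoint.\<close>

lemma (in zgroup) fdu_residues:
  fixes u :: "(nat \<Rightarrow> 'a) \<Rightarrow> 'a"
  assumes "0 < K" "\<And>r. r \<in> {0..<K} \<Longrightarrow> fdu S (A \<inter> {e. dvg K (u e - r \<cdot> 1)})"
  shows "fdu S A"
proof -
  have "A = (\<Union>r\<in>{0..<K}. A \<inter> {e. dvg K (u e - r \<cdot> 1)})"
    using residue_ex[OF assms(1)] by fastforce
  moreover have "disjoint_family_on (\<lambda>r. A \<inter> {e. dvg K (u e - r \<cdot> 1)}) {0..<K}"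
    unfolding disjoint_family_on_def using residue_unique by blast
  ultimately show ?thesis using fdu_UN[of "{0..<K}" S "\<lambda>r. A \<inter> {e. dvg K (u e - r \<cdot> 1)}"] assms(2)
    by simp
qed

section \<open>Cells and quantifier elimination\<close>

text \<open>A bound x \<ge> L/M is kept in the form L \<le> M x; \<open>UNIV\<close> means that
  there is no bound.\<close>

definition lowb :: "nat set \<Rightarrow> nat \<Rightarrow> (nat \<Rightarrow> 'a::{linordered_ab_group_add,one}) set set" where
  "lowb V t = insert UNIV {{e. L e \<le> M \<cdot> e t} | L M. L \<in> LF V \<and> 0 < M}"

definition upb :: "nat set \<Rightarrow> nat \<Rightarrow> (nat \<Rightarrow> 'a::{linordered_ab_group_add,one}) set set" where
  "upb V t = insert UNIV {{e. M \<cdot> e t \<le> L e} | L M. L \<in> LF V \<and> 0 < M}"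

lemma lowbI: "L \<in> LF V \<Longrightarrow> 0 < M \<Longrightarrow> {e. L e \<le> M \<cdot> e t} \<in> lowb V t"
  unfolding lowb_def by (rule insertI2) blast

lemma upbI: "L \<in> LF V \<Longrightarrow> 0 < M \<Longrightarrow> {e. M \<cdot> e t \<le> L e} \<in> upb V t"
  unfolding upb_def by (rule insertI2) blast

text \<open>At most one bound on each side and a single congruence, whose residue is a fixed integer
  rather than a form in the other coordinates. The latter allows the coordinate \<open>t\<close> to
  be rescaled by itself later on.\<close>

definition cells :: "nat set \<Rightarrow> nat \<Rightarrow> (nat \<Rightarrow> 'a::{linordered_ab_group_add,one}) set set" where
  "cells V t = {Y \<inter> Lo \<inter> Up \<inter> {e. dvg N (e t - c \<cdot> 1)} | Y Lo Up N c.
     QF V Y \<and> Lo \<in> lowb V t \<and> Up \<in> upb V t \<and> 0 < N}"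

lemma cellsI:
  "QF V Y \<Longrightarrow> Lo \<in> lowb V t \<Longrightarrow> Up \<in> upb V t \<Longrightarrow> 0 < N \<Longrightarrow> 
   C = Y \<inter> Lo \<inter> Up \<inter> {e. dvg N (e t - c \<cdot> 1)} \<Longrightarrow> C \<in> cells V t"
  unfolding cells_def by blast

text \<open>Transitivity in l'/M' \<le> l/M \<le> x with the denominators multiplied out.\<close>

lemma fraction_le_trans:
  fixes x :: "'a::linordered_ab_group_add"
  assumes "M \<cdot> l' \<le> M' \<cdot> l" "l \<le> M \<cdot> x" "0 < M" "0 < M'" shows "l' \<le> M' \<cdot> x"
proof -
  have "M' \<cdot> l \<le> M' \<cdot> M \<cdot> x" using assms zmult_le_iff by blast
  then have "M \<cdot> l' \<le> M \<cdot> M' \<cdot> x" using assms(1) by (simp add: mult.commute)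
  then show ?thesis using assms zmult_le_iff by blast
qed

text \<open>\<open>Z\<close> is where the first bound is the stronger one. There it implies the
  second, and outside \<open>Z\<close> the second implies the first.\<close>

lemma lowb_Int:
  assumes "Lo \<in> lowb V t" "Lo' \<in> lowb V t"
  shows "\<exists>Z. QF V Z \<and> Lo \<inter> Lo' \<inter> Z = Lo \<inter> Z \<and> Lo \<inter> Lo' - Z = Lo' - Z"
proof (cases "Lo = UNIV \<or> Lo' = UNIV")
  case True
  then show ?thesis using QF_UNIV QF_empty by (metis Diff_UNIV Diff_empty Int_UNIV_left Int_UNIV_right Int_empty_right)
next
  case False
  then obtain L M L' M' where *: "Lo = {e. L e \<le> M \<cdot> e t}" "Lo' = {e. L' e \<le> M' \<cdot> e t}"
    "L \<in> LF V" "L' \<in> LF V" "0 < M" "0 < M'"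
    using assms unfolding lowb_def by blast
  show ?thesis
  proof (intro exI conjI)
    show "QF V {e. M \<cdot> L' e \<le> M' \<cdot> L e}" using * by (intro QF_le LF_scale)
    show "Lo \<inter> Lo' \<inter> {e. M \<cdot> L' e \<le> M' \<cdot> L e} = Lo \<inter> {e. M \<cdot> L' e \<le> M' \<cdot> L e}"
      using fraction_le_trans[OF _ _ *(5,6)] unfolding * by blast
    have "\<not> M \<cdot> L' e \<le> M' \<cdot> L e \<Longrightarrow> M' \<cdot> L e \<le> M \<cdot> L' e" for e by simp
    then show "Lo \<inter> Lo' - {e. M \<cdot> L' e \<le> M' \<cdot> L e} = Lo' - {e. M \<cdot> L' e \<le> M' \<cdot> L e}"
      using fraction_le_trans[OF _ _ *(6,5)] unfolding * by blast
  qed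
qed

lemma upb_Int:
  assumes "Up \<in> upb V t" "Up' \<in> upb V t"
  shows "\<exists>Z. QF V Z \<and> Up \<inter> Up' \<inter> Z = Up \<inter> Z \<and> Up \<inter> Up' - Z = Up' - Z"
proof (cases "Up = UNIV \<or> Up' = UNIV")
  case True
  then show ?thesis using QF_UNIV QF_empty by (metis Diff_UNIV Diff_empty Int_UNIV_left Int_UNIV_right Int_empty_right)
next
  case False
  then obtain L M L' M' where *: "Up = {e. M \<cdot> e t \<le> L e}" "Up' = {e. M' \<cdot> e t \<le> L' e}"
    "L \<in> LF V" "L' \<in> LF V" "0 < M" "0 < M'"
    using assms unfolding upb_def by blast
  \<comment> \<open>The mirror image of \<open>fraction_le_trans\<close>, obtained by negating
    everything.\<close>
  have ft: "M' \<cdot> x \<le> l'" if "M' \<cdot> l \<le> M \<cdot> l'" "M \<cdot> x \<le> l" "0 < M" "0 < M'" for M M' and x l l' :: 'a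
    using fraction_le_trans[of M "- l'" M' "- l" "- x"] that by (simp add: zs)
  show ?thesis
  proof (intro exI conjI)
    show "QF V {e. M' \<cdot> L e \<le> M \<cdot> L' e}" using * by (intro QF_le LF_scale)
    show "Up \<inter> Up' \<inter> {e. M' \<cdot> L e \<le> M \<cdot> L' e} = Up \<inter> {e. M' \<cdot> L e \<le> M \<cdot> L' e}"
      using ft[OF _ _ *(5,6)] unfolding * by blast
    have "\<not> M' \<cdot> L e \<le> M \<cdot> L' e \<Longrightarrow> M \<cdot> L' e \<le> M' \<cdot> L e" for e by simp
    then show "Up \<inter> Up' - {e. M' \<cdot> L e \<le> M \<cdot> L' e} = Up' - {e. M' \<cdot> L e \<le> M \<cdot> L' e}"
      using ft[OF _ _ *(6,5)] unfolding * by blast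
  qed
qed

section \<open>Cell decomposition and projection along one coordinate\<close>

context zgroup
begin

text \<open>Four cases, according to which lower and which upper bound is the stronger, each again
  with a single bound on either side. The two congruences are merged modulo
  \<open>N * N'\<close>.\<close>

lemma cells_Int:
  fixes C C' :: "(nat \<Rightarrow> 'a) set"
  assumes "C \<in> cells V t" "C' \<in> cells V t" shows "fdu (cells V t) (C \<inter> C')"
proof -
  obtain Y Lo Up N c where C: "C = Y \<inter> Lo \<inter> Up \<inter> {e. dvg N (e t - c \<cdot> 1)}"
    "QF V Y" "Lo \<in> lowb V t" "Up \<in> upb V t" "0 < N" using assms(1) unfolding cells_def by blast
  obtain Y' Lo' Up' N' c' where C': "C' = Y' \<inter> Lo' \<inter> Up' \<inter> {e. dvg N' (e t - c' \<cdot> 1)}"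
    "QF V Y'" "Lo' \<in> lowb V t" "Up' \<in> upb V t" "0 < N'" using assms(2) unfolding cells_def by blast
  obtain Z where Z: "QF V Z" "Lo \<inter> Lo' \<inter> Z = Lo \<inter> Z" "Lo \<inter> Lo' - Z = Lo' - Z"
    using lowb_Int[OF C(3) C'(3)] by blast
  obtain Z' where Z': "QF V Z'" "Up \<inter> Up' \<inter> Z' = Up \<inter> Z'" "Up \<inter> Up' - Z' = Up' - Z'"
    using upb_Int[OF C(4) C'(4)] by blast
  let ?c = "{e. dvg N (e t - c \<cdot> 1)} \<inter> {e. dvg N' (e t - c' \<cdot> (1::'a))}"
  have *: "fdu (cells V t) (X \<inter> P \<inter> Q \<inter> ?c)" 
    if "QF V X" "P \<in> lowb V t" "Q \<in> upb V t" for X P Q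
  proof (rule fdu_residues[of "N * N'"])
    show "0 < N * N'" using C C' by simp
    fix r
    let ?r = "{e. dvg (N * N') (e t - r \<cdot> (1::'a))}"
    have sub: "dvg M (e t - d \<cdot> 1) \<longleftrightarrow> dvg M (r \<cdot> 1 - d \<cdot> (1::'a))" 
      if "M dvd N * N'" "e \<in> ?r" for M d and e :: "nat \<Rightarrow> 'a"
      using dvg_diff_iff[of M "e t - r \<cdot> 1" "e t - d \<cdot> 1"] dvg_trans[OF that(1), of "e t - r \<cdot> 1"] that(2)
        dvg_diff_iff[of M "e t - r \<cdot> 1" "r \<cdot> 1 - d \<cdot> 1 + (e t - r \<cdot> 1)"] by (simp add: algebra_simps)
    \<comment> \<open>The residue modulo \<open>N * N'\<close> decides both congruences, so a class
      is either unaffected by them or excluded.\<close>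
    have "X \<inter> P \<inter> Q \<inter> ?c \<inter> ?r = X \<inter> P \<inter> Q \<inter> ?r \<or> X \<inter> P \<inter> Q \<inter> ?c \<inter> ?r = {}"
    proof (cases "dvg N (r \<cdot> 1 - c \<cdot> (1::'a)) \<and> dvg N' (r \<cdot> 1 - c' \<cdot> (1::'a))")
      case True
      then show ?thesis using sub[of N] sub[of N'] by auto
    next
      case False
      then show ?thesis using sub[of N] sub[of N'] by auto
    qed
    moreover have "X \<inter> P \<inter> Q \<inter> ?r \<in> cells V t" using that C(5) C'(5) by (intro cellsI) auto
    ultimately show "fdu (cells V t) (X \<inter> P \<inter> Q \<inter> ?c \<inter> ?r)" by (auto intro: fdu_base fdu_empty)
  qed
  have Y: "QF V (Y \<inter> Y' \<inter> Z \<inter> Z')" "QF V (Y \<inter> Y' \<inter> Z - Z')" "QF V (Y \<inter> Y' \<inter> Z' - Z)" "QF V (Y \<inter> Y' - Z - Z')"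
    using C C' Z Z' by (auto intro!: QF_Int QF_Diff)
  have "fdu (cells V t) (C \<inter> C' \<inter> Z)"
  proof (rule fdu_split[where Z = Z'])
    have "C \<inter> C' \<inter> Z \<inter> Z' = (Y \<inter> Y' \<inter> Z \<inter> Z') \<inter> Lo \<inter> Up \<inter> ?c" using Z(2,3) Z'(2,3) unfolding C C' by blast
    then show "fdu (cells V t) (C \<inter> C' \<inter> Z \<inter> Z')" using *[OF Y(1) C(3,4)] by simp
    have "C \<inter> C' \<inter> Z - Z' = (Y \<inter> Y' \<inter> Z - Z') \<inter> Lo \<inter> Up' \<inter> ?c" using Z(2,3) Z'(2,3) unfolding C C' by blast
    then show "fdu (cells V t) (C \<inter> C' \<inter> Z - Z')" using *[OF Y(2) C(3) C'(4)] by simp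
  qed
  moreover have "fdu (cells V t) (C \<inter> C' - Z)"
  proof (rule fdu_split[where Z = Z'])
    have "(C \<inter> C' - Z) \<inter> Z' = (Y \<inter> Y' \<inter> Z' - Z) \<inter> Lo' \<inter> Up \<inter> ?c" using Z(2,3) Z'(2,3) unfolding C C' by blast
    then show "fdu (cells V t) ((C \<inter> C' - Z) \<inter> Z')" using *[OF Y(3) C'(3) C(4)] by simp
    have "C \<inter> C' - Z - Z' = (Y \<inter> Y' - Z - Z') \<inter> Lo' \<inter> Up' \<inter> ?c" using Z(2,3) Z'(2,3) unfolding C C' by blast
    then show "fdu (cells V t) (C \<inter> C' - Z - Z')" using *[OF Y(4) C'(3,4)] by simp
  qed
  ultimately show ?thesis by (rule fdu_split)
qed

text \<open>The sign of the coefficient of \<open>t\<close> decides whether the inequality is a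
  lower bound, an upper bound or a condition on the base. The congruence modulo 1 is
  vacuous.\<close>

lemma cells_ge:
  fixes L :: "(nat \<Rightarrow> 'a) \<Rightarrow> 'a"
  assumes "L \<in> LF (insert t V)" shows "{e. 0 \<le> L e} \<in> cells V t"
proof -
  obtain a L' where L': "L' \<in> LF V" "\<And>e. L e = a \<cdot> e t + L' e" using LF_split_var[OF assms] by blast
  have U: "UNIV \<in> lowb V t" "UNIV \<in> upb V t" by (auto simp: lowb_def upb_def)
  have d1: "dvg 1 x" for x :: 'a unfolding dvg_def by (metis zm.scale_one)
  have nn: "- x \<le> y \<longleftrightarrow> 0 \<le> y + x" for x y :: 'a
    by (metis diff_ge_0_iff_ge diff_minus_eq_add)
  consider "a > 0" | "a < 0" | "a = 0" by linarith
  then show ?thesis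
  proof cases
    case 1
    have "{e. - L' e \<le> a \<cdot> e t} \<in> lowb V t" using 1 L'(1) by (intro lowbI LF_minus)
    then show ?thesis using U QF_UNIV
      by (rule_tac cellsI[of V UNIV "{e. - L' e \<le> a \<cdot> e t}" t UNIV 1 _ 0]) (auto simp: L'(2) d1 nn)
  next
    case 2
    have "{e. (- a) \<cdot> e t \<le> L' e} \<in> upb V t" using 2 L'(1) by (intro upbI) auto
    then show ?thesis using U QF_UNIV
      by (rule_tac cellsI[of V UNIV UNIV t "{e. (- a) \<cdot> e t \<le> L' e}" 1 _ 0]) (auto simp: L'(2) d1 zs nn[of "a \<cdot> _"] add.commute)
  next
    case 3
    then show ?thesis using U QF_ge[OF L'(1)]
      by (rule_tac cellsI[of V "{e. 0 \<le> L' e}" UNIV t UNIV 1 _ 0]) (auto simp: L'(2) d1)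
  qed
qed

text \<open>Complements are carried along because the complement of a disjoint union of cells is not
  evidently one again; the case \<open>QF_Compl\<close> then merely exchanges the two
  claims.\<close>

lemma fdu_cells_QF:
  fixes A :: "(nat \<Rightarrow> 'a) set"
  assumes "QF (insert t V) A" shows "fdu (cells V t) A \<and> fdu (cells V t) (- A)"
  using assms
proof (induction rule: QF.induct)
  case (QF_ge L)
  have eq: "- {e. 0 \<le> L e} = {e. 0 \<le> (- 1) \<cdot> L e + - 1}"
  proof -
    \<comment> \<open>By discreteness x < 0 means x \<le> -1, so the complement of a half-space is
      again a half-space.\<close>
    have "\<not> 0 \<le> x \<longleftrightarrow> 0 \<le> (- 1) \<cdot> x + - 1" for x :: 'a
    proof -
      have "(- 1) \<cdot> x + - 1 = - (x + 1)" by simp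
      then show ?thesis using less_iff[of x 0] by (simp only: not_le neg_0_le_iff_le)
    qed
    then show ?thesis by auto
  qed
  have "(\<lambda>e. (- 1) \<cdot> L e + - 1) \<in> LF (insert t V)" by (intro LF_intros QF_ge)
  then have "fdu (cells V t) (- {e. 0 \<le> L e})" unfolding eq by (intro fdu_base cells_ge)
  then show ?case using fdu_base[OF cells_ge[OF QF_ge]] by blast
next
  case (QF_dvg L N)
  obtain a L' where L': "L' \<in> LF V" "\<And>e. L e = a \<cdot> e t + L' e" using LF_split_var[OF QF_dvg(1)] by blast
  have U: "UNIV \<in> lowb V t" "UNIV \<in> upb V t" by (auto simp: lowb_def upb_def)
  let ?Y = "\<lambda>r. {e. dvg N ((a * r) \<cdot> 1 + L' e)}"
  have Y: "QF V (?Y r)" for r using L'(1) QF_dvg(2) by (intro QF.QF_dvg LF_intros)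
  \<comment> \<open>On the class of \<open>r\<close> the coordinate \<open>t\<close> may be replaced
    by \<open>r\<close>, which leaves a condition on the base.\<close>
  have *: "dvg N (L e) \<longleftrightarrow> e \<in> ?Y r" if "dvg N (e t - r \<cdot> 1)" for e r
    using dvg_diff_iff[of N "a \<cdot> (e t - r \<cdot> 1)" "L e"] dvg_mult[OF that] by (simp add: L'(2) zs algebra_simps)
  have "fdu (cells V t) {e. dvg N (L e)}"
  proof (rule fdu_residues[OF QF_dvg(2)], rule fdu_base)
    fix r show "{e. dvg N (L e)} \<inter> {e. dvg N (e t - r \<cdot> 1)} \<in> cells V t"
      by (rule cellsI[OF Y[of r] U QF_dvg(2)]) (use * in auto)
  qed
  moreover have "fdu (cells V t) (- {e. dvg N (L e)})"
  proof (rule fdu_residues[OF QF_dvg(2)], rule fdu_base)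
    fix r show "- {e. dvg N (L e)} \<inter> {e. dvg N (e t - r \<cdot> 1)} \<in> cells V t"
      by (rule cellsI[OF QF_Compl[OF Y[of r]] U QF_dvg(2)]) (use * in auto)
  qed
  ultimately show ?case by blast
next
  case (QF_Int A B)
  have Int: "fdu (cells V t) (P \<inter> Q)" if "fdu (cells V t) P" "fdu (cells V t) Q" for P Q :: "(nat \<Rightarrow> 'a) set"
    using that by (rule fdu_Int[rotated]) (rule cells_Int)
  \<comment> \<open>The complement of the intersection has to be written as a disjoint
    union.\<close>
  have "fdu (cells V t) (- A \<union> (A \<inter> - B))"
    using QF_Int by (intro fdu_Un Int) auto
  moreover have "- A \<union> (A \<inter> - B) = - (A \<inter> B)" by auto
  ultimately show ?case using Int[of A B] QF_Int by simp
next
  case (QF_Compl A)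
  then show ?case by simp
qed

text \<open>Among the x of the right residue there is a least one with L \<le> M x, and for it M x =
  L + r with 0 \<le> r < M N. A solution exists over a point of the base exactly if this x respects
  the upper bound, and running through the finitely many r removes the quantifier. If one of the
  bounds is missing, there is always a solution.\<close>

lemma cell_project:
  fixes C :: "(nat \<Rightarrow> 'a) set"
  assumes "C \<in> cells V t" "t \<notin> V" shows "QF V {e. \<exists>x. e(t := x) \<in> C}"
proof -
  obtain Y Lo Up N c where C: "C = Y \<inter> Lo \<inter> Up \<inter> {e. dvg N (e t - c \<cdot> 1)}"
    "QF V Y" "Lo \<in> lowb V t" "Up \<in> upb V t" "0 < N" using assms(1) unfolding cells_def by blast
  have upd: "L (e(t := x)) = L e" if "L \<in> LF V" for L and e :: "nat \<Rightarrow> 'a" and x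
    by (rule LF_local[OF that]) (use assms(2) in auto)
  note Yupd = QF_upd[OF C(2) assms(2)]
  \<comment> \<open>For x congruent to c modulo N the values M x form the class of M c modulo M N;
    \<open>y + r\<close> is the first of them that is not below \<open>y\<close>.\<close>
  have res: "\<exists>r\<in>{0..<M * N}. \<exists>z. y + r \<cdot> 1 = M \<cdot> c \<cdot> 1 + (M * N) \<cdot> z" if "0 < M" for M and y :: 'a
  proof -
    have "0 < M * N" using that C(5) by simp
    from residue_ex[OF this]
    obtain r where "r \<in> {0..<M * N}" "dvg (M * N) ((M \<cdot> c \<cdot> 1 - y) - r \<cdot> 1)" by blast
    then obtain z where "M \<cdot> c \<cdot> 1 - y - r \<cdot> 1 = (M * N) \<cdot> z" by (auto simp: dvg_def)
    then have "y + r \<cdot> 1 = M \<cdot> c \<cdot> 1 + (M * N) \<cdot> (- z)" by (simp add: zs algebra_simps)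
    then show ?thesis using \<open>r \<in> _\<close> by blast
  qed
  have d: "dvg N ((c \<cdot> 1 + N \<cdot> z) - c \<cdot> (1::'a))" for z by (simp add: dvg_scale)
  consider (none) "Lo = UNIV" "Up = UNIV" 
    | (lo) L M where "Lo = {e. L e \<le> M \<cdot> e t}" "L \<in> LF V" "0 < M" "Up = UNIV"
    | (up) L M where "Up = {e. M \<cdot> e t \<le> L e}" "L \<in> LF V" "0 < M" "Lo = UNIV"
    | (both) L M L' M' where "Lo = {e. L e \<le> M \<cdot> e t}" "L \<in> LF V" "0 < M"
      "Up = {e. M' \<cdot> e t \<le> L' e}" "L' \<in> LF V" "0 < M'"
    using C(3,4) unfolding lowb_def upb_def by blast
  then show ?thesis
  proof cases
    case none
    have "\<exists>x. dvg N (x - c \<cdot> (1::'a))" using d by blast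
    then have "{e. \<exists>x. e(t := x) \<in> C} = Y" using none Yupd unfolding C(1) by auto
    then show ?thesis using C(2) by simp
  next
    case lo
    have "\<exists>x. L e \<le> M \<cdot> x \<and> dvg N (x - c \<cdot> 1)" for e
    proof -
      obtain r z where r: "r \<in> {0..<M * N}" "L e + r \<cdot> 1 = M \<cdot> c \<cdot> 1 + (M * N) \<cdot> z"
        using res[OF lo(3)] by blast
      have "0 \<le> r \<cdot> (1::'a)" using int_one_le[of 0 r] r(1) by simp
      then have "L e \<le> L e + r \<cdot> 1" by simp
      then have "L e \<le> M \<cdot> (c \<cdot> 1 + N \<cdot> z)" unfolding r(2) by (simp add: zs)
      then show ?thesis using d by blast
    qed
    then have "{e. \<exists>x. e(t := x) \<in> C} = Y" using Yupd unfolding C(1) lo using upd[OF lo(2)] by auto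
    then show ?thesis using C(2) by simp
  next
    case up
    have "\<exists>x. M \<cdot> x \<le> L e \<and> dvg N (x - c \<cdot> 1)" for e
    proof -
      \<comment> \<open>Starting one period lower, the first value found is still at most L, because
        r is less than M N.\<close>
      obtain r z where r: "r \<in> {0..<M * N}" "(L e - (M * N) \<cdot> 1) + r \<cdot> 1 = M \<cdot> c \<cdot> 1 + (M * N) \<cdot> z"
        using res[OF up(3)] by blast
      have "r \<cdot> (1::'a) \<le> (M * N) \<cdot> 1" using int_one_le[of r "M * N"] r(1) by simp
      moreover have "L e - M \<cdot> (c \<cdot> 1 + N \<cdot> z) = (M * N) \<cdot> 1 - r \<cdot> 1" using r(2) by (simp add: zs algebra_simps)
      ultimately have "M \<cdot> (c \<cdot> 1 + N \<cdot> z) \<le> L e" by (metis diff_ge_0_iff_ge)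
      then show ?thesis using d by blast
    qed
    then have "{e. \<exists>x. e(t := x) \<in> C} = Y" using Yupd unfolding C(1) up using upd[OF up(2)] by auto
    then show ?thesis using C(2) by simp
  next
    case both
    let ?P = "\<lambda>r. {e. dvg (M * N) (L e + r \<cdot> 1 - M \<cdot> c \<cdot> 1)} \<inter> {e. M' \<cdot> (L e + r \<cdot> 1) \<le> M \<cdot> L' e}"
    have "{e. \<exists>x. e(t := x) \<in> C} = Y \<inter> (\<Union>r\<in>{0..<M * N}. ?P r)"
    proof (rule set_eqI)
      fix e
      have "(\<exists>x. L e \<le> M \<cdot> x \<and> M' \<cdot> x \<le> L' e \<and> dvg N (x - c \<cdot> 1)) \<longleftrightarrow> (\<exists>r\<in>{0..<M * N}. e \<in> ?P r)" (is "?l = ?r")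
      proof
        assume ?l
        then obtain x s where x: "L e \<le> M \<cdot> x" "M' \<cdot> x \<le> L' e" "x - c \<cdot> 1 = N \<cdot> s" by (auto simp: dvg_def)
        obtain r z where r: "r \<in> {0..<M * N}" "L e + r \<cdot> 1 = M \<cdot> c \<cdot> 1 + (M * N) \<cdot> z"
          using res[OF both(3)] by blast
        have x': "x = c \<cdot> 1 + N \<cdot> s" using x(3) by (simp add: algebra_simps)
        \<comment> \<open>Minimality of the ceiling: \<open>z\<close> belongs to the least
          candidate, \<open>s\<close> to the given solution.\<close>
        have "z \<le> s"
        proof (subst ceil_le_iff[symmetric])
          show "L e - M \<cdot> c \<cdot> 1 + r \<cdot> 1 = (M * N) \<cdot> z" using r(2) by (simp add: algebra_simps)
          show "L e - M \<cdot> c \<cdot> 1 \<le> (M * N) \<cdot> s" using x(1) unfolding x' by (simp add: zs algebra_simps)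
        qed (use r in auto)
        then have "(M * N) \<cdot> z \<le> (M * N) \<cdot> s" using both(3) C(5) by (subst zmult_le_iff) auto
        then have "L e + r \<cdot> 1 \<le> M \<cdot> x" unfolding r x' by (simp add: zs)
        then have "M' \<cdot> (L e + r \<cdot> 1) \<le> M' \<cdot> M \<cdot> x" using zmult_le_iff[OF both(6)] by blast
        also have "\<dots> = M \<cdot> M' \<cdot> x" by (simp add: mult.commute)
        also have "\<dots> \<le> M \<cdot> L' e" using x(2) zmult_le_iff[OF both(3)] by blast
        finally have "e \<in> ?P r" using r(2) by (simp add: dvg_scale)
        then show ?r using r(1) by blast
      next
        assume ?r
        then obtain r z where r: "r \<in> {0..<M * N}" "L e + r \<cdot> 1 - M \<cdot> c \<cdot> 1 = (M * N) \<cdot> z"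
          "M' \<cdot> (L e + r \<cdot> 1) \<le> M \<cdot> L' e" by (auto simp: dvg_def)
        let ?x = "c \<cdot> 1 + N \<cdot> z"
        have Mx: "M \<cdot> ?x = L e + r \<cdot> 1" using r(2) by (simp add: zs algebra_simps)
        have "0 \<le> r \<cdot> (1::'a)" using int_one_le[of 0 r] r(1) by simp
        then have "L e \<le> M \<cdot> ?x" unfolding Mx by simp
        moreover have "M \<cdot> M' \<cdot> ?x \<le> M \<cdot> L' e" using r(3) unfolding Mx[symmetric] by (simp add: mult.commute)
        then have "M' \<cdot> ?x \<le> L' e" using zmult_le_iff[OF both(3)] by blast
        ultimately show ?l using d by blast
      qed
      then show "e \<in> {e. \<exists>x. e(t := x) \<in> C} \<longleftrightarrow> e \<in> Y \<inter> (\<Union>r\<in>{0..<M * N}. ?P r)"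
        unfolding C(1) both using Yupd upd[OF both(2)] upd[OF both(5)] by auto
    qed
    moreover have "QF V (Y \<inter> (\<Union>r\<in>{0..<M * N}. ?P r))"
      using both C by (intro QF_Int QF_UN QF_le QF_dvg LF_intros) auto
    ultimately show ?thesis by simp
  qed
qed

lemma QF_project:
  fixes A :: "(nat \<Rightarrow> 'a) set"
  assumes "QF (insert t V) A" "t \<notin> V" shows "QF V {e. \<exists>x. e(t := x) \<in> A}"
proof -
  have "fdu (cells V t) A" using fdu_cells_QF assms by blast
  then show ?thesis
  proof (induction rule: fdu.induct)
    case (fdu_Un A B)
    have "{e. \<exists>x. e(t := x) \<in> A \<union> B} = {e. \<exists>x. e(t := x) \<in> A} \<union> {e. \<exists>x. e(t := x) \<in> B}" by auto
    then show ?case using QF_Un[OF fdu_Un.IH] by (simp only:)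
  next
    case (fdu_base A)
    then show ?case using assms(2) by (rule cell_project)
  qed (simp add: QF_empty)
qed

section \<open>Quantifier elimination for formulas\<close>

lemma LF_tval: "tvars s \<subseteq> V \<Longrightarrow> (\<lambda>e::nat \<Rightarrow> 'a. tval e s) \<in> LF V"
  by (induction s) (auto intro: LF_intros)

text \<open>Projection of quantifier-free sets handles the existential quantifier. Together with
  \<open>sat_QF\<close> this identifies definability without parameters with
  \<open>QF\<close>.\<close>

lemma QF_sat: "fvars \<phi> \<subseteq> V \<Longrightarrow> QF V {e::nat \<Rightarrow> 'a. sat e \<phi>}"
proof (induction \<phi> arbitrary: V)
  case (Cong n s t)
  have "QF V {e::nat \<Rightarrow> 'a. dvg (int (Suc n)) (tval e s - tval e t)}"
    using Cong by (intro QF_dvg LF_intros LF_tval) auto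
  then show ?case by (simp add: gcong_dvg del: of_nat_Suc)
next
  case (Neg \<phi>)
  then show ?case using QF_Compl[of V "{e::nat \<Rightarrow> 'a. sat e \<phi>}"] by (simp add: Compl_eq)
next
  case (Conj \<phi> \<psi>)
  then show ?case using QF_Int[of V "{e::nat \<Rightarrow> 'a. sat e \<phi>}" "{e. sat e \<psi>}"] by (simp add: Collect_conj_eq)
next
  case (Exists i \<phi>)
  have "QF (V - {i}) {e. \<exists>x. e(i := x) \<in> {e::nat \<Rightarrow> 'a. sat e \<phi>}}"
    using Exists by (intro QF_project Exists.IH) auto
  then show ?case using QF_mono by fastforce
qed (auto intro!: QF_eq QF_le LF_tval)

text \<open>The language has no subtraction, so a form becomes a pair of terms, one for each side of
  an atom.\<close>

lemma tval_LF: 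
  fixes L :: "(nat \<Rightarrow> 'a) \<Rightarrow> 'a"
  shows "L \<in> LF V \<Longrightarrow> \<exists>s s'. tvars s \<subseteq> V \<and> tvars s' \<subseteq> V \<and> (\<forall>e. L e = tval e s - tval e s')"
proof (induction rule: LF.induct)
  case LF_one
  show ?case by (intro exI[of _ One] exI[of _ Zero]) auto
next
  case (LF_var i)
  then show ?case by (intro exI[of _ "Var i"] exI[of _ Zero]) auto
next
  case (LF_add L L')
  then obtain s s' t t' where "tvars s \<subseteq> V" "tvars s' \<subseteq> V" "\<forall>e. L e = tval e s - tval e s'"
    "tvars t \<subseteq> V" "tvars t' \<subseteq> V" "\<forall>e. L' e = tval e t - tval e t'" by blast
  moreover have "(a - b) + (c - d) = a + c - (b + d)" for a b c d :: 'a by (simp add: algebra_simps)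
  ultimately show ?case by (intro exI[of _ "Add s t"] exI[of _ "Add s' t'"]) auto
next
  case (LF_minus L)
  then obtain s s' where "tvars s \<subseteq> V" "tvars s' \<subseteq> V" "\<forall>e. L e = tval e s - tval e s'" by blast
  then show ?case by (intro exI[of _ s'] exI[of _ s]) auto
qed

lemma sat_QF: 
  fixes A :: "(nat \<Rightarrow> 'a) set"
  shows "QF V A \<Longrightarrow> \<exists>\<phi>. fvars \<phi> \<subseteq> V \<and> A = {e. sat e \<phi>}"
proof (induction rule: QF.induct)
  case (QF_ge L)
  then obtain s s' where "tvars s \<subseteq> V" "tvars s' \<subseteq> V" "\<forall>e. L e = tval e s - tval e s'" 
    using tval_LF by blast
  then show ?case by (intro exI[of _ "Le s' s"]) auto
next
  case (QF_dvg L N)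
  then obtain s s' where "tvars s \<subseteq> V" "tvars s' \<subseteq> V" "\<forall>e. L e = tval e s - tval e s'" 
    using tval_LF by blast
  then show ?case using QF_dvg(2) by (intro exI[of _ "Cong (nat N - 1) s s'"]) (auto simp: gcong_dvg)
next
  case (QF_Compl A)
  then obtain \<phi> where "fvars \<phi> \<subseteq> V" "A = {e. sat e \<phi>}" by blast
  then show ?case by (intro exI[of _ "Neg \<phi>"]) auto
next
  case (QF_Int A B)
  then obtain \<phi> \<psi> where "fvars \<phi> \<subseteq> V" "A = {e. sat e \<phi>}" "fvars \<psi> \<subseteq> V" "B = {e. sat e \<psi>}" by blast
  then show ?case by (intro exI[of _ "Conj \<phi> \<psi>"]) auto
qed

end

section \<open>Integral affine maps\<close>

text \<open>Functions on \<open>A\<close> that are integer combinations of the \<open>(e i - c i) / d i\<close> for \<open>i \<in> W\<close> up to a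
  function of the parameters, which are the coordinates in \<open>V - W\<close>.\<close>

inductive aff :: "(nat \<Rightarrow> int) \<Rightarrow> (nat \<Rightarrow> int) \<Rightarrow> nat set \<Rightarrow> nat set \<Rightarrow> 
    (nat \<Rightarrow> 'a::{linordered_ab_group_add,one}) set \<Rightarrow> ((nat \<Rightarrow> 'a) \<Rightarrow> 'a) \<Rightarrow> bool" for d c V W A where
  aff_var: "i \<in> W \<Longrightarrow> (\<And>e. e \<in> A \<Longrightarrow> d i \<cdot> u e = e i - c i \<cdot> 1) \<Longrightarrow> aff d c V W A u"
| aff_par: "qlin (V - W) A u \<Longrightarrow> aff d c V W A u"
| aff_add: "aff d c V W A u \<Longrightarrow> aff d c V W A v \<Longrightarrow> aff d c V W A (\<lambda>e. u e + v e)"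
| aff_minus: "aff d c V W A u \<Longrightarrow> aff d c V W A (\<lambda>e. - u e)"

abbreviation aff1 where "aff1 \<equiv> aff (\<lambda>_. 1) (\<lambda>_. 0)"

text \<open>The difference of the two functions vanishes on \<open>A\<close> and so counts as a
  function of the parameters.\<close>

lemma aff_cong: 
  assumes "aff d c V W A u" "\<And>e. e \<in> A \<Longrightarrow> u e = v e" shows "aff d c V W A v"
proof -
  have "qlin (V - W) A (\<lambda>e. v e - u e)" by (rule qlinI[of 1 "\<lambda>e. 0"]) (auto simp: LF_zero assms(2))
  then have "aff d c V W A (\<lambda>e. u e + (v e - u e))" by (intro aff_add assms(1)) (rule aff_par)
  then show ?thesis by simp
qed

lemma aff_diff: "aff d c V W A u \<Longrightarrow> aff d c V W A v \<Longrightarrow> aff d c V W A (\<lambda>e. u e - v e)"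
  using aff_add[OF _ aff_minus] by fastforce

lemma aff_const: "aff d c V W A (\<lambda>e. a \<cdot> 1)"
  by (intro aff_par qlin_LF LF_const)

lemma aff_zero: "aff d c V W A (\<lambda>e. 0)"
  using aff_const[of d c V W A 0] by simp

lemma aff_coord: "i \<in> W \<Longrightarrow> d i = 1 \<Longrightarrow> c i = 0 \<Longrightarrow> aff d c V W A (\<lambda>e. e i)"
  by (rule aff_var[of i]) auto

lemma aff_scale: "aff d c V W A u \<Longrightarrow> aff d c V W A (\<lambda>e. a \<cdot> u e)"
proof (induction a rule: int_induct[of _ 0])
  case (step1 i)
  then show ?case using aff_add[of d c V W A "\<lambda>e. i \<cdot> u e" u] by (simp add: zs)
next
  case (step2 i)
  then show ?case using aff_diff[of d c V W A "\<lambda>e. i \<cdot> u e" u] by (simp add: zs)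
qed (simp add: aff_zero)

lemma aff_mono: 
  assumes "aff d c V W A u" "A' \<subseteq> A" "W \<subseteq> W'" "V - W \<subseteq> V' - W'" 
    "\<And>i. i \<in> W \<Longrightarrow> d' i = d i" "\<And>i. i \<in> W \<Longrightarrow> c' i = c i"
  shows "aff d' c' V' W' A' u"
  using assms
proof (induction rule: aff.induct)
  case (aff_var i u)
  then show ?case by (intro aff.aff_var[of i]) auto
qed (auto intro: aff.intros(3,4) aff_par qlin_mono)

lemma aff_subset: "aff d c V W A u \<Longrightarrow> A' \<subseteq> A \<Longrightarrow> aff d c V W A' u"
  by (rule aff_mono) auto

lemma aff_qlin:
  assumes "aff d c V W A u" "W \<subseteq> V" "\<And>i. i \<in> W \<Longrightarrow> 0 < d i" shows "qlin V A u"
  using assms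
proof (induction rule: aff.induct)
  case (aff_var i u)
  then show ?case by (intro qlinI[of "d i" "\<lambda>e. e i - c i \<cdot> 1"] LF_diff LF_var LF_const) auto
next
  case (aff_par u)
  then show ?case by (auto intro: qlin_mono)
qed (simp_all add: qlin_add qlin_minus)

lemma aff_local:
  assumes "aff d c V W A u" "W \<subseteq> V" "\<And>i. i \<in> W \<Longrightarrow> 0 < d i"
    "e \<in> A" "e' \<in> A" "\<And>i. i \<in> V \<Longrightarrow> e i = e' i" 
  shows "u e = u e'"
  by (rule qlin_local[OF aff_qlin[OF assms(1-3)] assms(4-6)])

text \<open>The outer function has all denominators 1, so its coefficients at \<open>W\<close> are
  plain integers and substituting \<open>h\<close> creates no new denominators: those of the
  composition come from \<open>h\<close> alone. Its parameter part is unaffected because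
  \<open>h\<close> fixes the parameters.\<close>

lemma aff_compose:
  assumes "aff1 V W B u" and h: "\<And>e. e \<in> A \<Longrightarrow> h e \<in> B" "\<And>e i. e \<in> A \<Longrightarrow> i \<notin> W \<Longrightarrow> h e i = e i"
    "\<And>i. i \<in> W \<Longrightarrow> aff d c V W A (\<lambda>e. h e i)"
  shows "aff d c V W A (\<lambda>e. u (h e))"
  using assms(1)
proof (induction rule: aff.induct)
  case (aff_var i u)
  show ?case by (rule aff_cong[OF h(3)[OF aff_var(1)]]) (use aff_var(2) h(1) in fastforce)
next
  case (aff_par u)
  then obtain N L where L: "0 < N" "L \<in> LF (V - W)" "\<And>e. e \<in> B \<Longrightarrow> N \<cdot> u e = L e" 
    unfolding qlin_def by blast
  have "L (h e) = L e" if "e \<in> A" for e by (rule LF_local[OF L(2)]) (use h(2)[OF that] in auto)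
  then have "qlin (V - W) A (\<lambda>e. u (h e))" using L h(1) by (intro qlinI[of N L]) auto
  then show ?case by (rule aff.aff_par)
qed (auto intro: aff_add aff_minus)

text \<open>Makes the integer coefficients explicit, given the exact quotients \<open>q\<close>.
  With all denominators 1 this yields the coefficients of a wedge; in general it yields the shape of
  a linear map.\<close>

lemma aff_sum:
  assumes "aff d c V W A u" "finite W" "\<And>i. i \<in> W \<Longrightarrow> 0 < d i"
    "\<And>e i. e \<in> A \<Longrightarrow> i \<in> W \<Longrightarrow> d i \<cdot> q e i = e i - c i \<cdot> 1"
  shows "\<exists>a g. qlin (V - W) A g \<and> (\<forall>e\<in>A. u e = (\<Sum>i\<in>W. a i \<cdot> q e i) + g e)"
  using assms(1)
proof (induction rule: aff.induct)
  case (aff_var j u)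
  have "u e = (\<Sum>i\<in>W. (if i = j then 1 else 0) \<cdot> q e i) + 0" if e: "e \<in> A" for e
  proof -
    have "d j \<cdot> u e = d j \<cdot> q e j" using aff_var assms(4) e by simp
    then have "u e = q e j" using zmult_cancel assms(3) aff_var(1) by blast
    moreover have "(\<Sum>i\<in>W. (if i = j then 1 else 0) \<cdot> q e i) = (\<Sum>i\<in>W. if i = j then q e i else 0)"
      by (rule sum.cong) auto
    ultimately show ?thesis using aff_var(1) assms(2) by (simp add: sum.delta)
  qed
  moreover have "qlin (V - W) A (\<lambda>e. 0)" by (rule qlin_LF[OF LF_zero])
  ultimately show ?case
    by (intro exI[of _ "\<lambda>i. if i = j then 1 else 0"] exI[of _ "\<lambda>e. 0"]) blast
next
  case (aff_par u)
  then show ?case by (intro exI[of _ "\<lambda>_. 0"] exI[of _ u]) auto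
next
  case (aff_add u v)
  then obtain a g b f where "qlin (V - W) A g" "\<forall>e\<in>A. u e = (\<Sum>i\<in>W. a i \<cdot> q e i) + g e"
    "qlin (V - W) A f" "\<forall>e\<in>A. v e = (\<Sum>i\<in>W. b i \<cdot> q e i) + f e" by blast
  then show ?case
    by (intro exI[of _ "\<lambda>i. a i + b i"] exI[of _ "\<lambda>e. g e + f e"]) 
      (auto simp: zs sum.distrib qlin_add algebra_simps)
next
  case (aff_minus u)
  then obtain a g where "qlin (V - W) A g" "\<forall>e\<in>A. u e = (\<Sum>i\<in>W. a i \<cdot> q e i) + g e" by blast
  then show ?case
    by (intro exI[of _ "\<lambda>i. - a i"] exI[of _ "\<lambda>e. - g e"]) (auto simp: sum_negf qlin_minus)
qed

text \<open>Exactness of the divisions for every coordinate in \<open>W\<close>, including those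
  that do not occur in a given function: a linear map requires the congruences for all of
  them.\<close>

definition scaled :: "(nat \<Rightarrow> int) \<Rightarrow> (nat \<Rightarrow> int) \<Rightarrow> nat set \<Rightarrow> (nat \<Rightarrow> 'a::{linordered_ab_group_add,one}) set \<Rightarrow> bool" where
  "scaled d c W A \<longleftrightarrow> (\<forall>i\<in>W. 0 < d i) \<and> (\<forall>e\<in>A. \<forall>i\<in>W. dvg (d i) (e i - c i \<cdot> 1))"

lemma dvg_1: "dvg 1 x"
  unfolding dvg_def by (rule exI[of _ x]) simp

lemma scaled_1: "scaled (\<lambda>_. 1) (\<lambda>_. 0) W A"
  by (simp add: scaled_def dvg_1)

lemma scaled_subset: "scaled d c W A \<Longrightarrow> A' \<subseteq> A \<Longrightarrow> scaled d c W A'"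
  unfolding scaled_def by blast

text \<open>A coordinate is recovered from its quotient q as d q + c, which is an integer
  combination.\<close>

lemma aff_if_aff1:
  assumes "scaled d c W A" "aff1 V W A u" shows "aff d c V W A u"
proof -
  have "aff d c V W A (\<lambda>e. e i)" if i: "i \<in> W" for i
  proof -
    define q where "q e = (SOME z. e i - c i \<cdot> 1 = d i \<cdot> z)" for e :: "nat \<Rightarrow> 'a"
    have q: "d i \<cdot> q e = e i - c i \<cdot> 1" if "e \<in> A" for e
      unfolding q_def using assms(1) i that someI_ex[of "\<lambda>z. e i - c i \<cdot> 1 = d i \<cdot> z"]
      by (auto simp: scaled_def dvg_def)
    have "aff d c V W A (\<lambda>e. d i \<cdot> q e + c i \<cdot> 1)"
      by (intro aff_add aff_scale aff_const aff_var[where u = q, OF i] q)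
    then show ?thesis by (rule aff_cong) (use q in auto)
  qed
  then show ?thesis using aff_compose[OF assms(2), of A "\<lambda>e. e" d c] by simp
qed

section \<open>Boxes and rectilinear pieces\<close>

text \<open>Isomorphism over the parameters. Among the coordinates in \<open>W\<close>, only
  \<open>h\<close> may divide, and only those of \<open>A\<close>; the inverse \<open>k\<close> is
  integral on \<open>B\<close>. Hence integral isomorphisms can be appended at \<open>B\<close>
  without new denominators.\<close>

definition aiso where
  "aiso d c V W A B h k \<longleftrightarrow>
    (\<forall>e\<in>A. h e \<in> B \<and> k (h e) = e \<and> (\<forall>i. i \<notin> W \<longrightarrow> h e i = e i)) \<and>
    (\<forall>e\<in>B. k e \<in> A \<and> h (k e) = e \<and> (\<forall>i. i \<notin> W \<longrightarrow> k e i = e i)) \<and>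
    (\<forall>i\<in>W. aff d c V W A (\<lambda>e. h e i)) \<and> (\<forall>i\<in>W. aff1 V W B (\<lambda>e. k e i))"

abbreviation "aiso1 \<equiv> aiso (\<lambda>_. 1) (\<lambda>_. 0)"

lemma aisoD:
  assumes "aiso d c V W A B h k"
  shows "e \<in> A \<Longrightarrow> h e \<in> B" "e \<in> A \<Longrightarrow> k (h e) = e" "e \<in> A \<Longrightarrow> i \<notin> W \<Longrightarrow> h e i = e i"
    "e \<in> B \<Longrightarrow> k e \<in> A" "e \<in> B \<Longrightarrow> h (k e) = e" "e \<in> B \<Longrightarrow> i \<notin> W \<Longrightarrow> k e i = e i"
    "i \<in> W \<Longrightarrow> aff d c V W A (\<lambda>e. h e i)" "i \<in> W \<Longrightarrow> aff1 V W B (\<lambda>e. k e i)"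
  using assms unfolding aiso_def by blast+

lemma aiso_id: "aiso1 V W A A (\<lambda>e. e) (\<lambda>e. e)"
  unfolding aiso_def by (auto intro: aff_coord)

lemma aiso_restrict:
  assumes "aiso d c V W A B h k" "B' \<subseteq> B" shows "aiso d c V W {e \<in> A. h e \<in> B'} B' h k"
  using assms(2) aisoD[OF assms(1)] unfolding aiso_def
  by (auto intro: aff_subset[of d c V W A] aff_subset[of _ _ V W B])

lemma aiso_trans:
  assumes "aiso d c V W A B h k" "aiso1 V W B C h' k'" 
  shows "aiso d c V W A C (\<lambda>e. h' (h e)) (\<lambda>e. k (k' e))"
proof -
  note 1 = aisoD[OF assms(1)] and 2 = aisoD[OF assms(2)]
  have "aff d c V W A (\<lambda>e. h' (h e) i)" if "i \<in> W" for i
    by (rule aff_compose[OF 2(7)[OF that]]) (auto intro: 1)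
  moreover have "aff1 V W C (\<lambda>e. k (k' e) i)" if "i \<in> W" for i
    by (rule aff_compose[OF 1(8)[OF that]]) (auto intro: 2)
  ultimately show ?thesis unfolding aiso_def using 1 2 by auto
qed

text \<open>The coordinates in \<open>L\<close> range freely over \<open>H\<close>, the remaining ones in \<open>W\<close> are bounded in each fibre.\<close>

definition box :: "nat set \<Rightarrow> nat set \<Rightarrow> (nat \<Rightarrow> 'a::linordered_ab_group_add) set \<Rightarrow> bool" where
  "box W L B \<longleftrightarrow> (\<forall>e\<in>B. \<forall>i\<in>L. 0 \<le> e i \<and> (\<forall>x\<ge>0. e(i := x) \<in> B)) \<and>
    (\<forall>p. \<exists>z. \<forall>e\<in>B. (\<forall>i. i \<notin> W \<longrightarrow> e i = p i) \<longrightarrow> (\<forall>i\<in>W - L. - z \<le> e i \<and> e i \<le> z))"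

lemma boxD:
  assumes "box W L B"
  shows "e \<in> B \<Longrightarrow> i \<in> L \<Longrightarrow> 0 \<le> e i" "e \<in> B \<Longrightarrow> i \<in> L \<Longrightarrow> 0 \<le> x \<Longrightarrow> e(i := x) \<in> B"
  using assms unfolding box_def by blast+

text \<open>Prepares the addition of the coordinate \<open>t\<close>, which is then no longer held
  fixed within a fibre. As \<open>t\<close> is not in \<open>V\<close>, the set \<open>B\<close>
  does not depend on it, so a value of \<open>t\<close> outside \<open>W\<close> may first be reset
  to \<open>p t\<close>. The maximum with 0 makes the bound usable in sums.\<close>

lemma box_bound:
  assumes "box W L B" "QF V B" "t \<notin> V"
  shows "\<exists>z\<ge>0. \<forall>e\<in>B. (\<forall>i. i \<notin> insert t W \<longrightarrow> e i = p i) \<longrightarrow> (\<forall>i\<in>W - L. i \<noteq> t \<longrightarrow> - z \<le> e i \<and> e i \<le> z)"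
proof -
  obtain z where z: "\<forall>e\<in>B. (\<forall>i. i \<notin> W \<longrightarrow> e i = p i) \<longrightarrow> (\<forall>i\<in>W - L. - z \<le> e i \<and> e i \<le> z)"
    using assms(1) unfolding box_def by blast
  have "- max z 0 \<le> e i \<and> e i \<le> max z 0" 
    if e: "e \<in> B" "\<And>i. i \<notin> insert t W \<Longrightarrow> e i = p i" "i \<in> W - L" "i \<noteq> t" for e i
  proof -
    define e' where "e' = (if t \<in> W then e else e(t := p t))"
    have "e' \<in> B" using QF_upd[OF assms(2,3)] e(1) by (simp add: e'_def)
    moreover have "e' i = p i" if "i \<notin> W" for i using e(2)[of i] that by (cases "i = t") (auto simp: e'_def)
    ultimately have "- z \<le> e' i \<and> e' i \<le> z" using z e(3) by blast
    then have *: "- z \<le> e i" "e i \<le> z" using e(4) by (auto simp: e'_def split: if_splits)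
    have "- max z 0 \<le> - z" by simp
    then have "- max z 0 \<le> e i" using *(1) by (rule order_trans)
    moreover have "e i \<le> max z 0" using *(2) by (rule order_trans) simp
    ultimately show ?thesis by blast
  qed
  then show ?thesis by (intro exI[of _ "max z 0"]) auto
qed

definition rect :: "(nat \<Rightarrow> int) \<Rightarrow> (nat \<Rightarrow> int) \<Rightarrow> nat set \<Rightarrow> nat set \<Rightarrow> (nat \<Rightarrow> 'a::{linordered_ab_group_add,one}) set set" where
  "rect d c V W = {A. QF V A \<and> scaled d c W A \<and> 
     (\<exists>L B h k. L \<subseteq> W \<and> QF V B \<and> box W L B \<and> aiso d c V W A B h k)}"

abbreviation "rect1 \<equiv> rect (\<lambda>_. 1) (\<lambda>_. 0)"

text \<open>Each piece may come with its own denominators and residues.\<close>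

abbreviation "good V W \<equiv> fdu (\<Union>d c. rect d c V W)"

lemma rectI: 
  "QF V A \<Longrightarrow> scaled d c W A \<Longrightarrow> L \<subseteq> W \<Longrightarrow> QF V B \<Longrightarrow> box W L B \<Longrightarrow> aiso d c V W A B h k \<Longrightarrow> A \<in> rect d c V W"
  unfolding rect_def by blast

lemma rectE:
  assumes "A \<in> rect d c V W"
  obtains L B h k where "QF V A" "scaled d c W A" "L \<subseteq> W" "QF V B" "box W L B" "aiso d c V W A B h k"
  using assms unfolding rect_def by blast

lemma rect1_box: "QF V B \<Longrightarrow> L \<subseteq> W \<Longrightarrow> box W L B \<Longrightarrow> B \<in> rect1 V W"
  by (rule rectI[OF _ scaled_1 _ _ _ aiso_id])

lemma good_if_rect1: "fdu (rect1 V W) A \<Longrightarrow> good V W A"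
proof (induction rule: fdu.induct)
  case (fdu_base A)
  then show ?case by (intro fdu.fdu_base) blast
qed (auto intro: fdu_empty fdu_Un)

lemma aiso_QF:
  assumes "aiso d c V W A B h k" "W \<subseteq> V" "scaled d c W A" "QF V A" "QF V E" 
  shows "QF V {e \<in> A. h e \<in> E}"
proof (rule QF_pullback[OF assms(5,4)])
  fix i assume "i \<in> V"
  show "qlin V A (\<lambda>e. h e i)"
  proof (cases "i \<in> W")
    case True
    show ?thesis by (rule aff_qlin[OF aisoD(7)[OF assms(1) True] assms(2)]) (use assms(3) in \<open>auto simp: scaled_def\<close>)
  next
    case False
    have "qlin V A (\<lambda>e. e i)" using \<open>i \<in> V\<close> by (intro qlin_LF LF_var)
    then show ?thesis by (rule qlin_cong) (use aisoD(3)[OF assms(1) _ False] in auto)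
  qed
qed

lemma rect_trans:
  assumes iso: "aiso d c V W A B h k" and sub: "W \<subseteq> V" and sc: "scaled d c W A" and A: "QF V A" 
    and R: "R \<in> rect1 V W" "R \<subseteq> B"
  shows "{e \<in> A. h e \<in> R} \<in> rect d c V W"
proof -
  from R(1) obtain L C h' k' where C: "QF V R" "L \<subseteq> W" "QF V C" "box W L C" "aiso1 V W R C h' k'"
    by (rule rectE)
  show ?thesis
    by (rule rectI[OF _ _ C(2,3,4) aiso_trans[OF aiso_restrict[OF iso R(2)] C(5)]])
      (use aiso_QF[OF iso sub sc A C(1)] scaled_subset[OF sc] in auto)
qed

text \<open>A decomposition of the target is pulled back piece by piece; its pieces must have
  denominators 1 so that their isomorphisms can follow \<open>h\<close>. The second form keeps
  denominators 1 throughout and serves the recursion in \<open>wedge\<close>.\<close>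

lemma good_trans:
  assumes iso: "aiso d c V W A B h k" and sub: "W \<subseteq> V" and sc: "scaled d c W A" and A: "QF V A" 
  shows "fdu (rect1 V W) E \<Longrightarrow> E \<subseteq> B \<Longrightarrow> good V W {e \<in> A. h e \<in> E}"
    and "fdu (rect1 V W) E \<Longrightarrow> E \<subseteq> B \<Longrightarrow> d = (\<lambda>_. 1) \<Longrightarrow> c = (\<lambda>_. 0) \<Longrightarrow> fdu (rect1 V W) {e \<in> A. h e \<in> E}"
proof -
  have *: "fdu (rect d c V W) {e \<in> A. h e \<in> E}" if "fdu (rect1 V W) E" "E \<subseteq> B" for E
    using that
  proof (induction rule: fdu.induct)
    case (fdu_base R)
    then show ?case by (intro fdu.fdu_base rect_trans[OF assms]) auto
  next
    case (fdu_Un R S)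
    have "{e \<in> A. h e \<in> R \<union> S} = {e \<in> A. h e \<in> R} \<union> {e \<in> A. h e \<in> S}" by auto
    then show ?case using fdu_Un by (auto intro!: fdu.fdu_Un)
  qed (auto intro: fdu_empty)
  show "fdu (rect1 V W) E \<Longrightarrow> E \<subseteq> B \<Longrightarrow> d = (\<lambda>_. 1) \<Longrightarrow> c = (\<lambda>_. 0) \<Longrightarrow> fdu (rect1 V W) {e \<in> A. h e \<in> E}"
    using * by simp
  have "good V W X" if "fdu (rect d c V W) X" for X
    using that
  proof (induction rule: fdu.induct)
    case (fdu_base A)
    then show ?case by (intro fdu.fdu_base) blast
  qed (auto intro: fdu_empty fdu.fdu_Un)
  then show "fdu (rect1 V W) E \<Longrightarrow> E \<subseteq> B \<Longrightarrow> good V W {e \<in> A. h e \<in> E}" using * by blast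
qed

section \<open>Rays and wedges over a box\<close>

lemma sum_scale_upd:
  assumes "finite W" "i \<in> W"
  shows "(\<Sum>j\<in>W. b j \<cdot> (e(i := x)) j) = (\<Sum>j\<in>W. b j \<cdot> e j) + b i \<cdot> (x - e i)"
proof -
  have "(\<Sum>j\<in>W - {i}. b j \<cdot> (e(i := x)) j) = (\<Sum>j\<in>W - {i}. b j \<cdot> e j)" by (rule sum.cong) auto
  then show ?thesis using sum.remove[OF assms, of "\<lambda>j. b j \<cdot> (e(i := x)) j"] sum.remove[OF assms, of "\<lambda>j. b j \<cdot> e j"]
    by (simp add: zs algebra_simps)
qed

lemma sum_scale_decr:
  assumes "finite W" "i \<in> W"
  shows "(\<Sum>j\<in>W. (b(i := b i - 1)) j \<cdot> e j) = (\<Sum>j\<in>W. b j \<cdot> e j) - e i"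
proof -
  have "(\<Sum>j\<in>W - {i}. (b(i := b i - 1)) j \<cdot> e j) = (\<Sum>j\<in>W - {i}. b j \<cdot> e j)" by (rule sum.cong) auto
  then show ?thesis using sum.remove[OF assms, of "\<lambda>j. (b(i := b i - 1)) j \<cdot> e j"] sum.remove[OF assms, of "\<lambda>j. b j \<cdot> e j"]
    by (simp add: zs algebra_simps)
qed

lemma aff_lincomb:
  assumes "finite W" shows "aff1 V W A (\<lambda>e. \<Sum>i\<in>W. b i \<cdot> e i)"
proof -
  have "aff1 V W A (\<lambda>e. \<Sum>i\<in>S. b i \<cdot> e i)" if "finite S" "S \<subseteq> W" for S
    using that
  proof (induction S rule: finite_induct)
    case empty
    show ?case by (simp add: aff_zero)
  next
    case (insert i S)
    then show ?case by (simp add: aff_add aff_scale aff_coord)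
  qed
  then show ?thesis using assms by blast
qed

lemma abs_scale_le:
  fixes x z :: "'a::linordered_ab_group_add"
  assumes "- z \<le> x" "x \<le> z" shows "b \<cdot> x \<le> \<bar>b\<bar> \<cdot> z"
proof (cases "b = 0")
  case False
  then have "0 < \<bar>b\<bar>" by simp
  show ?thesis
  proof (cases "b > 0")
    case True
    then show ?thesis using zmult_le_iff[OF \<open>0 < \<bar>b\<bar>\<close>, of x z] assms by simp
  next
    case False
    have "- x \<le> z" using assms(1) by (simp add: minus_le_iff)
    then have "\<bar>b\<bar> \<cdot> (- x) \<le> \<bar>b\<bar> \<cdot> z" using zmult_le_iff[OF \<open>0 < \<bar>b\<bar>\<close>] by blast
    then show ?thesis using False by (simp add: abs_if split: if_splits)
  qed
qed simp

text \<open>No free coordinate occurs in the upper bound, so these stay free, and \<open>t\<close>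
  is bounded in each fibre along with the rest.\<close>

lemma box_wedge:
  fixes B :: "(nat \<Rightarrow> 'a::{linordered_ab_group_add,one}) set"
  assumes t: "t \<notin> V" and W: "W \<subseteq> V" "finite W" and B: "QF V B" "box W L B" "L \<subseteq> W" 
    and g: "qlin (V - W) B g" and b: "\<And>i. i \<in> L \<Longrightarrow> b i = 0"
  shows "box (insert t W) L {e \<in> B. 0 \<le> e t \<and> e t \<le> (\<Sum>i\<in>W. b i \<cdot> e i) + g e}" (is "box _ L ?E")
  unfolding box_def
proof (intro conjI allI)
  have tL: "t \<notin> L" "t \<notin> W" using t W B by auto
  show "\<forall>e\<in>?E. \<forall>i\<in>L. 0 \<le> e i \<and> (\<forall>x\<ge>0. e(i := x) \<in> ?E)"
  proof (intro ballI conjI allI impI)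
    fix e i and x :: 'a assume e: "e \<in> ?E" "i \<in> L"
    then show "0 \<le> e i" using boxD[OF B(2)] by blast
    assume "0 \<le> x"
    then have "e(i := x) \<in> B" using boxD[OF B(2)] e by blast
    moreover have "g (e(i := x)) = g e" 
      using e B(3) by (intro qlin_local[OF g \<open>e(i := x) \<in> B\<close>]) auto
    moreover have "(\<Sum>j\<in>W. b j \<cdot> (e(i := x)) j) = (\<Sum>j\<in>W. b j \<cdot> e j)"
      using sum_scale_upd[OF W(2), of i b e x] e(2) B(3) b by auto
    ultimately show "e(i := x) \<in> ?E" using e tL by auto
  qed
  fix p
  obtain z where z0: "0 \<le> z" and z': "\<forall>e\<in>B. (\<forall>i. i \<notin> insert t W \<longrightarrow> e i = p i) \<longrightarrow> 
      (\<forall>i\<in>W - L. i \<noteq> t \<longrightarrow> - z \<le> e i \<and> e i \<le> z)"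
    using box_bound[OF B(2,1) t, of p] by blast
  have "- z \<le> e i \<and> e i \<le> z" if "e \<in> B" "\<forall>i. i \<notin> insert t W \<longrightarrow> e i = p i" "i \<in> W - L" for e i
    using z'[rule_format, OF that(1) _ that(3)] that(2,3) tL by blast
  note z = z0 this
  obtain N K where K: "0 < N" "K \<in> LF (V - W)" "\<And>e. e \<in> B \<Longrightarrow> N \<cdot> g e = K e" 
    using g unfolding qlin_def by blast
  \<comment> \<open>\<open>g\<close> is a function of the parameters; where it is nonnegative, it is
    at most N g, which is the value of the form \<open>K\<close> at \<open>p\<close>.\<close>
  have gb: "g e \<le> max 0 (K p)" if "e \<in> B" "\<forall>i. i \<notin> insert t W \<longrightarrow> e i = p i" for e
  proof (cases "0 \<le> g e")
    case True
    have "K e = K p" by (rule LF_local[OF K(2)]) (use that t in auto)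
    moreover have "1 \<cdot> g e \<le> N \<cdot> g e" using True K(1) by (intro zmult_left_mono) auto
    ultimately show ?thesis using K(3)[OF that(1)] by (simp add: max.coboundedI2)
  qed (simp add: max.coboundedI1)
  \<comment> \<open>\<open>y\<close> bounds \<open>t\<close> from above; the final bound
    \<open>y + z\<close> also covers the old coordinates.\<close>
  define y where "y = (\<Sum>i\<in>W. \<bar>b i\<bar> \<cdot> z) + max 0 (K p)"
  have y0: "0 \<le> y" unfolding y_def by (intro add_nonneg_nonneg sum_nonneg zmult_nonneg z) auto
  have "- (y + z) \<le> e i \<and> e i \<le> y + z" if e: "e \<in> ?E" "\<forall>i. i \<notin> insert t W \<longrightarrow> e i = p i" 
    and i: "i \<in> insert t W - L" for e i
  proof (cases "i = t")
    case True
    have "(\<Sum>i\<in>W. b i \<cdot> e i) \<le> (\<Sum>i\<in>W. \<bar>b i\<bar> \<cdot> z)"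
    proof (rule sum_mono)
      fix i assume "i \<in> W"
      show "b i \<cdot> e i \<le> \<bar>b i\<bar> \<cdot> z"
      proof (cases "i \<in> L")
        case False
        then show ?thesis using z(2)[of e i] e \<open>i \<in> W\<close> by (intro abs_scale_le) auto
      qed (simp add: b)
    qed
    then have "(\<Sum>i\<in>W. b i \<cdot> e i) + g e \<le> y" unfolding y_def using gb[of e] e by (intro add_mono) auto
    then have "e t \<le> y" using e by (auto intro: order_trans)
    moreover have "y \<le> y + z" using z(1) by simp
    ultimately have "e t \<le> y + z" by (rule order_trans)
    moreover have "0 \<le> y + z" using y0 z(1) by (rule add_nonneg_nonneg)
    then have "- (y + z) \<le> 0" by (simp only: neg_le_0_iff_le)
    then have "- (y + z) \<le> e t" by (rule order_trans) (use e in simp)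
    ultimately show ?thesis using True by simp
  next
    case False
    then have *: "- z \<le> e i" "e i \<le> z" using z(2)[of e i] e i by auto
    have "z \<le> y + z" using y0 by simp
    then have "e i \<le> y + z" "- (y + z) \<le> - z" using order_trans[OF *(2)] le_imp_neg_le by blast+
    then show ?thesis using order_trans[OF _ *(1)] by blast
  qed
  then show "\<exists>z. \<forall>e\<in>?E. (\<forall>i. i \<notin> insert t W \<longrightarrow> e i = p i) \<longrightarrow> (\<forall>i\<in>insert t W - L. - z \<le> e i \<and> e i \<le> z)"
    by blast
qed

text \<open>Without an upper bound the new coordinate simply joins the free ones.\<close>

lemma box_ray:
  assumes t: "t \<notin> V" and W: "W \<subseteq> V" and B: "QF V B" "box W L B"
  shows "box (insert t W) (insert t L) {e \<in> B. 0 \<le> e t}" (is "box _ _ ?E")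
  unfolding box_def
proof (intro conjI allI)
  show "\<forall>e\<in>?E. \<forall>i\<in>insert t L. 0 \<le> e i \<and> (\<forall>x\<ge>0. e(i := x) \<in> ?E)"
    using boxD[OF B(2)] QF_upd[OF B(1) t] by auto
  fix p
  obtain z where "\<forall>e\<in>B. (\<forall>i. i \<notin> insert t W \<longrightarrow> e i = p i) \<longrightarrow> (\<forall>i\<in>W - L. i \<noteq> t \<longrightarrow> - z \<le> e i \<and> e i \<le> z)"
    using box_bound[OF B(2,1) t, of p] by blast
  then show "\<exists>z. \<forall>e\<in>?E. (\<forall>i. i \<notin> insert t W \<longrightarrow> e i = p i) \<longrightarrow> (\<forall>i\<in>insert t W - insert t L. - z \<le> e i \<and> e i \<le> z)"
    by (intro exI[of _ z]) auto
qed

context zgroup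
begin

lemma QF_wedge:
  fixes B :: "(nat \<Rightarrow> 'a) set"
  assumes "W \<subseteq> V" "QF V B" "aff1 V W B \<beta>"
  shows "QF (insert t V) {e \<in> B. 0 \<le> e t}" "QF (insert t V) {e \<in> B. 0 \<le> e t \<and> e t \<le> \<beta> e}"
proof -
  have B: "QF (insert t V) B" using assms(2) by (rule QF_mono) auto
  have "qlin V B \<beta>" using aff_qlin[OF assms(3,1)] by simp
  then have \<beta>: "qlin (insert t V) B \<beta>" by (rule qlin_mono) auto
  have t: "qlin (insert t V) B (\<lambda>e. e t)" by (intro qlin_LF LF_var) auto
  note * = QF_qlin_le[OF B t \<beta>]
  show **: "QF (insert t V) {e \<in> B. 0 \<le> e t}" by (rule QF_qlin_le[OF B qlin_LF[OF LF_zero] t])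
  have "{e \<in> B. 0 \<le> e t \<and> e t \<le> \<beta> e} = {e \<in> B. 0 \<le> e t} \<inter> {e \<in> B. e t \<le> \<beta> e}" by auto
  then show "QF (insert t V) {e \<in> B. 0 \<le> e t \<and> e t \<le> \<beta> e}" using QF_Int[OF ** *] by simp
qed

text \<open>If \<open>b i > 0\<close> for some \<open>i \<in> L\<close>, cut along \<open>e t = e i\<close>: below the cut, \<open>(e i - e t - 1, e t)\<close>
  are free coordinates, and above it the shear \<open>e t - e i\<close> lowers \<open>b i\<close>.\<close>

lemma wedge:
  fixes B :: "(nat \<Rightarrow> 'a) set"
  assumes t: "t \<notin> V" and W: "W \<subseteq> V" "finite W" and B: "QF V B" "box W L B" "L \<subseteq> W" 
    and g: "qlin (V - W) B g" 
    and nonneg: "\<And>e. e \<in> B \<Longrightarrow> 0 \<le> (\<Sum>i\<in>W. b i \<cdot> e i) + g e"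
  shows "fdu (rect1 (insert t V) (insert t W)) {e \<in> B. 0 \<le> e t \<and> e t \<le> (\<Sum>i\<in>W. b i \<cdot> e i) + g e}"
  using nonneg
\<comment> \<open>The sum of the coefficients at the free coordinates; each shear lowers one of them
  by 1.\<close>
proof (induction "\<Sum>i\<in>L. nat (b i)" arbitrary: b rule: less_induct)
  case less
  let ?\<beta> = "\<lambda>e. (\<Sum>i\<in>W. b i \<cdot> e i) + g e"
  let ?E = "{e \<in> B. 0 \<le> e t \<and> e t \<le> ?\<beta> e}"
  let ?V = "insert t V" and ?W = "insert t W"
  have aff\<beta>: "aff1 V W B ?\<beta>" using W(2) g by (intro aff_add aff_lincomb aff_par)
  note QFE = QF_wedge[OF W(1) B(1) this]
  show ?case
  \<comment> \<open>An actual point of \<open>B\<close> is needed to exclude negative coefficients,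
    so the empty case is separate.\<close>
  proof (cases "B = {} \<or> (\<forall>i\<in>L. b i = 0)")
    case True
    then show ?thesis
    proof
      assume "B = {}"
      then show ?thesis by (simp add: fdu_empty)
    next
      assume "\<forall>i\<in>L. b i = 0"
      then have "box ?W L ?E" by (intro box_wedge[OF t W B g]) auto
      then show ?thesis using B(3) by (intro fdu_base rect1_box QFE) auto
    qed
  next
    case False
    then obtain i e0 where i: "i \<in> L" "b i \<noteq> 0" and e0: "e0 \<in> B" by blast
    have iW: "i \<in> W" "i \<noteq> t" using i B(3) W t by auto
    have upd: "?\<beta> (e(i := x)) = ?\<beta> e + b i \<cdot> (x - e i)" if "e \<in> B" "0 \<le> x" for e x
    proof -
      have "g (e(i := x)) = g e" using boxD(2)[OF B(2)] that i(1) iW by (intro qlin_local[OF g]) auto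
      then show ?thesis using sum_scale_upd[OF W(2) iW(1), of b e x] by (simp add: algebra_simps)
    qed
    have "0 < b i"
    proof (rule ccontr)
      assume "\<not> 0 < b i"
      then have neg: "b i \<le> - 1" using i(2) by simp
      define e1 where "e1 = e0(i := 0)"
      have e1: "e1 \<in> B" using boxD(2)[OF B(2) e0 i(1)] by (simp add: e1_def)
      \<comment> \<open>On the ray through \<open>e1\<close>, a coefficient of at most -1 would
        bring the bound down to -1 or less at this x, against its nonnegativity.\<close>
      define x where "x = ?\<beta> e1 + 1"
      have x0: "0 \<le> x" using less.prems[OF e1] one_pos unfolding x_def by (simp add: add_nonneg_nonneg less_imp_le)
      have "?\<beta> (e1(i := x)) = ?\<beta> e1 + b i \<cdot> x" using upd[OF e1 x0] by (simp add: e1_def)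
      moreover have "b i \<cdot> x \<le> (- 1) \<cdot> x" by (rule zmult_left_mono[OF x0 neg])
      moreover have "0 \<le> ?\<beta> (e1(i := x))" using less.prems boxD(2)[OF B(2) e1 i(1) x0] by blast
      ultimately have "0 \<le> ?\<beta> e1 + (- 1) \<cdot> x" by (metis (no_types, lifting) add_left_mono order_trans)
      then show False using one_pos unfolding x_def by simp
    qed
    \<comment> \<open>The coefficient of \<open>e i\<close> is at least 1, and what remains at
      \<open>e(i := 0)\<close> is nonnegative. The estimate makes the upper bound automatic below
      the cut and keeps it nonnegative after the shear above the cut.\<close>
    have ge: "e i \<le> ?\<beta> e" if e: "e \<in> B" for e
    proof -
      have e': "e(i := 0) \<in> B" using boxD(2)[OF B(2) e i(1)] by simp
      have "1 \<cdot> e i \<le> b i \<cdot> e i" using boxD(1)[OF B(2) e i(1)] \<open>0 < b i\<close> by (intro zmult_left_mono) auto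
      moreover have "?\<beta> e = ?\<beta> (e(i := 0)) + b i \<cdot> e i" using upd[OF e, of 0] by (simp add: algebra_simps)
      ultimately show ?thesis using less.prems[OF e'] by (simp only:) (metis add_increasing zm.scale_one)
    qed
    have cut: "QF ?V {e. e i \<le> e t}" using iW(1) W(1) by (intro QF_le LF_var) auto
    have aff_c: "aff1 ?V ?W A (\<lambda>e. e j)" if "j \<in> ?W" for j and A :: "(nat \<Rightarrow> 'a) set" 
      using that by (rule aff_coord) auto
    have one: "aff1 ?V ?W A (\<lambda>e. 1)" for A :: "(nat \<Rightarrow> 'a) set" using aff_const[of _ _ _ _ _ 1] by simp
    show ?thesis
    proof (rule fdu_split[where Z = "{e. e i \<le> e t}"])
      let ?E1 = "?E - {e. e i \<le> e t}"
      \<comment> \<open>Below the cut the inequality is strict, whence the 1: the new coordinate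
        takes every value in H, independently of \<open>e t\<close>.\<close>
      let ?h = "\<lambda>e::nat \<Rightarrow> 'a. e(i := e i - e t - 1)" and ?k = "\<lambda>e::nat \<Rightarrow> 'a. e(i := e i + e t + 1)"
      have "aiso1 ?V ?W ?E1 {e \<in> B. 0 \<le> e t} ?h ?k"
        unfolding aiso_def
      proof (intro conjI ballI allI impI)
        fix e assume e: "e \<in> ?E1"
        then have "0 \<le> e i - e t - 1" using less_iff[of "e t" "e i"] by (auto simp: not_le algebra_simps)
        then show "?h e \<in> {e \<in> B. 0 \<le> e t}" using e boxD(2)[OF B(2) _ i(1)] iW by auto
        show "?k (?h e) = e" using iW by simp
        show "?h e j = e j" if "j \<notin> ?W" for j using that iW by auto
      next
        fix e assume e: "e \<in> {e \<in> B. 0 \<le> e t}"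
        then have i0: "0 \<le> e i" using boxD(1)[OF B(2) _ i(1)] by blast
        then have x0: "0 \<le> e i + e t + 1" using e one_pos by (simp add: add_nonneg_nonneg less_imp_le)
        have kB: "?k e \<in> B" using e boxD(2)[OF B(2) _ i(1) x0] by blast
        have lt: "e t < e i + e t + 1" using i0 one_pos less_iff by (simp add: add.commute add.left_commute add_increasing)
        have "e i + e t + 1 \<le> ?\<beta> (?k e)" using ge[OF kB] by simp
        then have "e t \<le> ?\<beta> (?k e)" using lt by (meson less_imp_le order_trans)
        then show "?k e \<in> ?E1" using kB lt e iW by (auto simp: not_le)
        show "?h (?k e) = e" using iW by simp
        show "?k e j = e j" if "j \<notin> ?W" for j using that iW by auto
      next
        fix j assume j: "j \<in> ?W"
        have "aff1 ?V ?W ?E1 (\<lambda>e. e i - e t - 1)" using iW by (intro aff_diff aff_c one) auto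
        then show "aff1 ?V ?W ?E1 (\<lambda>e. ?h e j)" using j aff_c[of j] by (cases "j = i") auto
        have "aff1 ?V ?W {e \<in> B. 0 \<le> e t} (\<lambda>e. e i + e t + 1)" using iW by (intro aff_add aff_c one) auto
        then show "aff1 ?V ?W {e \<in> B. 0 \<le> e t} (\<lambda>e. ?k e j)" using j aff_c[of j] by (cases "j = i") auto
      qed
      then have "?E1 \<in> rect1 ?V ?W"
        using B(3) by (intro rectI[OF QF_Diff[OF QFE(2) cut] scaled_1 _ QFE(1) box_ray[OF t W(1) B(1,2)]]) auto
      then show "fdu (rect1 ?V ?W) ?E1" by (rule fdu_base)
    next
      let ?E2 = "?E \<inter> {e. e i \<le> e t}"
      let ?b = "b(i := b i - 1)"
      let ?E' = "{e \<in> B. 0 \<le> e t \<and> e t \<le> (\<Sum>j\<in>W. ?b j \<cdot> e j) + g e}"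
      let ?h = "\<lambda>e::nat \<Rightarrow> 'a. e(t := e t - e i)" and ?k = "\<lambda>e::nat \<Rightarrow> 'a. e(t := e t + e i)"
      have \<beta>': "(\<Sum>j\<in>W. ?b j \<cdot> e j) + g e = ?\<beta> e - e i" for e
        unfolding sum_scale_decr[OF W(2) iW(1)] by simp
      have Bt: "e(t := x) \<in> B \<longleftrightarrow> e \<in> B" for e x by (rule QF_upd[OF B(1) t])
      have \<beta>t: "?\<beta> (e(t := x)) = ?\<beta> e" if "e \<in> B" for e x
      proof (rule aff_local[OF aff\<beta> W(1)])
        show "e(t := x) \<in> B" using Bt that by blast
      qed (use that t in auto)
      have fin: "finite L" using B(3) W(2) by (rule finite_subset)
      have IH: "fdu (rect1 ?V ?W) ?E'"
      proof (rule less.hyps)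
        show "(\<Sum>i\<in>L. nat (?b i)) < (\<Sum>i\<in>L. nat (b i))"
        proof (rule sum_strict_mono_ex1[OF fin])
          show "\<forall>j\<in>L. nat (?b j) \<le> nat (b j)" by auto
          show "\<exists>j\<in>L. nat (?b j) < nat (b j)" using i(1) \<open>0 < b i\<close> by (intro bexI[of _ i]) auto
        qed
        show "0 \<le> (\<Sum>j\<in>W. ?b j \<cdot> e j) + g e" if "e \<in> B" for e unfolding \<beta>' using ge[OF that] by simp
      qed
      have iso: "aiso1 ?V ?W ?E2 ?E' ?h ?k"
        unfolding aiso_def
      proof (intro conjI ballI allI impI)
        fix e assume e: "e \<in> ?E2"
        then have eB: "e \<in> B" by simp
        show "?h e \<in> ?E'" unfolding \<beta>' using e \<beta>t[OF eB, of "e t - e i"] Bt iW by auto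
        show "?k (?h e) = e" using iW by simp
        show "?h e j = e j" if "j \<notin> ?W" for j using that iW by auto
      next
        fix e assume e: "e \<in> ?E'"
        then have eB: "e \<in> B" by simp
        have "0 \<le> e i" using boxD(1)[OF B(2) eB i(1)] .
        moreover have "0 \<le> e t" "e t + e i \<le> ?\<beta> e" using e unfolding \<beta>' by (auto simp: algebra_simps)
        ultimately show "?k e \<in> ?E2" using e \<beta>t[OF eB, of "e t + e i"] Bt iW by (auto simp: add_nonneg_nonneg)
        show "?h (?k e) = e" using iW by simp
        show "?k e j = e j" if "j \<notin> ?W" for j using that iW by auto
      next
        fix j assume j: "j \<in> ?W"
        have "aff1 ?V ?W ?E2 (\<lambda>e. e t - e i)" using iW by (intro aff_diff aff_c) auto
        then show "aff1 ?V ?W ?E2 (\<lambda>e. ?h e j)" using j aff_c[of j] by (cases "j = t") auto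
        have "aff1 ?V ?W ?E' (\<lambda>e. e t + e i)" using iW by (intro aff_add aff_c) auto
        then show "aff1 ?V ?W ?E' (\<lambda>e. ?k e j)" using j aff_c[of j] by (cases "j = t") auto
      qed
      have "fdu (rect1 ?V ?W) {e \<in> ?E2. ?h e \<in> ?E'}"
        using W(1) by (intro good_trans(2)[OF iso _ scaled_1 QF_Int[OF QFE(2) cut] IH]) auto
      moreover have "{e \<in> ?E2. ?h e \<in> ?E'} = ?E2" using aisoD(1)[OF iso] by blast
      ultimately show "fdu (rect1 ?V ?W) ?E2" by simp
    qed
  qed
qed

end

section \<open>Rays and segments over a rectilinear piece\<close>

lemma scaled_insert: 
  "scaled d c W A \<Longrightarrow> t \<notin> W \<Longrightarrow> scaled (d(t := 1)) (c(t := 0)) (insert t W) A"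
  by (auto simp: scaled_def dvg_1)

text \<open>The isomorphism of the base is extended by \<epsilon> t - \<alpha>, which is unimodular
  since \<epsilon> is 1 or -1; the sign -1 serves upper bounds. The sets \<open>Y\<close> and
  \<open>B\<close> stay as they are because neither depends on \<open>t\<close>: all that changes is
  that \<open>t\<close> now counts among the coordinates in \<open>W\<close>.\<close>

lemma shear:
  fixes Y B :: "(nat \<Rightarrow> 'a::{linordered_ab_group_add,one}) set"
  assumes iso: "aiso d c V W Y B h k" and sc: "scaled d c W Y" and t: "t \<notin> V" and W: "W \<subseteq> V" 
    and QF: "QF V Y" "QF V B" and \<alpha>: "aff1 V W Y \<alpha>" and \<epsilon>: "\<epsilon> * \<epsilon> = 1"
  shows "e \<in> Y \<Longrightarrow> k ((h e)(t := x)) = e(t := x)"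
    and "aiso (d(t := 1)) (c(t := 0)) (insert t V) (insert t W) Y B 
          (\<lambda>e. (h e)(t := \<epsilon> \<cdot> e t - \<alpha> e)) (\<lambda>e. (k e)(t := \<epsilon> \<cdot> (e t + \<alpha> (k e))))"
proof -
  note D = aisoD[OF iso]
  have tW: "t \<notin> W" using t W by auto
  have dpos: "0 < d i" if "i \<in> W" for i using sc that by (simp add: scaled_def)
  have Yt: "e(t := x) \<in> Y \<longleftrightarrow> e \<in> Y" for e x by (rule QF_upd[OF QF(1) t])
  have Bt: "e(t := x) \<in> B \<longleftrightarrow> e \<in> B" for e x by (rule QF_upd[OF QF(2) t])
  \<comment> \<open>The values of \<open>k\<close> at \<open>W\<close> depend on the coordinates in
    \<open>V\<close> only and \<open>t\<close> itself is left alone, so \<open>k\<close> commutes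
    with changes of \<open>t\<close>; the same holds for \<open>h\<close> below.\<close>
  have hk: "k (e(t := x)) = (k e)(t := x)" if e: "e \<in> B" for e x
  proof
    fix i
    have e': "e(t := x) \<in> B" using e Bt by simp
    show "k (e(t := x)) i = ((k e)(t := x)) i"
    proof (cases "i \<in> W")
      case True
      have "k (e(t := x)) i = k e i" using t by (intro aff_local[OF D(8)[OF True] W _ e' e]) auto
      then show ?thesis using True tW by auto
    qed (use D(6)[OF e'] D(6)[OF e] in auto)
  qed
  have hh: "h (e(t := x)) = (h e)(t := x)" if e: "e \<in> Y" for e x
  proof
    fix i
    have e': "e(t := x) \<in> Y" using e Yt by simp
    show "h (e(t := x)) i = ((h e)(t := x)) i"
    proof (cases "i \<in> W")
      case True
      have "h (e(t := x)) i = h e i" using t by (intro aff_local[OF D(7)[OF True] W dpos e' e]) auto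
      then show ?thesis using True tW by auto
    qed (use D(3)[OF e'] D(3)[OF e] in auto)
  qed
  show *: "k ((h e)(t := x)) = e(t := x)" if "e \<in> Y" for e x using hk D that by simp
  have \<alpha>t: "\<alpha> (e(t := x)) = \<alpha> e" if "e \<in> Y" for e x
  proof (rule aff_local[OF \<alpha> W])
    show "e(t := x) \<in> Y" using Yt that by blast
  qed (use that t in auto)
  have \<epsilon>2: "\<epsilon> \<cdot> \<epsilon> \<cdot> x = x" for x :: 'a using \<epsilon> by simp
  let ?V = "insert t V" and ?W = "insert t W" and ?d = "d(t := 1)" and ?c = "c(t := 0)"
  let ?h = "\<lambda>e. (h e)(t := \<epsilon> \<cdot> e t - \<alpha> e)" and ?k = "\<lambda>e. (k e)(t := \<epsilon> \<cdot> (e t + \<alpha> (k e)))"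
  have VW: "?V - ?W = V - W" using t W by auto
  have up: "aff ?d ?c ?V ?W A u" if "aff d c V W A u" for A u 
    using that tW VW by (intro aff_mono[OF that]) auto
  have up1: "aff1 ?V ?W A u" if "aff1 V W A u" for A :: "(nat \<Rightarrow> 'a) set" and u 
    using that tW VW by (intro aff_mono[OF that]) auto
  show "aiso ?d ?c ?V ?W Y B ?h ?k"
    unfolding aiso_def
  proof (intro conjI ballI allI impI)
    fix e assume e: "e \<in> Y"
    show "?h e \<in> B" using Bt D(1)[OF e] by simp
    show "?k (?h e) = e" using *[OF e] \<alpha>t[OF e] \<epsilon>2 by simp
    show "?h e i = e i" if "i \<notin> ?W" for i using that D(3)[OF e] by auto
  next
    fix e assume e: "e \<in> B"
    show "?k e \<in> Y" using Yt D(4)[OF e] by simp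
    show "?h (?k e) = e" using hh[OF D(4)[OF e]] D(5)[OF e] \<alpha>t[OF D(4)[OF e]] \<epsilon>2 by simp
    show "?k e i = e i" if "i \<notin> ?W" for i using that D(6)[OF e] by auto
  next
    fix i assume i: "i \<in> ?W"
    have "aff ?d ?c ?V ?W Y (\<lambda>e. \<epsilon> \<cdot> e t - \<alpha> e)"
      by (intro aff_diff aff_scale aff_coord up aff_if_aff1[OF sc \<alpha>]) auto
    then show "aff ?d ?c ?V ?W Y (\<lambda>e. ?h e i)" using i up[OF D(7)] by (cases "i = t") auto
    have "aff1 V W B (\<lambda>e. \<alpha> (k e))" by (rule aff_compose[OF \<alpha>]) (use D in auto)
    then have "aff1 ?V ?W B (\<lambda>e. \<epsilon> \<cdot> (e t + \<alpha> (k e)))"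
      by (intro aff_scale aff_add aff_coord up1) auto
    then show "aff1 ?V ?W B (\<lambda>e. ?k e i)" using i up1[OF D(8)] by (cases "i = t") auto
  qed
qed

context zgroup
begin

text \<open>After the shear the ray becomes 0 \<le> t over each box.\<close>

lemma good_ray:
  fixes Y :: "(nat \<Rightarrow> 'a) set"
  assumes Y: "good V W Y" and t: "t \<notin> V" and W: "W \<subseteq> V" and \<alpha>: "aff1 V W Y \<alpha>" and \<epsilon>: "\<epsilon> * \<epsilon> = 1"
  shows "good (insert t V) (insert t W) (Y \<inter> {e. \<alpha> e \<le> \<epsilon> \<cdot> e t})"
proof (rule fdu_induct_set[OF Y])
  fix R assume "R \<in> (\<Union>d c. rect d c V W)" and RY: "R \<subseteq> Y"
  then obtain d c where "R \<in> rect d c V W" by blast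
  then obtain L B h k where R: "QF V R" "scaled d c W R" "L \<subseteq> W" "QF V B" "box W L B" "aiso d c V W R B h k"
    by (rule rectE)
  let ?E = "{e \<in> B. 0 \<le> e t}"
  have tW: "t \<notin> W" using t W by auto
  have \<alpha>R: "aff1 V W R \<alpha>" using \<alpha> RY by (rule aff_subset)
  note sh = shear[OF R(6,2) t W R(1,4) \<alpha>R \<epsilon>]
  have E: "fdu (rect1 (insert t V) (insert t W)) ?E"
    using R(3) by (intro fdu_base rect1_box[OF QF_wedge(1)[OF W R(4) aff_zero] _ box_ray[OF t W R(4,5)]]) auto
  have R': "QF (insert t V) R" using R(1) by (rule QF_mono) auto
  have "good (insert t V) (insert t W) {e \<in> R. (h e)(t := \<epsilon> \<cdot> e t - \<alpha> e) \<in> ?E}"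
    using W by (intro good_trans(1)[OF sh(2) _ scaled_insert[OF R(2) tW] R' E]) auto
  moreover have "{e \<in> R. (h e)(t := \<epsilon> \<cdot> e t - \<alpha> e) \<in> ?E} = R \<inter> {e. \<alpha> e \<le> \<epsilon> \<cdot> e t}"
    using aisoD(1)[OF R(6)] QF_upd[OF R(4) t] by auto
  ultimately show "good (insert t V) (insert t W) (R \<inter> {e. \<alpha> e \<le> \<epsilon> \<cdot> e t})" by simp
qed

lemma good_segment:
  fixes Y :: "(nat \<Rightarrow> 'a) set"
  assumes IH: "\<And>Z::(nat \<Rightarrow> 'a) set. QF V Z \<Longrightarrow> good V W Z" and t: "t \<notin> V" and W: "W \<subseteq> V" "finite W" 
    and QFY: "QF V Y" and \<alpha>: "aff1 V W Y \<alpha>" and \<beta>: "aff1 V W Y \<beta>"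
  shows "good (insert t V) (insert t W) (Y \<inter> {e. \<alpha> e \<le> e t \<and> e t \<le> \<beta> e})"
proof -
  \<comment> \<open>The other fibres of the segment are empty. Cutting the base down before it is
    decomposed makes the length nonnegative on every box, as \<open>wedge\<close> demands.\<close>
  let ?Y = "{e \<in> Y. \<alpha> e \<le> \<beta> e}"
  have "QF V ?Y" using aff_qlin[OF \<alpha> W(1)] aff_qlin[OF \<beta> W(1)] by (intro QF_qlin_le QFY) auto
  then have Y: "good V W ?Y" by (rule IH)
  have "good (insert t V) (insert t W) (?Y \<inter> {e. \<alpha> e \<le> e t \<and> e t \<le> \<beta> e})"
  proof (rule fdu_induct_set[OF Y])
    fix R assume "R \<in> (\<Union>d c. rect d c V W)" and RY: "R \<subseteq> ?Y"
    then obtain d c where "R \<in> rect d c V W" by blast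
    then obtain L B h k where R: "QF V R" "scaled d c W R" "L \<subseteq> W" "QF V B" "box W L B" "aiso d c V W R B h k"
      by (rule rectE)
    have tW: "t \<notin> W" using t W by auto
    have \<alpha>R: "aff1 V W R \<alpha>" using \<alpha> by (rule aff_subset) (use RY in auto)
    have \<gamma>R: "aff1 V W R (\<lambda>e. \<beta> e - \<alpha> e)" by (rule aff_diff[OF aff_subset[OF \<beta>] \<alpha>R]) (use RY in auto)
    \<comment> \<open>Seen from the box, the length is still integral affine because the inverse
      \<open>k\<close> is.\<close>
    have "aff1 V W B (\<lambda>e. \<beta> (k e) - \<alpha> (k e))"
      by (rule aff_compose[OF \<gamma>R]) (use aisoD[OF R(6)] in auto)
    from aff_sum[OF this W(2), of "\<lambda>e i. e i"] obtain b g where g: "qlin (V - W) B g" 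
      "\<And>e. e \<in> B \<Longrightarrow> \<beta> (k e) - \<alpha> (k e) = (\<Sum>i\<in>W. b i \<cdot> e i) + g e" by auto
    let ?E = "{e \<in> B. 0 \<le> e t \<and> e t \<le> (\<Sum>i\<in>W. b i \<cdot> e i) + g e}"
    have "1 * 1 = (1::int)" by simp
    note sh = shear[OF R(6,2) t W(1) R(1,4) \<alpha>R this]
    have "fdu (rect1 (insert t V) (insert t W)) ?E"
    proof (rule wedge[OF t W R(4,5,3) g(1)])
      fix e assume e: "e \<in> B"
      then have "k e \<in> ?Y" using aisoD(4)[OF R(6)] RY by blast
      then show "0 \<le> (\<Sum>i\<in>W. b i \<cdot> e i) + g e" unfolding g(2)[OF e, symmetric] by simp
    qed
    moreover have R': "QF (insert t V) R" using R(1) by (rule QF_mono) auto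
    ultimately have "good (insert t V) (insert t W) {e \<in> R. (h e)(t := 1 \<cdot> e t - \<alpha> e) \<in> ?E}"
      using W(1) by (intro good_trans(1)[OF sh(2) _ scaled_insert[OF R(2) tW] R']) auto
    moreover have "(h e)(t := 1 \<cdot> e t - \<alpha> e) \<in> ?E \<longleftrightarrow> \<alpha> e \<le> e t \<and> e t \<le> \<beta> e" if e: "e \<in> R" for e
    proof -
      let ?e = "(h e)(t := 1 \<cdot> e t - \<alpha> e)"
      have B: "?e \<in> B" using QF_upd[OF R(4) t] aisoD(1)[OF R(6) e] by simp
      have et: "e(t := 1 \<cdot> e t - \<alpha> e) \<in> R" using QF_upd[OF R(1) t] e by simp
      have "\<beta> (k ?e) - \<alpha> (k ?e) = \<beta> e - \<alpha> e" unfolding sh(1)[OF e]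
        using t by (intro aff_local[OF \<gamma>R W(1) _ et e]) auto
      then have "?e \<in> ?E \<longleftrightarrow> 0 \<le> e t - \<alpha> e \<and> e t - \<alpha> e \<le> \<beta> e - \<alpha> e"
        using B unfolding mem_Collect_eq g(2)[OF B, symmetric] by simp
      then show ?thesis by simp
    qed
    then have "{e \<in> R. (h e)(t := 1 \<cdot> e t - \<alpha> e) \<in> ?E} = R \<inter> {e. \<alpha> e \<le> e t \<and> e t \<le> \<beta> e}" by blast
    ultimately show "good (insert t V) (insert t W) (R \<inter> {e. \<alpha> e \<le> e t \<and> e t \<le> \<beta> e})" by simp
  qed
  moreover have "?Y \<inter> {e. \<alpha> e \<le> e t \<and> e t \<le> \<beta> e} = Y \<inter> {e. \<alpha> e \<le> e t \<and> e t \<le> \<beta> e}" by auto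
  ultimately show ?thesis by simp
qed

subsection \<open>Passing to residue classes\<close>

text \<open>If D q = e i - r, then a quotient u of q with d u = q - c satisfies (D d) u = e i - (r +
  D c). The new denominator and residue are read off from this.\<close>

lemma aff_rescale:
  fixes \<sigma> :: "(nat \<Rightarrow> 'a) \<Rightarrow> nat \<Rightarrow> 'a"
  assumes "aff d c V W P u" "i \<in> W" and A: "\<And>e. e \<in> A \<Longrightarrow> \<sigma> e \<in> P"
    and q: "\<And>e. e \<in> A \<Longrightarrow> \<sigma> e = e(i := q e)" "\<And>e. e \<in> A \<Longrightarrow> D \<cdot> q e = e i - r \<cdot> 1"
  shows "aff (d(i := D * d i)) (c(i := r + D * c i)) V W A (\<lambda>e. u (\<sigma> e))"
  using assms(1)
proof (induction rule: aff.induct)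
  case (aff_var j u)
  show ?case
  proof (rule aff.aff_var[OF aff_var(1)])
    fix e assume e: "e \<in> A"
    have u: "d j \<cdot> u (\<sigma> e) = \<sigma> e j - c j \<cdot> 1" using aff_var(2) A e by blast
    show "(d(i := D * d i)) j \<cdot> u (\<sigma> e) = e j - (c(i := r + D * c i)) j \<cdot> 1"
    proof (cases "j = i")
      case True
      have "(D * d j) \<cdot> u (\<sigma> e) = D \<cdot> d j \<cdot> u (\<sigma> e)" by simp
      then show ?thesis using True q(2)[OF e] unfolding u by (simp add: q(1)[OF e] zs algebra_simps)
    qed (use u q(1)[OF e] in simp)
  qed
next
  case (aff_par u)
  then obtain N L where L: "0 < N" "L \<in> LF (V - W)" "\<And>e. e \<in> P \<Longrightarrow> N \<cdot> u e = L e" 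
    unfolding qlin_def by blast
  have "L (\<sigma> e) = L e" if "e \<in> A" for e
    by (rule LF_local[OF L(2)]) (use q(1)[OF that] assms(2) in auto)
  then have "qlin (V - W) A (\<lambda>e. u (\<sigma> e))" using L A by (intro qlinI[of N L]) auto
  then show ?case by (rule aff.aff_par)
qed (auto intro: aff_add aff_minus)

text \<open>On the class of \<open>r\<close> modulo \<open>D\<close> in coordinate \<open>i\<close>,
  dividing out leads to a set whose decomposition is assumed. Transporting it back puts the division
  into the forward maps only; the inverses acquire a multiplication by \<open>D\<close> and remain
  integral.\<close>

lemma good_rescale:
  fixes X :: "(nat \<Rightarrow> 'a) set"
  assumes W: "i \<in> W" "W \<subseteq> V" and D: "0 < D" and X: "QF V X" 
    and good: "\<And>c. good V W {e. e(i := D \<cdot> e i + c \<cdot> 1) \<in> X}"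
  shows "good V W X"
proof (rule fdu_residues[OF D, of _ X "\<lambda>e. e i"])
  fix r
  let ?X' = "{e. e(i := D \<cdot> e i + r \<cdot> 1) \<in> X}" and ?s = "\<lambda>e::nat \<Rightarrow> 'a. e(i := D \<cdot> e i + r \<cdot> 1)"
  \<comment> \<open>The exact quotient; its value matters only on the residue class.\<close>
  define q where "q e = (SOME z. e i - r \<cdot> 1 = D \<cdot> z)" for e :: "nat \<Rightarrow> 'a"
  define \<sigma> where "\<sigma> e = e(i := q e)" for e :: "nat \<Rightarrow> 'a"
  let ?A = "X \<inter> {e. dvg D (e i - r \<cdot> 1)}"
  have q: "D \<cdot> q e = e i - r \<cdot> 1" if "dvg D (e i - r \<cdot> 1)" for e
    unfolding q_def using that someI_ex[of "\<lambda>z. e i - r \<cdot> 1 = D \<cdot> z"] by (auto simp: dvg_def)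
  have s\<sigma>: "?s (\<sigma> e) = e" if "dvg D (e i - r \<cdot> 1)" for e using q[of e] that by (simp add: \<sigma>_def)
  have \<sigma>s: "\<sigma> (?s e) = e" for e
  proof -
    have "D \<cdot> q (?s e) = D \<cdot> e i" using q[of "?s e"] by (simp add: dvg_scale)
    then have "q (?s e) = e i" using zmult_cancel[OF D] by blast
    then show ?thesis by (simp add: \<sigma>_def)
  qed
  have QFA: "QF V ?A" using W D by (intro QF_Int X QF_dvg LF_diff LF_var LF_const) auto
  have "good V W {e \<in> ?A. \<sigma> e \<in> P}" if "good V W P" "P \<subseteq> ?X'" for P
    using that
  proof (induction rule: fdu.induct)
    case (fdu_base P)
    then obtain d c where "P \<in> rect d c V W" by blast
    then obtain L B h k where R: "QF V P" "scaled d c W P" "L \<subseteq> W" "QF V B" "box W L B" "aiso d c V W P B h k"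
      by (rule rectE)
    let ?P = "{e \<in> ?A. \<sigma> e \<in> P}" and ?d = "d(i := D * d i)" and ?c = "c(i := r + D * c i)"
    have "?P \<in> rect ?d ?c V W"
    proof (rule rectI[OF _ _ R(3-5)])
      show "QF V ?P"
      proof (rule QF_pullback[OF R(1) QFA])
        fix j assume j: "j \<in> V"
        show "qlin V ?A (\<lambda>e. \<sigma> e j)"
        proof (cases "j = i")
          case True
          show ?thesis using q D W True
            by (intro qlinI[of D "\<lambda>e. e i - r \<cdot> 1"] LF_diff LF_var LF_const) (auto simp: \<sigma>_def)
        next
          case False
          have "qlin V ?A (\<lambda>e. e j)" using j by (intro qlin_LF LF_var)
          then show ?thesis using False by (simp add: \<sigma>_def)
        qed
      qed
      show "scaled ?d ?c W ?P"
        unfolding scaled_def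
      proof (intro conjI ballI)
        show "0 < ?d j" if "j \<in> W" for j using that R(2) D by (auto simp: scaled_def)
        fix e j assume e: "e \<in> ?P" and j: "j \<in> W"
        have *: "dvg (d j) (\<sigma> e j - c j \<cdot> 1)" using R(2) e j by (auto simp: scaled_def)
        show "dvg (?d j) (e j - ?c j \<cdot> 1)"
        proof (cases "j = i")
          case True
          have "e i - ?c i \<cdot> 1 = D \<cdot> (\<sigma> e i - c i \<cdot> 1)" using q[of e] e by (simp add: \<sigma>_def zs algebra_simps)
          then show ?thesis using * True by (simp add: dvg_cancel[OF D])
        qed (use * in \<open>simp add: \<sigma>_def\<close>)
      qed
      show "aiso ?d ?c V W ?P B (\<lambda>e. h (\<sigma> e)) (\<lambda>e. ?s (k e))"
        unfolding aiso_def
      proof (intro conjI ballI allI impI)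
        fix e assume e: "e \<in> ?P"
        show "h (\<sigma> e) \<in> B" using aisoD(1)[OF R(6)] e by blast
        show "?s (k (h (\<sigma> e))) = e" using aisoD(2)[OF R(6)] s\<sigma> e by simp
        show "h (\<sigma> e) j = e j" if "j \<notin> W" for j using aisoD(3)[OF R(6)] e that W by (auto simp: \<sigma>_def)
      next
        fix e assume e: "e \<in> B"
        then have ke: "k e \<in> P" using aisoD(4)[OF R(6)] by blast
        then have "?s (k e) \<in> X" using fdu_base(2) by blast
        then show "?s (k e) \<in> ?P" using ke \<sigma>s by (auto simp: dvg_scale)
        show "h (\<sigma> (?s (k e))) = e" using aisoD(5)[OF R(6) e] \<sigma>s by simp
        show "?s (k e) j = e j" if "j \<notin> W" for j using aisoD(6)[OF R(6) e that] that W by auto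
      next
        fix j assume j: "j \<in> W"
        show "aff ?d ?c V W ?P (\<lambda>e. h (\<sigma> e) j)"
          by (rule aff_rescale[OF aisoD(7)[OF R(6) j] W(1), where q = q]) (use q in \<open>auto simp: \<sigma>_def\<close>)
        have "aff1 V W B (\<lambda>e. D \<cdot> k e i + r \<cdot> 1)"
          by (intro aff_add aff_scale aff_const aisoD(8)[OF R(6) W(1)])
        then show "aff1 V W B (\<lambda>e. ?s (k e) j)" using aisoD(8)[OF R(6) j] by (cases "j = i") auto
      qed
    qed
    then show ?case by (intro fdu.fdu_base) blast
  next
    case (fdu_Un P Q)
    have "{e \<in> ?A. \<sigma> e \<in> P \<union> Q} = {e \<in> ?A. \<sigma> e \<in> P} \<union> {e \<in> ?A. \<sigma> e \<in> Q}" by auto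
    then show ?case using fdu_Un by (auto intro!: fdu.fdu_Un)
  qed (simp add: fdu_empty)
  from this[OF good] have "good V W {e \<in> ?A. \<sigma> e \<in> ?X'}" by simp
  moreover have "{e \<in> ?A. \<sigma> e \<in> ?X'} = ?A" using s\<sigma> by auto
  ultimately show "good V W ?A" by simp
qed

definition resc :: "int \<Rightarrow> nat set \<Rightarrow> (nat \<Rightarrow> int) \<Rightarrow> (nat \<Rightarrow> 'a) \<Rightarrow> nat \<Rightarrow> 'a" where
  "resc D S c e = (\<lambda>i. if i \<in> S then D \<cdot> e i + c i \<cdot> 1 else e i)"

lemma QF_resc: "QF V X \<Longrightarrow> QF V {e. resc D S c e \<in> X}"
proof -
  assume X: "QF V X"
  have "QF V {e \<in> UNIV. resc D S c e \<in> X}"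
  proof (rule QF_pullback[OF X QF_UNIV])
    fix i assume "i \<in> V"
    then have "(\<lambda>e. if i \<in> S then D \<cdot> e i + c i \<cdot> 1 else e i) \<in> LF V"
      by (cases "i \<in> S") (simp_all add: LF_add LF_scale LF_var LF_const)
    then show "qlin V UNIV (\<lambda>e. resc D S c e i)" unfolding resc_def by (rule qlin_LF)
  qed
  then show ?thesis by simp
qed

lemma good_resc:
  assumes "finite S" "S \<subseteq> W" "W \<subseteq> V" "0 < D" "QF V X" "\<And>c. good V W {e. resc D S c e \<in> X}"
  shows "good V W X"
  using assms
proof (induction S arbitrary: X rule: finite_induct)
  case empty
  then show ?case by (simp add: resc_def)
next
  case (insert j S)
  show ?case
  proof (rule good_rescale[where i = j and D = D])
    fix c0
    have upd: "e(j := D \<cdot> e j + c0 \<cdot> 1) = resc D {j} (\<lambda>_. c0) e" for e by (auto simp: resc_def)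
    have comp: "resc D {j} (\<lambda>_. c0) (resc D S c e) = resc D (insert j S) (c(j := c0)) e" for c e
      using insert(2) by (auto simp: resc_def)
    show "good V W {e. e(j := D \<cdot> e j + c0 \<cdot> 1) \<in> X}"
      unfolding upd by (rule insert.IH) (use insert QF_resc comp in auto)
  qed (use insert in auto)
qed

text \<open>After the substitution every coefficient at \<open>W\<close> is a multiple of
  \<open>D\<close>, and the residues go into the constant. Apart from constants the remainder
  \<open>P\<close> contains only parameters, so a bound can be rounded without mixing coordinates of
  \<open>W\<close>.\<close>

lemma LF_resc:
  assumes "L \<in> LF V" "W \<subseteq> V"
  shows "\<exists>U P. aff1 V W UNIV U \<and> P \<in> LF (V - W) \<and> (\<forall>e. L (resc D W c e) = D \<cdot> U e + P e)"
  using assms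
proof (induction rule: LF.induct)
  case LF_one
  then show ?case by (intro exI[of _ "\<lambda>e. 0"] exI[of _ "\<lambda>e. 1"]) (auto intro: aff_zero LF_intros)
next
  case (LF_var i)
  show ?case
  proof (cases "i \<in> W")
    case True
    then show ?thesis
      by (intro exI[of _ "\<lambda>e. e i"] exI[of _ "\<lambda>e. c i \<cdot> 1"]) (auto intro: aff_coord LF_const simp: resc_def)
  next
    case False
    then show ?thesis using LF_var
      by (intro exI[of _ "\<lambda>e. 0"] exI[of _ "\<lambda>e. e i"]) (auto intro: aff_zero LF_intros simp: resc_def)
  qed
next
  case (LF_add L L')
  then obtain U P U' P' where "aff1 V W UNIV U" "P \<in> LF (V - W)" "\<forall>e. L (resc D W c e) = D \<cdot> U e + P e"
    "aff1 V W UNIV U'" "P' \<in> LF (V - W)" "\<forall>e. L' (resc D W c e) = D \<cdot> U' e + P' e" by blast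
  then show ?case
    by (intro exI[of _ "\<lambda>e. U e + U' e"] exI[of _ "\<lambda>e. P e + P' e"]) 
      (auto intro: aff_add LF_intros simp: zs algebra_simps)
next
  case (LF_minus L)
  then obtain U P where "aff1 V W UNIV U" "P \<in> LF (V - W)" "\<forall>e. L (resc D W c e) = D \<cdot> U e + P e" by blast
  then show ?case
    by (intro exI[of _ "\<lambda>e. - U e"] exI[of _ "\<lambda>e. - P e"]) (auto intro: aff_minus LF_intros)
qed

text \<open>\<alpha> is U plus the ceiling of P/K. The part in \<open>W\<close> is integral already,
  so only \<open>P\<close> is rounded, on a residue class of the parameters. Here \<open>r\<close>
  is the residue of \<open>- P\<close>, the amount to be added to \<open>P\<close> to reach a
  multiple of \<open>K\<close>.\<close>

lemma rounding:
  assumes "0 < K" "aff1 V W UNIV U" "P \<in> LF (V - W)" "r \<in> {0..<K}"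
  shows "\<exists>\<alpha>. aff1 V W {e. dvg K (- P e - r \<cdot> 1)} \<alpha> \<and> 
    (\<forall>e x. dvg K (- P e - r \<cdot> (1::'a)) \<longrightarrow> (K \<cdot> U e + P e \<le> K \<cdot> x \<longleftrightarrow> \<alpha> e \<le> x))"
proof -
  define z where "z e = (SOME z. - P e - r \<cdot> 1 = K \<cdot> z)" for e
  have z: "- P e - r \<cdot> 1 = K \<cdot> z e" if "dvg K (- P e - r \<cdot> 1)" for e
    unfolding z_def using that someI_ex[of "\<lambda>z. - P e - r \<cdot> 1 = K \<cdot> z"] by (auto simp: dvg_def)
  have "qlin (V - W) {e. dvg K (- P e - r \<cdot> 1)} z"
    using assms z by (intro qlinI[of K "\<lambda>e. - P e - r \<cdot> 1"] LF_diff LF_minus LF_const) auto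
  then have "aff1 V W {e. dvg K (- P e - r \<cdot> 1)} z" by (rule aff_par)
  then have aff: "aff1 V W {e. dvg K (- P e - r \<cdot> 1)} (\<lambda>e. U e - z e)"
    by (rule aff_diff[OF aff_subset[OF assms(2)], rotated]) auto
  have "K \<cdot> U e + P e \<le> K \<cdot> x \<longleftrightarrow> U e - z e \<le> x" if "dvg K (- P e - r \<cdot> 1)" for e x
  proof -
    have "K \<cdot> (- z e) = - (K \<cdot> z e)" by simp
    also have "\<dots> = P e + r \<cdot> 1" unfolding z[of e, OF that, symmetric] by simp
    finally have "P e + r \<cdot> 1 = K \<cdot> (- z e)" by (rule sym)
    from ceil_le_iff[OF this assms(4), of "x - U e"] show ?thesis by (simp add: zs algebra_simps)
  qed
  then show ?thesis using aff by blast
qed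

lemma QF_rounding:
  assumes "P \<in> LF (V - W)" "0 < K"
  shows "QF V {e. dvg K (- P e - r \<cdot> (1::'a))}"
proof -
  have "P \<in> LF V" using assms(1) by (rule LF_mono) auto
  then show ?thesis using assms(2) by (intro QF_dvg LF_diff LF_minus LF_const)
qed

text \<open>Once the residue of \<open>- P\<close> modulo \<open>K\<close> is fixed, the bound can
  be replaced by an integral one.\<close>

lemma good_scaled_ray:
  fixes Y :: "(nat \<Rightarrow> 'a) set"
  assumes IH: "\<And>Z::(nat \<Rightarrow> 'a) set. QF V Z \<Longrightarrow> good V W Z" and t: "t \<notin> V" and W: "W \<subseteq> V" and QFY: "QF V Y" 
    and U: "aff1 V W UNIV U" and P: "P \<in> LF (V - W)" and K: "0 < K" and \<epsilon>: "\<epsilon> * \<epsilon> = 1"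
  shows "good (insert t V) (insert t W) (Y \<inter> {e. K \<cdot> U e + P e \<le> K \<cdot> \<epsilon> \<cdot> e t})"
proof (rule fdu_residues[OF K, of _ _ "\<lambda>e. - P e"])
  fix r assume r: "r \<in> {0..<K}"
  let ?Z = "{e. dvg K (- P e - r \<cdot> 1)}"
  obtain \<alpha> where \<alpha>: "aff1 V W ?Z \<alpha>" "\<And>e x. e \<in> ?Z \<Longrightarrow> K \<cdot> U e + P e \<le> K \<cdot> x \<longleftrightarrow> \<alpha> e \<le> x"
    using rounding[OF K U P r] by blast
  have "good V W (Y \<inter> ?Z)" by (intro IH QF_Int QFY QF_rounding[OF P K])
  then have "good (insert t V) (insert t W) (Y \<inter> ?Z \<inter> {e. \<alpha> e \<le> \<epsilon> \<cdot> e t})"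
    by (rule good_ray[OF _ t W aff_subset[OF \<alpha>(1)] \<epsilon>]) auto
  moreover have "Y \<inter> ?Z \<inter> {e. \<alpha> e \<le> \<epsilon> \<cdot> e t} = Y \<inter> {e. K \<cdot> U e + P e \<le> K \<cdot> \<epsilon> \<cdot> e t} \<inter> ?Z"
    using \<alpha>(2) by blast
  ultimately show "good (insert t V) (insert t W) (Y \<inter> {e. K \<cdot> U e + P e \<le> K \<cdot> \<epsilon> \<cdot> e t} \<inter> ?Z)" by simp
qed

lemma good_scaled_segment:
  fixes Y :: "(nat \<Rightarrow> 'a) set"
  assumes IH: "\<And>Z::(nat \<Rightarrow> 'a) set. QF V Z \<Longrightarrow> good V W Z" and t: "t \<notin> V" and W: "W \<subseteq> V" "finite W" and QFY: "QF V Y" 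
    and U: "aff1 V W UNIV U" and P: "P \<in> LF (V - W)" and K: "0 < K"
    and U': "aff1 V W UNIV U'" and P': "P' \<in> LF (V - W)" and K': "0 < K'"
  shows "good (insert t V) (insert t W) (Y \<inter> {e. K \<cdot> U e + P e \<le> K \<cdot> e t} \<inter> {e. K' \<cdot> e t \<le> K' \<cdot> U' e + P' e})"
    (is "good _ _ ?S")
proof (rule fdu_residues[OF K, of _ _ "\<lambda>e. - P e"], rule fdu_residues[OF K', of _ _ "\<lambda>e. - (- P' e)"])
  fix r r' assume r: "r \<in> {0..<K}" "r' \<in> {0..<K'}"
  let ?Z = "{e. dvg K (- P e - r \<cdot> 1)}" and ?Z' = "{e. dvg K' (- (- P' e) - r' \<cdot> 1)}"
  obtain \<alpha> where \<alpha>: "aff1 V W ?Z \<alpha>" "\<And>e x. e \<in> ?Z \<Longrightarrow> K \<cdot> U e + P e \<le> K \<cdot> x \<longleftrightarrow> \<alpha> e \<le> x"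
    using rounding[OF K U P r(1)] by blast
  note mP = LF_minus[OF P']
  obtain \<beta> where \<beta>: "aff1 V W ?Z' \<beta>" 
    "\<And>e x. e \<in> ?Z' \<Longrightarrow> K' \<cdot> (- U' e) + - P' e \<le> K' \<cdot> x \<longleftrightarrow> \<beta> e \<le> x"
    using rounding[OF K' aff_minus[OF U'] mP r(2)] by blast
  \<comment> \<open>The upper bound has been rounded as a lower bound for the negated
    coordinate.\<close>
  have \<beta>': "K' \<cdot> x \<le> K' \<cdot> U' e + P' e \<longleftrightarrow> x \<le> - \<beta> e" if "e \<in> ?Z'" for e x
  proof -
    have "K' \<cdot> x \<le> K' \<cdot> U' e + P' e \<longleftrightarrow> - (K' \<cdot> U' e + P' e) \<le> - (K' \<cdot> x)" by (rule neg_le_iff_le[symmetric])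
    also have "\<dots> \<longleftrightarrow> K' \<cdot> (- U' e) + - P' e \<le> K' \<cdot> (- x)" by simp
    also have "\<dots> \<longleftrightarrow> x \<le> - \<beta> e" using \<beta>(2)[OF that, of "- x"] by (simp add: le_minus_iff)
    finally show ?thesis .
  qed
  have Q: "QF V (Y \<inter> ?Z \<inter> ?Z')" by (intro QF_Int QFY QF_rounding[OF P K] QF_rounding[OF mP K'])
  have "aff1 V W (Y \<inter> ?Z \<inter> ?Z') (\<lambda>e. - \<beta> e)" by (rule aff_minus[OF aff_subset[OF \<beta>(1)]]) blast
  moreover have "aff1 V W (Y \<inter> ?Z \<inter> ?Z') \<alpha>" by (rule aff_subset[OF \<alpha>(1)]) blast
  ultimately have "good (insert t V) (insert t W) (Y \<inter> ?Z \<inter> ?Z' \<inter> {e. \<alpha> e \<le> e t \<and> e t \<le> - \<beta> e})"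
    using good_segment[OF IH t W Q] by blast
  moreover have "Y \<inter> ?Z \<inter> ?Z' \<inter> {e. \<alpha> e \<le> e t \<and> e t \<le> - \<beta> e} = ?S \<inter> ?Z \<inter> ?Z'"
    using \<alpha>(2) \<beta>' by blast
  ultimately show "good (insert t V) (insert t W) (?S \<inter> ?Z \<inter> ?Z')" by simp
qed

text \<open>A box offers only rays and bounded coordinates, so a full line is cut into t \<ge> 0 and
  -t \<ge> 1.\<close>

lemma good_line:
  fixes Y :: "(nat \<Rightarrow> 'a) set"
  assumes IH: "\<And>Z::(nat \<Rightarrow> 'a) set. QF V Z \<Longrightarrow> good V W Z" and t: "t \<notin> V" and W: "W \<subseteq> V" and QFY: "QF V Y" 
  shows "good (insert t V) (insert t W) Y"
proof (rule fdu_split[where Z = "{e. 0 \<le> e t}"])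
  have "good (insert t V) (insert t W) (Y \<inter> {e. 0 \<le> 1 \<cdot> e t})"
    by (rule good_ray[OF IH[OF QFY] t W aff_zero]) simp
  then show "good (insert t V) (insert t W) (Y \<inter> {e. 0 \<le> e t})" by simp
  have "good (insert t V) (insert t W) (Y \<inter> {e. 1 \<cdot> 1 \<le> (- 1) \<cdot> e t})"
    by (rule good_ray[OF IH[OF QFY] t W aff_const]) simp
  moreover have "1 \<le> - x \<longleftrightarrow> \<not> 0 \<le> x" for x :: 'a using less_iff[of 0 "- x"] by (simp add: not_le)
  then have "Y \<inter> {e. 1 \<cdot> 1 \<le> (- 1) \<cdot> e t} = Y - {e. 0 \<le> e t}" by auto
  ultimately show "good (insert t V) (insert t W) (Y - {e. 0 \<le> e t})" by simp
qed

lemma good_cell: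
  fixes C :: "(nat \<Rightarrow> 'a) set"
  assumes IH: "\<And>Z::(nat \<Rightarrow> 'a) set. QF V Z \<Longrightarrow> good V W Z" and t: "t \<notin> V" and W: "W \<subseteq> V" "finite W"
    and C: "C \<in> cells V t" "QF (insert t V) C"
  shows "good (insert t V) (insert t W) C"
proof -
  obtain Y Lo Up N c where Ce: "C = Y \<inter> Lo \<inter> Up \<inter> {e. dvg N (e t - c \<cdot> 1)}"
    "QF V Y" "Lo \<in> lowb V t" "Up \<in> upb V t" "0 < N" using C(1) unfolding cells_def by blast
  have tW: "t \<notin> W" using t W by auto
  \<comment> \<open>A missing bound gets the denominator 1, so that \<open>D\<close> is defined
    uniformly.\<close>
  obtain M1 where M1: "0 < M1" "Lo = UNIV \<or> (\<exists>L\<in>LF V. Lo = {e. L e \<le> M1 \<cdot> e t})"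
  proof (cases "Lo = UNIV")
    case False
    then obtain L M where "L \<in> LF V" "0 < M" "Lo = {e. L e \<le> M \<cdot> e t}" using Ce(3) unfolding lowb_def by blast
    then show ?thesis using that by blast
  qed (use that[of 1] in simp)
  obtain M2 where M2: "0 < M2" "Up = UNIV \<or> (\<exists>L\<in>LF V. Up = {e. M2 \<cdot> e t \<le> L e})"
  proof (cases "Up = UNIV")
    case False
    then obtain L M where "L \<in> LF V" "0 < M" "Up = {e. M \<cdot> e t \<le> L e}" using Ce(4) unfolding upb_def by blast
    then show ?thesis using that by blast
  qed (use that[of 1] in simp)
  \<comment> \<open>Substituting N t + a for \<open>t\<close> makes M1 N and M2 N the coefficients
    of \<open>t\<close> in the two bounds. \<open>D\<close> is a multiple of both, so after the base
    coordinates are rescaled by \<open>D\<close> each bound can be divided by the coefficient of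
    \<open>t\<close>, up to rounding in the parameters.\<close>
  define D where "D = N * M1 * M2"
  have D: "0 < D" using Ce(5) M1 M2 by (simp add: D_def)
  show ?thesis
  proof (rule good_resc[OF W(2) _ _ D C(2)])
    fix b
    let ?X = "{e. resc D W b e \<in> C}"
    show "good (insert t V) (insert t W) ?X"
    proof (rule good_rescale[where i = t and D = N])
      show "QF (insert t V) ?X" by (rule QF_resc[OF C(2)])
      fix a
      let ?s = "\<lambda>e. resc D W b (e(t := N \<cdot> e t + a \<cdot> 1))"
      let ?Y = "{e. resc D W b e \<in> Y}"
      have Y: "QF V ?Y" by (rule QF_resc[OF Ce(2)])
      have st: "?s e t = N \<cdot> e t + a \<cdot> 1" for e using tW by (simp add: resc_def)
      have sL: "L (?s e) = L (resc D W b e)" if "L \<in> LF V" for L e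
        by (rule LF_local[OF that]) (use t in \<open>auto simp: resc_def\<close>)
      have sY: "?s e \<in> Y \<longleftrightarrow> e \<in> ?Y" for e
        unfolding mem_Collect_eq by (rule QF_local[OF Ce(2)]) (use t in \<open>auto simp: resc_def\<close>)
      have lo: "\<exists>U P. aff1 V W UNIV U \<and> P \<in> LF (V - W) \<and>
           (\<forall>e. ?s e \<in> Lo \<longleftrightarrow> (M1 * N) \<cdot> U e + P e \<le> (M1 * N) \<cdot> e t)" if ne: "Lo \<noteq> UNIV"
      proof -
        obtain L where L: "L \<in> LF V" "Lo = {e. L e \<le> M1 \<cdot> e t}" using M1 ne by blast
        obtain U P where U: "aff1 V W UNIV U" "P \<in> LF (V - W)" "\<And>e. L (resc D W b e) = D \<cdot> U e + P e"
          using LF_resc[OF L(1) W(1)] by blast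
        have "?s e \<in> Lo \<longleftrightarrow> (M1 * N) \<cdot> M2 \<cdot> U e + (P e - M1 \<cdot> a \<cdot> 1) \<le> (M1 * N) \<cdot> e t" for e
        proof -
          have "?s e \<in> Lo \<longleftrightarrow> D \<cdot> U e + P e \<le> M1 \<cdot> (N \<cdot> e t + a \<cdot> 1)"
            using sL[OF L(1)] U(3) st unfolding L(2) by simp
          moreover have "D \<cdot> U e = (M1 * N) \<cdot> M2 \<cdot> U e" by (simp add: D_def mult_ac)
          moreover have "M1 \<cdot> (N \<cdot> e t + a \<cdot> 1) = (M1 * N) \<cdot> e t + M1 \<cdot> a \<cdot> 1" by (simp add: zs)
          ultimately show ?thesis by (simp only: diff_le_eq add_diff_eq)
        qed
        moreover have "(\<lambda>e. P e - M1 \<cdot> a \<cdot> 1) \<in> LF (V - W)" by (intro LF_diff U LF_scale LF_one)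
        ultimately show ?thesis using aff_scale[OF U(1)] by blast
      qed
      have up: "\<exists>U P. aff1 V W UNIV U \<and> P \<in> LF (V - W) \<and>
           (\<forall>e. ?s e \<in> Up \<longleftrightarrow> (M2 * N) \<cdot> e t \<le> (M2 * N) \<cdot> U e + P e)" if ne: "Up \<noteq> UNIV"
      proof -
        obtain L where L: "L \<in> LF V" "Up = {e. M2 \<cdot> e t \<le> L e}" using M2 ne by blast
        obtain U P where U: "aff1 V W UNIV U" "P \<in> LF (V - W)" "\<And>e. L (resc D W b e) = D \<cdot> U e + P e"
          using LF_resc[OF L(1) W(1)] by blast
        have "?s e \<in> Up \<longleftrightarrow> (M2 * N) \<cdot> e t \<le> (M2 * N) \<cdot> M1 \<cdot> U e + (P e - M2 \<cdot> a \<cdot> 1)" for e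
        proof -
          have "?s e \<in> Up \<longleftrightarrow> M2 \<cdot> (N \<cdot> e t + a \<cdot> 1) \<le> D \<cdot> U e + P e"
            using sL[OF L(1)] U(3) st unfolding L(2) by simp
          moreover have "D \<cdot> U e = (M2 * N) \<cdot> M1 \<cdot> U e" by (simp add: D_def mult_ac)
          moreover have "M2 \<cdot> (N \<cdot> e t + a \<cdot> 1) = (M2 * N) \<cdot> e t + M2 \<cdot> a \<cdot> 1" by (simp add: zs)
          ultimately show ?thesis by (simp only: le_diff_eq add_diff_eq)
        qed
        moreover have "(\<lambda>e. P e - M2 \<cdot> a \<cdot> 1) \<in> LF (V - W)" by (intro LF_diff U LF_scale LF_one)
        ultimately show ?thesis using aff_scale[OF U(1)] by blast
      qed
      have K: "0 < M1 * N" "0 < M2 * N" using M1 M2 Ce(5) by auto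
      have main: "good (insert t V) (insert t W) {e. ?s e \<in> Y \<inter> Lo \<inter> Up}"
      proof (cases "Lo = UNIV")
        case True
        show ?thesis
        proof (cases "Up = UNIV")
          case True
          then show ?thesis using good_line[OF IH t W(1) Y] sY \<open>Lo = UNIV\<close> by simp
        next
          case False
          then obtain U P where U: "aff1 V W UNIV U" "P \<in> LF (V - W)"
            "\<And>e. ?s e \<in> Up \<longleftrightarrow> (M2 * N) \<cdot> e t \<le> (M2 * N) \<cdot> U e + P e" using up by blast
          have \<epsilon>: "(- 1) * (- 1) = (1::int)" by simp
          have "good (insert t V) (insert t W) 
             (?Y \<inter> {e. (M2 * N) \<cdot> (- U e) + - P e \<le> (M2 * N) \<cdot> (- 1) \<cdot> e t})"
            by (rule good_scaled_ray[OF IH t W(1) Y aff_minus[OF U(1)] LF_minus[OF U(2)] K(2) \<epsilon>])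
          moreover have "(M2 * N) \<cdot> (- U e) + - P e \<le> (M2 * N) \<cdot> (- 1) \<cdot> e t \<longleftrightarrow> ?s e \<in> Up" for e
          proof -
            have "(M2 * N) \<cdot> (- U e) + - P e = - ((M2 * N) \<cdot> U e + P e)" by simp
            moreover have "(M2 * N) \<cdot> (- 1) \<cdot> e t = - ((M2 * N) \<cdot> e t)" by simp
            ultimately show ?thesis unfolding U(3) by (simp only: neg_le_iff_le)
          qed
          ultimately show ?thesis using sY True by (simp add: Int_def conj_commute)
        qed
      next
        case False
        then obtain U P where U: "aff1 V W UNIV U" "P \<in> LF (V - W)"
          "\<And>e. ?s e \<in> Lo \<longleftrightarrow> (M1 * N) \<cdot> U e + P e \<le> (M1 * N) \<cdot> e t" using lo by blast
        show ?thesis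
        proof (cases "Up = UNIV")
          case True
          have \<epsilon>: "1 * 1 = (1::int)" by simp
          have "good (insert t V) (insert t W) (?Y \<inter> {e. (M1 * N) \<cdot> U e + P e \<le> (M1 * N) \<cdot> 1 \<cdot> e t})"
            by (rule good_scaled_ray[OF IH t W(1) Y U(1,2) K(1) \<epsilon>])
          moreover have "?Y \<inter> {e. (M1 * N) \<cdot> U e + P e \<le> (M1 * N) \<cdot> 1 \<cdot> e t} = {e. ?s e \<in> Y \<inter> Lo \<inter> Up}"
            using sY True U(3) by auto
          ultimately show ?thesis by simp
        next
          case False
          then obtain U' P' where U': "aff1 V W UNIV U'" "P' \<in> LF (V - W)"
            "\<And>e. ?s e \<in> Up \<longleftrightarrow> (M2 * N) \<cdot> e t \<le> (M2 * N) \<cdot> U' e + P' e" using up by blast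
          have "?Y \<inter> {e. (M1 * N) \<cdot> U e + P e \<le> (M1 * N) \<cdot> e t} \<inter> {e. (M2 * N) \<cdot> e t \<le> (M2 * N) \<cdot> U' e + P' e} 
              = {e. ?s e \<in> Y \<inter> Lo \<inter> Up}"
            using sY U(3) U'(3) by auto
          then show ?thesis using good_scaled_segment[OF IH t W Y U(1,2) K(1) U'(1,2) K(2)] by simp
        qed
      qed
      \<comment> \<open>After the substitution the congruence no longer involves the point: it holds
        everywhere or nowhere.\<close>
      have dv: "dvg N (?s e t - c \<cdot> 1) \<longleftrightarrow> dvg N ((a - c) \<cdot> (1::'a))" for e
        using dvg_diff_iff[OF dvg_scale[of N "e t"], of "N \<cdot> e t + a \<cdot> 1 - c \<cdot> 1"] unfolding st by (simp add: zs)
      show "good (insert t V) (insert t W) {e. e(t := N \<cdot> e t + a \<cdot> 1) \<in> ?X}"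
      proof (cases "dvg N ((a - c) \<cdot> (1::'a))")
        case True
        then have "{e. e(t := N \<cdot> e t + a \<cdot> 1) \<in> ?X} = {e. ?s e \<in> Y \<inter> Lo \<inter> Up}"
          using dv unfolding Ce(1) by auto
        then show ?thesis using main by simp
      next
        case False
        then have "{e. e(t := N \<cdot> e t + a \<cdot> 1) \<in> ?X} = {}" using dv unfolding Ce(1) by auto
        then show ?thesis using fdu_empty by simp
      qed
    qed (use W Ce(5) in auto)
  qed (use W in auto)
qed

text \<open>\<open>V\<close> loses the same index as \<open>W\<close>, so the parameters stay the
  same throughout the induction, and a cell in the removed coordinate is treated over the remaining
  ones.\<close>

lemma good_QF:
  fixes X :: "(nat \<Rightarrow> 'a) set"
  assumes "finite W" "W \<subseteq> V" "QF V X"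
  shows "good V W X"
  using assms
proof (induction W arbitrary: V X rule: finite_induct)
  case empty
  \<comment> \<open>With only parameters left nothing has to be straightened: every set is a
    box.\<close>
  have "box {} {} X" by (auto simp: box_def)
  then show ?case using empty by (intro good_if_rect1 fdu_base rect1_box[where L = "{}"]) auto
next
  case (insert t W)
  define V0 where "V0 = V - {t}"
  have V0: "V = insert t V0" "t \<notin> V0" "W \<subseteq> V0" using insert by (auto simp: V0_def)
  have IH: "good V0 W Z" if "QF V0 Z" for Z :: "(nat \<Rightarrow> 'a) set" using insert.IH[OF V0(3) that] .
  have X: "fdu (cells V0 t) X" using fdu_cells_QF insert.prems(2) unfolding V0(1) by blast
  have "good V (insert t W) (X \<inter> UNIV)"
  proof (rule fdu_induct_set[OF X])
    fix C :: "(nat \<Rightarrow> 'a) set" assume C: "C \<in> cells V0 t"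
    have "QF (insert t V0) C"
    proof -
      obtain Y Lo Up N c where Ce: "C = Y \<inter> Lo \<inter> Up \<inter> {e. dvg N (e t - c \<cdot> 1)}"
        "QF V0 Y" "Lo \<in> lowb V0 t" "Up \<in> upb V0 t" "0 < N" using C unfolding cells_def by blast
      have mono: "L \<in> LF (insert t V0)" if "L \<in> LF V0" for L :: "(nat \<Rightarrow> 'a) \<Rightarrow> 'a" using that by (rule LF_mono) auto
      have t: "(\<lambda>e::nat \<Rightarrow> 'a. e t) \<in> LF (insert t V0)" by (rule LF_var) simp
      have "QF (insert t V0) {e. L e \<le> M \<cdot> e t}" if "L \<in> LF V0" for L :: "(nat \<Rightarrow> 'a) \<Rightarrow> 'a" and M
        by (intro QF_le mono[OF that] LF_scale t)
      then have "QF (insert t V0) Lo" using Ce(3) QF_UNIV unfolding lowb_def by blast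
      moreover have "QF (insert t V0) {e. M \<cdot> e t \<le> L e}" if "L \<in> LF V0" for L :: "(nat \<Rightarrow> 'a) \<Rightarrow> 'a" and M
        by (intro QF_le mono[OF that] LF_scale t)
      then have "QF (insert t V0) Up" using Ce(4) QF_UNIV unfolding upb_def by blast
      moreover have "QF (insert t V0) Y" using Ce(2) by (rule QF_mono) auto
      moreover have "QF (insert t V0) {e::nat \<Rightarrow> 'a. dvg N (e t - c \<cdot> 1)}" using Ce(5) by (intro QF_dvg LF_diff t LF_const)
      ultimately show ?thesis unfolding Ce(1) by (intro QF_Int)
    qed
    then show "good V (insert t W) (C \<inter> UNIV)"
      using good_cell[OF IH V0(2,3) insert(1) C] unfolding V0(1) by simp
  qed
  then show ?case by simp
qed

end

section \<open>Points as lists\<close>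

text \<open>Padding with a fixed value matters: isomorphisms and boxes refer to all coordinates
  outside \<open>W\<close>, including those beyond the list, and these must not vary with the
  list.\<close>

definition nl :: "'a::zero list \<Rightarrow> nat \<Rightarrow> 'a" where
  "nl z i = (if i < length z then z ! i else 0)"

text \<open>\<open>box\<close> changes one free coordinate at a time; finitely many changes in
  succession give this.\<close>

lemma box_free:
  assumes "box W L B" "finite L" "e \<in> B" "\<And>i. i \<notin> L \<Longrightarrow> e' i = e i" "\<And>i. i \<in> L \<Longrightarrow> 0 \<le> e' i"
  shows "e' \<in> B"
proof -
  have "(\<lambda>i. if i \<in> S then e' i else e i) \<in> B" if "finite S" "S \<subseteq> L" for S
    using that
  proof (induction S rule: finite_induct)
    case empty
    then show ?case using assms(3) by simp
  next
    case (insert j S)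
    have "(\<lambda>i. if i \<in> S then e' i else e i)(j := e' j) \<in> B"
      using insert assms(5) by (intro boxD(2)[OF assms(1)]) auto
    moreover have "(\<lambda>i. if i \<in> S then e' i else e i)(j := e' j) = (\<lambda>i. if i \<in> insert j S then e' i else e i)"
      by auto
    ultimately show ?case by simp
  qed
  from this[OF assms(2) order_refl] have "(\<lambda>i. if i \<in> L then e' i else e i) \<in> B" .
  moreover have "(\<lambda>i. if i \<in> L then e' i else e i) = e'" using assms(4) by auto
  ultimately show ?thesis by simp
qed

text \<open>Orders the coordinates so that the free ones come first, as a product with
  \<open>Hpow l\<close> on the left requires.\<close>

lemma ex_bij_first:
  assumes "L \<subseteq> W" "finite W"
  shows "\<exists>\<sigma>. bij_betw \<sigma> {..<card W} W \<and> (\<forall>j<card W. \<sigma> j \<in> L \<longleftrightarrow> j < card L)"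
proof -
  have fin: "finite L" using assms by (rule finite_subset)
  have le: "card L \<le> card W" using assms by (intro card_mono)
  obtain f where f: "bij_betw f {..<card L} L"
    using finite_same_card_bij[of "{..<card L}" L] fin by auto
  obtain g where g: "bij_betw g {card L..<card W} (W - L)"
    using finite_same_card_bij[of "{card L..<card W}" "W - L"] assms fin by (auto simp: card_Diff_subset)
  let ?\<sigma> = "\<lambda>j. if j \<in> {..<card L} then f j else g j"
  have "bij_betw ?\<sigma> ({..<card L} \<union> {card L..<card W}) (L \<union> (W - L))"
    by (rule bij_betw_disjoint_Un[OF f g]) auto
  moreover have "{..<card L} \<union> {card L..<card W} = {..<card W}" "L \<union> (W - L) = W"
    using le assms by auto
  moreover have "?\<sigma> j \<in> L \<longleftrightarrow> j < card L" if "j < card W" for j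
  proof (cases "j < card L")
    case True
    then show ?thesis using bij_betwE[OF f] by simp
  next
    case False
    then show ?thesis using bij_betwE[OF g] that by simp
  qed
  ultimately show ?thesis by (intro exI[of _ ?\<sigma>]) simp
qed

text \<open>A linear map needs residues with 0 \<le> c < d, whereas rescaling produces arbitrary
  integers. Reducing c modulo d changes the quotient by the constant c div d only.\<close>

lemma aff_mod:
  assumes "aff d c V W A u" shows "aff d (\<lambda>i. c i mod d i) V W A u"
  using assms
proof (induction rule: aff.induct)
  case (aff_var i u)
  have "aff d (\<lambda>i. c i mod d i) V W A (\<lambda>e. u e + (c i div d i) \<cdot> 1)"
  proof (rule aff.aff_var[OF aff_var(1)])
    fix e assume "e \<in> A"
    then have "d i \<cdot> (u e + (c i div d i) \<cdot> 1) = e i - c i \<cdot> 1 + (d i * (c i div d i)) \<cdot> 1"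
      using aff_var(2) by (simp add: zs)
    also have "\<dots> = e i - (c i - d i * (c i div d i)) \<cdot> 1" by (simp only: zs) (simp add: algebra_simps)
    finally show "d i \<cdot> (u e + (c i div d i) \<cdot> 1) = e i - (c i mod d i) \<cdot> 1" by (simp only: minus_mult_div_eq_mod)
  qed
  from aff_diff[OF this aff_const[of _ _ _ _ _ "c i div d i"]] show ?case by simp
qed (auto intro: aff.intros)

lemma scaled_mod:
  fixes A :: "(nat \<Rightarrow> 'a::{linordered_ab_group_add,one}) set"
  assumes "scaled d c W A" shows "scaled d (\<lambda>i. c i mod d i) W A"
proof -
  have "dvg (d i) (e i - (c i mod d i) \<cdot> 1)" if "dvg (d i) (e i - c i \<cdot> 1)" for e :: "nat \<Rightarrow> 'a" and i
  proof -
    have "dvg (d i) (e i - c i \<cdot> 1 + d i \<cdot> (c i div d i) \<cdot> 1)" by (intro dvg_add that dvg_scale)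
    moreover have "e i - c i \<cdot> 1 + d i \<cdot> (c i div d i) \<cdot> 1 = e i - (c i - d i * (c i div d i)) \<cdot> 1"
      by (simp only: zs zm.scale_scale) (simp add: algebra_simps)
    ultimately show ?thesis by (simp only: minus_mult_div_eq_mod)
  qed
  then show ?thesis using assms by (auto simp: scaled_def)
qed

lemma gdiv_dvg:
  fixes y :: "'a::linordered_ab_group_add"
  assumes "0 < d" "dvg d y" shows "d \<cdot> gdiv y (nat d) = y"
proof -
  obtain z where z: "y = d \<cdot> z" using assms(2) by (auto simp: dvg_def)
  have "gdiv y (nat d) = z"
    unfolding gdiv_def
  proof (rule the_equality)
    show "nmult (nat d) z = y" using z assms(1) by (simp add: zmult_int[symmetric])
    show "w = z" if "nmult (nat d) w = y" for w
      using that z zmult_cancel[OF assms(1), of w z] assms(1) by (simp add: zmult_int[symmetric])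
  qed
  then show ?thesis using z by simp
qed

section \<open>From environments to definable sets and linear maps on lists\<close>

context zgroup
begin

lemma definable_if_QF:
  fixes p :: "'a list"
  assumes "QF {..<length p + k} A" shows "definable p k {y \<in> Gpow k. nl (p @ y) \<in> A}"
proof -
  obtain \<phi> where \<phi>: "fvars \<phi> \<subseteq> {..<length p + k}" "A = {e. sat e \<phi>}" using sat_QF[OF assms] by blast
  \<comment> \<open>Padding and the unspecified values of \<open>nth\<close> differ only beyond the
    variables on which \<open>A\<close> depends.\<close>
  have "nl (p @ y) \<in> A \<longleftrightarrow> nth (p @ y) \<in> A" if "y \<in> Gpow k" for y :: "'a list"
    by (rule QF_local[OF assms]) (use that in \<open>auto simp: nl_def Gpow_def\<close>)
  then have "{y \<in> Gpow k. nl (p @ y) \<in> A} = {y \<in> Gpow k. sat (nth (p @ y)) \<phi>}" using \<phi>(2) by blast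
  then show ?thesis unfolding definable_def using \<phi>(1) by blast
qed

lemma QF_if_definable:
  fixes Y :: "'a list set"
  assumes "definable [] k Y" shows "\<exists>A. QF {..<k} A \<and> Y = {y \<in> Gpow k. nl y \<in> A}"
proof -
  obtain \<phi> where \<phi>: "fvars \<phi> \<subseteq> {..<k}" "Y = {y \<in> Gpow k. sat (nth y) \<phi>}" 
    using assms unfolding definable_def by auto
  have A: "QF {..<k} {e::nat \<Rightarrow> 'a. sat e \<phi>}" by (rule QF_sat[OF \<phi>(1)])
  have "nl y \<in> {e. sat e \<phi>} \<longleftrightarrow> nth y \<in> {e. sat e \<phi>}" if "y \<in> Gpow k" for y :: "'a list"
    by (rule QF_local[OF A]) (use that in \<open>auto simp: nl_def Gpow_def\<close>)
  then have "Y = {y \<in> Gpow k. nl y \<in> {e. sat e \<phi>}}" using \<phi>(2) by blast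
  then show ?thesis using A by blast
qed

text \<open>With the parameters fixed, the part that depends on them alone becomes the constant
  \<gamma>, whatever its denominators.\<close>

lemma linear_on_if_aff:
  fixes A :: "(nat \<Rightarrow> 'a) set" and p :: "'a list"
  assumes u: "aff d c {..<m + n} {m..<m + n} A u" and sc: "scaled d c {m..<m + n} A" and p: "length p = m"
  shows "linear_on n {x. length x = n \<and> nl (p @ x) \<in> A} (\<lambda>x. u (nl (p @ x)))" (is "linear_on n ?F _")
proof -
  let ?V = "{..<m + n}" and ?W = "{m..<m + n}"
  define b where "b i = c i mod d i" for i
  define q where "q e i = gdiv (e i - b i \<cdot> (1::'a)) (nat (d i))" for e i
  have dpos: "0 < d i" if "i \<in> ?W" for i using sc that by (simp add: scaled_def)
  have dv: "dvg (d i) (e i - b i \<cdot> 1)" if "e \<in> A" "i \<in> ?W" for e i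
    using scaled_mod[OF sc] that by (simp add: scaled_def b_def)
  have q: "d i \<cdot> q e i = e i - b i \<cdot> 1" if "e \<in> A" "i \<in> ?W" for e i
    unfolding q_def by (rule gdiv_dvg[OF dpos[OF that(2)] dv[OF that]])
  have "aff d b ?V ?W A u" using aff_mod[OF u] by (simp add: b_def[abs_def])
  from aff_sum[where q = q, OF this _ dpos q] obtain a g where g: "qlin (?V - ?W) A g"
    "\<And>e. e \<in> A \<Longrightarrow> u e = (\<Sum>i\<in>?W. a i \<cdot> q e i) + g e" by auto
  \<comment> \<open>On an empty fibre any \<gamma> will do; otherwise the value at one point is the
    value at all of them.\<close>
  obtain \<gamma> where \<gamma>: "g (nl (p @ x)) = \<gamma>" if "x \<in> ?F" for x
  proof (cases "?F = {}")
    case False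
    then obtain x0 where x0: "x0 \<in> ?F" by blast
    have "g (nl (p @ x)) = g (nl (p @ x0))" if "x \<in> ?F" for x
      by (rule qlin_local[OF g(1)]) (use that x0 p in \<open>auto simp: nl_def nth_append\<close>)
    then show ?thesis using that by blast
  qed (use that in blast)
  have b0: "0 \<le> b i" "b i < d i" if "i \<in> ?W" for i using dpos[OF that] by (auto simp: b_def)
  have nm: "nmult (nat (b i)) 1 = b i \<cdot> (1::'a)" if "i \<in> ?W" for i
    using b0[OF that] by (simp add: zmult_int[symmetric])
  show ?thesis
    unfolding linear_on_def
  proof (intro conjI exI allI ballI impI)
    show "?F \<subseteq> Gpow n" by (auto simp: Gpow_def)
    show "nat (b (m + i)) < nat (d (m + i))" if "i < n" for i using b0[of "m + i"] that by auto
    fix x assume x: "x \<in> ?F"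
    then have e: "nl (p @ x) \<in> A" and lx: "length x = n" by auto
    have xi: "nl (p @ x) (m + i) = x ! i" if "i < n" for i using that lx p by (simp add: nl_def nth_append)
    show "gcong (nat (d (m + i))) (x ! i) (nmult (nat (b (m + i))) 1)" if "i < n" for i
      using dv[OF e, of "m + i"] dpos[of "m + i"] that nm[of "m + i"] xi[OF that] by (simp add: gcong_dvg)
    have "(\<Sum>i\<in>?W. a i \<cdot> q (nl (p @ x)) i) = (\<Sum>i<n. a (m + i) \<cdot> q (nl (p @ x)) (m + i))"
      by (rule sum.reindex_bij_witness[of _ "\<lambda>i. m + i" "\<lambda>i. i - m"]) auto
    also have "\<dots> = (\<Sum>i<n. zmult (a (m + i)) (gdiv (x ! i - nmult (nat (b (m + i))) 1) (nat (d (m + i)))))"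
      by (rule sum.cong) (use xi nm in \<open>auto simp: q_def\<close>)
    finally show "u (nl (p @ x)) = (\<Sum>i<n. zmult (a (m + i)) (gdiv (x ! i - nmult (nat (b (m + i))) 1) (nat (d (m + i))))) + \<gamma>"
      using g(2)[OF e] \<gamma>[OF x] by simp
  qed
qed

text \<open>\<open>f\<close> is \<open>h\<close> up to a permutation of the target coordinates that
  puts the free ones first. The number \<open>l\<close> is the size of \<open>L\<close>, hence the
  same for all fibres of the piece.\<close>

lemma rect_piece:
  fixes A' :: "(nat \<Rightarrow> 'a) set"
  assumes A': "A' \<in> rect d c {..<m + n} {m..<m + n}"
  defines "A \<equiv> {z \<in> Gpow (m + n). nl z \<in> A'}"
  shows "definable [] (m + n) A \<and>
      (\<exists>B l f. B \<subseteq> Gpow (m + n) \<and> proj_first m A = proj_first m B \<and> l \<le> n \<and>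
        definable_family m n n A f \<and>
        (\<forall>p\<in>proj_first m A.
          linear_map_on n n (fiber A p) (f p) \<and>
          bij_betw (f p) (fiber A p) (fiber B p) \<and>
          (\<exists>\<Lambda>. gbounded (n - l) \<Lambda> \<and> definable p (n - l) \<Lambda> \<and>
             fiber B p = cart_prod (Hpow l) \<Lambda>)))"
proof -
  let ?V = "{..<m + n}" and ?W = "{m..<m + n}"
  obtain L B' h k where QA: "QF ?V A'" and sc: "scaled d c ?W A'" and L: "L \<subseteq> ?W" and QB: "QF ?V B'" 
    and box: "box ?W L B'" and iso: "aiso d c ?V ?W A' B' h k"
    using A' by (rule rectE)
  note D = aisoD[OF iso]
  have WV: "?W \<subseteq> ?V" by auto
  have dpos: "0 < d i" if "i \<in> ?W" for i using sc that by (simp add: scaled_def)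
  have finL: "finite L" using L by (rule finite_subset) simp
  define l where "l = card L"
  have ln: "l \<le> n" using card_mono[OF _ L] by (simp add: l_def)
  obtain \<sigma> where \<sigma>: "bij_betw \<sigma> {..<n} ?W" "\<And>j. j < n \<Longrightarrow> \<sigma> j \<in> L \<longleftrightarrow> j < l"
    using ex_bij_first[OF L] by (auto simp: l_def)
  define \<tau> where "\<tau> = the_inv_into {..<n} \<sigma>"
  have \<sigma>W: "\<sigma> j \<in> ?W" if "j < n" for j using bij_betwE[OF \<sigma>(1)] that by simp
  have \<tau>\<sigma>: "\<tau> (\<sigma> j) = j" if "j < n" for j
    using the_inv_into_f_f[OF bij_betw_imp_inj_on[OF \<sigma>(1)]] that by (simp add: \<tau>_def)
  have \<tau>: "\<tau> i < n" "\<sigma> (\<tau> i) = i" if "i \<in> ?W" for i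
    using f_the_inv_into_f_bij_betw[OF \<sigma>(1), of i] the_inv_into_into[OF bij_betw_imp_inj_on[OF \<sigma>(1)], of i "{..<n}"]
      bij_betw_imp_surj_on[OF \<sigma>(1)] that by (auto simp: \<tau>_def)
  have \<tau>L: "i \<in> L \<longleftrightarrow> \<tau> i < l" if "i \<in> ?W" for i using \<sigma>(2)[OF \<tau>(1)[OF that]] \<tau>(2)[OF that] by simp
  \<comment> \<open>The environment whose coordinates in \<open>W\<close>, listed in the order of
    \<sigma>, are \<open>y\<close>, and whose other coordinates are those of
    \<open>p\<close>.\<close>
  define E where "E p y = (\<lambda>i. if i \<in> ?W then y ! \<tau> i else nl p i)" for p y :: "'a list"
  define f where "f p x = map (\<lambda>j. h (nl (p @ x)) (\<sigma> j)) [0..<n]" for p x :: "'a list"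
  define g where "g p y = map (\<lambda>i. k (E p y) (m + i)) [0..<n]" for p y :: "'a list"
  define B where "B = {p @ y | p y. length p = m \<and> length y = n \<and> E p y \<in> B'}"
  have fibA: "fiber A p = {x. length x = n \<and> nl (p @ x) \<in> A'}" if "length p = m" for p
    using that by (auto simp: fiber_def A_def Gpow_def)
  have fibB: "fiber B p = {y. length y = n \<and> E p y \<in> B'}" if "length p = m" for p
    using that by (auto simp: fiber_def B_def)
  have nl_out: "nl (p @ x) i = nl p i" if "length p = m" "length x = n" "i \<notin> ?W" for p x :: "'a list" and i
    using that by (auto simp: nl_def nth_append)
  have hE: "h (nl (p @ x)) = E p (f p x)" if "length p = m" "x \<in> fiber A p" for p x
  proof
    fix i
    have x: "length x = n" "nl (p @ x) \<in> A'" using that fibA by auto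
    show "h (nl (p @ x)) i = E p (f p x) i"
      using \<tau>[of i] D(3)[OF x(2), of i] nl_out[OF that(1) x(1), of i] by (simp add: E_def f_def)
  qed
  have kE: "k (E p y) = nl (p @ g p y)" if "length p = m" "y \<in> fiber B p" for p y
  proof
    fix i
    have y: "length y = n" "E p y \<in> B'" using that fibB by auto
    have "length (g p y) = n" by (simp add: g_def)
    from nl_out[OF that(1) this, of i] show "k (E p y) i = nl (p @ g p y) i"
      using D(6)[OF y(2), of i] that(1) by (auto simp: E_def g_def nl_def nth_append)
  qed
  have fB: "f p x \<in> fiber B p" if "length p = m" "x \<in> fiber A p" for p x
  proof -
    have "nl (p @ x) \<in> A'" using that fibA by blast
    from D(1)[OF this] have "E p (f p x) \<in> B'" by (simp only: hE[OF that])
    then show ?thesis using that fibB by (simp add: f_def)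
  qed
  have gA: "g p y \<in> fiber A p" if "length p = m" "y \<in> fiber B p" for p y
  proof -
    have "E p y \<in> B'" using that fibB by blast
    from D(4)[OF this] have "nl (p @ g p y) \<in> A'" by (simp only: kE[OF that])
    then show ?thesis using that fibA by (simp add: g_def)
  qed
  have gf: "g p (f p x) = x" if "length p = m" "x \<in> fiber A p" for p x
  proof (rule nth_equalityI)
    have x: "length x = n" "nl (p @ x) \<in> A'" using that fibA by auto
    show "length (g p (f p x)) = length x" using x by (simp add: g_def)
    fix i assume "i < length (g p (f p x))"
    then have i: "i < n" by (simp add: g_def)
    have "k (E p (f p x)) = nl (p @ x)" using D(2)[OF x(2)] hE[OF that] by simp
    then show "g p (f p x) ! i = x ! i" using i x that by (simp add: g_def nl_def nth_append)
  qed
  have fg: "f p (g p y) = y" if "length p = m" "y \<in> fiber B p" for p y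
  proof (rule nth_equalityI)
    have y: "length y = n" "E p y \<in> B'" using that fibB by auto
    show "length (f p (g p y)) = length y" using y by (simp add: f_def)
    fix j assume "j < length (f p (g p y))"
    then have j: "j < n" by (simp add: f_def)
    have "h (nl (p @ g p y)) = E p y" using D(5)[OF y(2)] kE[OF that] by simp
    then show "f p (g p y) ! j = y ! j" using j \<sigma>W[OF j] \<tau>\<sigma>[OF j] by (simp add: f_def E_def)
  qed
  have projA: "p \<in> proj_first m A \<longleftrightarrow> length p = m \<and> fiber A p \<noteq> {}" for p
  proof
    assume "p \<in> proj_first m A"
    then obtain z where z: "z \<in> A" "p = take m z" by (auto simp: proj_first_def)
    then have "length p = m" by (simp add: A_def Gpow_def)
    moreover have "drop m z \<in> fiber A p" using z by (simp add: fiber_def)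
    ultimately show "length p = m \<and> fiber A p \<noteq> {}" by blast
  next
    assume "length p = m \<and> fiber A p \<noteq> {}"
    then obtain x where "length p = m" "p @ x \<in> A" by (auto simp: fiber_def)
    then show "p \<in> proj_first m A" unfolding proj_first_def by (intro image_eqI[of _ _ "p @ x"]) auto
  qed
  have projB: "p \<in> proj_first m B \<longleftrightarrow> length p = m \<and> fiber B p \<noteq> {}" for p
  proof
    assume "p \<in> proj_first m B"
    then obtain z where z: "z \<in> B" "p = take m z" by (auto simp: proj_first_def)
    then have "length p = m" by (auto simp: B_def)
    moreover have "drop m z \<in> fiber B p" using z by (simp add: fiber_def)
    ultimately show "length p = m \<and> fiber B p \<noteq> {}" by blast
  next
    assume "length p = m \<and> fiber B p \<noteq> {}"
    then obtain x where "length p = m" "p @ x \<in> B" by (auto simp: fiber_def)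
    then show "p \<in> proj_first m B" unfolding proj_first_def by (intro image_eqI[of _ _ "p @ x"]) auto
  qed
  have "definable [] (m + n) {z \<in> Gpow (m + n). nl ([] @ z) \<in> A'}"
    by (rule definable_if_QF) (use QA in simp)
  then have defA: "definable [] (m + n) A" by (simp add: A_def)
  have BG: "B \<subseteq> Gpow (m + n)" by (auto simp: B_def Gpow_def)
  have proj: "proj_first m A = proj_first m B"
  proof (rule set_eqI)
    fix p
    have "length p = m \<Longrightarrow> fiber A p \<noteq> {} \<longleftrightarrow> fiber B p \<noteq> {}" using fB gA by blast
    then show "p \<in> proj_first m A \<longleftrightarrow> p \<in> proj_first m B" using projA projB by blast
  qed
  have fam: "definable_family m n n A f"
  proof -
    let ?V' = "{..<m + n + n}"
    have QA': "QF ?V' A'" using QA by (rule QF_mono) auto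
    have ql: "qlin ?V' A' (\<lambda>e. h e (\<sigma> j))" if "j < n" for j
      by (rule qlin_mono[OF aff_qlin[OF D(7)[OF \<sigma>W[OF that]] WV dpos]]) auto
    have ql': "qlin ?V' A' (\<lambda>e. e (m + n + j))" if "j < n" for j
      using that by (intro qlin_LF LF_var) auto
    \<comment> \<open>The graph, with the values of the map in the last \<open>n\<close>
      coordinates; equality is split into two inequalities, to which \<open>QF_qlin_le\<close>
      applies.\<close>
    let ?Q = "A' \<inter> (\<Inter>j\<in>{..<n}. {e \<in> A'. h e (\<sigma> j) \<le> e (m + n + j)} \<inter> {e \<in> A'. e (m + n + j) \<le> h e (\<sigma> j)})"
    have "QF ?V' ?Q" by (intro QF_Int QF_INT QF_qlin_le QA' ql ql') auto
    then have "definable [] (m + n + n) {z \<in> Gpow (m + n + n). nl ([] @ z) \<in> ?Q}"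
      by (intro definable_if_QF) simp
    moreover have "{z \<in> Gpow (m + n + n). nl ([] @ z) \<in> ?Q} = 
        {p @ x @ f p x | p x. p \<in> proj_first m A \<and> x \<in> fiber A p}" (is "?l = ?r")
    proof -
      have key: "p @ x @ y \<in> ?l \<longleftrightarrow> nl (p @ x) \<in> A' \<and> y = f p x" 
        if len: "length p = m" "length x = n" "length y = n" for p x y
      proof -
        let ?e = "nl (p @ x @ y)"
        have loc: "?e i = nl (p @ x) i" if "i \<in> ?V" for i using that len by (auto simp: nl_def nth_append)
        have eA: "?e \<in> A' \<longleftrightarrow> nl (p @ x) \<in> A'" using QF_local[OF QA] loc by blast
        have ey: "?e (m + n + j) = y ! j" if "j < n" for j using that len by (simp add: nl_def nth_append)
        have hh: "h ?e (\<sigma> j) = f p x ! j" if "j < n" "nl (p @ x) \<in> A'" for j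
        proof -
          have "h ?e (\<sigma> j) = h (nl (p @ x)) (\<sigma> j)"
            by (rule aff_local[OF D(7)[OF \<sigma>W[OF that(1)]] WV dpos]) (use that(2) eA loc in auto)
          then show ?thesis using that by (simp add: f_def)
        qed
        have "p @ x @ y \<in> ?l \<longleftrightarrow> nl (p @ x) \<in> A' \<and> (\<forall>j<n. f p x ! j = y ! j)"
          using len eA ey hh by (auto simp: Gpow_def intro: order_antisym)
        also have "(\<forall>j<n. f p x ! j = y ! j) \<longleftrightarrow> y = f p x"
          using len(3) by (auto simp: list_eq_iff_nth_eq f_def)
        finally show ?thesis .
      qed
      show ?thesis
      proof (intro set_eqI iffI)
        fix z assume z: "z \<in> ?l"
        then have lz: "length z = m + n + n" by (simp add: Gpow_def)
        have "z = take m z @ take n (drop m z) @ drop n (drop m z)" by (metis append_take_drop_id)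
        moreover have "length (take m z) = m" "length (take n (drop m z)) = n" "length (drop n (drop m z)) = n" 
          using lz by auto
        ultimately obtain p x y where ze: "z = p @ x @ y" and len: "length p = m" "length x = n" "length y = n"
          by blast
        have "nl (p @ x) \<in> A'" and y: "y = f p x" using key[OF len] z unfolding ze by blast+
        then have "x \<in> fiber A p" using fibA len by simp
        moreover from this have "p \<in> proj_first m A" using projA len by blast
        ultimately show "z \<in> ?r" unfolding ze y by blast
      next
        fix z assume "z \<in> ?r"
        then obtain p x where z: "z = p @ x @ f p x" "p \<in> proj_first m A" "x \<in> fiber A p" by blast
        then have "length p = m" using projA by blast
        moreover from this have "length x = n" "nl (p @ x) \<in> A'" using z fibA by auto
        ultimately show "z \<in> ?l" using key[of p x "f p x"] z(1) by (simp add: f_def)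
      qed
    qed
    ultimately show ?thesis unfolding definable_family_def by simp
  qed
  have fibre: "linear_map_on n n (fiber A p) (f p) \<and> bij_betw (f p) (fiber A p) (fiber B p) \<and>
      (\<exists>\<Lambda>. gbounded (n - l) \<Lambda> \<and> definable p (n - l) \<Lambda> \<and> fiber B p = cart_prod (Hpow l) \<Lambda>)"
    if "p \<in> proj_first m A" for p
  proof (intro conjI)
    have p: "length p = m" using that projA by blast
    show "linear_map_on n n (fiber A p) (f p)"
      unfolding linear_map_on_def
    proof (intro conjI allI impI)
      show "f p ` fiber A p \<subseteq> Gpow n" by (auto simp: f_def Gpow_def)
      fix j assume j: "j < n"
      have "linear_on n (fiber A p) (\<lambda>x. h (nl (p @ x)) (\<sigma> j))"
        unfolding fibA[OF p] by (rule linear_on_if_aff[OF D(7)[OF \<sigma>W[OF j]] sc p])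
      then show "linear_on n (fiber A p) (\<lambda>x. f p x ! j)" using j by (simp add: f_def)
    qed
    show "bij_betw (f p) (fiber A p) (fiber B p)"
      by (rule bij_betw_byWitness[where f' = "g p"]) (use fB gA gf fg p in auto)
    \<comment> \<open>The section of the box at the origin of the free coordinates; by
      \<open>box_free\<close> the section at any other point of \<open>Hpow l\<close> is the
      same.\<close>
    let ?\<Lambda> = "{v \<in> Gpow (n - l). E p (replicate l 0 @ v) \<in> B'}"
    have Ev: "E p (u @ v) (\<sigma> (l + i)) = v ! i" if "length u = l" "i < n - l" for u v i
      using that \<sigma>W[of "l + i"] \<tau>\<sigma>[of "l + i"] by (simp add: E_def nth_append)
    have "gbounded (n - l) ?\<Lambda>"
    proof -
      have "\<exists>z. \<forall>e\<in>B'. (\<forall>i. i \<notin> ?W \<longrightarrow> e i = nl p i) \<longrightarrow> (\<forall>i\<in>?W - L. - z \<le> e i \<and> e i \<le> z)"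
        using box unfolding box_def by (elim conjE) (erule spec)
      then obtain z where z: "\<forall>e\<in>B'. (\<forall>i. i \<notin> ?W \<longrightarrow> e i = nl p i) \<longrightarrow> (\<forall>i\<in>?W - L. - z \<le> e i \<and> e i \<le> z)" ..
      \<comment> \<open>The bound supplied by \<open>box\<close> need not be nonnegative, but the
        one required here has to lie in H.\<close>
      have "- max z 0 \<le> v ! i \<and> v ! i \<le> max z 0" if v: "v \<in> ?\<Lambda>" and i: "i < n - l" for v i
      proof -
        have "\<sigma> (l + i) \<in> ?W - L" using \<sigma>W[of "l + i"] \<sigma>(2)[of "l + i"] i by simp
        moreover have "\<forall>i. i \<notin> ?W \<longrightarrow> E p (replicate l 0 @ v) i = nl p i" by (simp add: E_def)
        moreover have "E p (replicate l 0 @ v) \<in> B'" using v by blast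
        ultimately have "- z \<le> E p (replicate l 0 @ v) (\<sigma> (l + i)) \<and> E p (replicate l 0 @ v) (\<sigma> (l + i)) \<le> z"
          using z by blast
        then have "- z \<le> v ! i \<and> v ! i \<le> z" using Ev[of "replicate l 0" i v] i by simp
        moreover have "- max z 0 \<le> - z" "z \<le> max z 0" by simp_all
        ultimately show ?thesis by (meson order_trans)
      qed
      moreover have "replicate (n - l) (max z 0) \<in> Hpow (n - l)" by (simp add: Hpow_def Gpow_def)
      ultimately show ?thesis unfolding gbounded_def
        by (intro conjI bexI[of _ "replicate (n - l) (max z 0)"]) auto
    qed
    moreover have "definable p (n - l) ?\<Lambda>"
    proof -
      let ?V' = "{..<length p + (n - l)}"
      \<comment> \<open>Puts 0 at the free coordinates and reads the bounded ones from
        \<open>p @ v\<close>. There the \<open>l\<close> free positions after the parameters are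
        left out, hence \<open>\<tau> i - l\<close>.\<close>
      define T where "T e = (\<lambda>i. if i \<in> L then 0 else if i \<in> ?W then e (m + (\<tau> i - l)) else e i)" for e :: "nat \<Rightarrow> 'a"
      have "QF ?V' {e \<in> UNIV. T e \<in> B'}"
      proof (rule QF_pullback[OF QB QF_UNIV], rule qlin_LF)
        fix i assume i: "i \<in> ?V"
        consider "i \<in> L" | "i \<in> ?W - L" | "i < m" using i L by fastforce
        then show "(\<lambda>e. T e i) \<in> LF ?V'"
        proof cases
          case 1
          then show ?thesis by (simp add: T_def LF_zero)
        next
          case 2
          then have "m + (\<tau> i - l) \<in> ?V'" using \<tau>(1)[of i] \<tau>L[of i] p by auto
          from LF_var[OF this] show ?thesis using 2 by (simp add: T_def)
        next
          case 3
          then have "i \<in> ?V'" "i \<notin> L" "i \<notin> ?W" using p L by auto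
          moreover from this have "(\<lambda>e. T e i) = (\<lambda>e. e i)" by (intro ext) (simp only: T_def if_False)
          ultimately show ?thesis by (simp only: LF_var)
        qed
      qed
      then have "definable p (n - l) {v \<in> Gpow (n - l). nl (p @ v) \<in> {e. T e \<in> B'}}"
        by (intro definable_if_QF) simp
      moreover have "nl (p @ v) \<in> {e. T e \<in> B'} \<longleftrightarrow> E p (replicate l 0 @ v) \<in> B'" if "v \<in> Gpow (n - l)" for v
      proof -
        have "T (nl (p @ v)) \<in> B' \<longleftrightarrow> E p (replicate l 0 @ v) \<in> B'"
        proof (rule QF_local[OF QB])
          fix i assume i: "i \<in> ?V"
          have lv: "length v = n - l" using that by (simp add: Gpow_def)
          consider "i \<in> L" | "i \<in> ?W - L" | "i < m" using i L by fastforce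
          then show "T (nl (p @ v)) i = E p (replicate l 0 @ v) i"
          proof cases
            case 1
            then have "i \<in> ?W" "\<tau> i < l" using L \<tau>L by auto
            then show ?thesis using 1 by (simp add: T_def E_def nth_append)
          next
            case 2
            then have "\<tau> i < n" "l \<le> \<tau> i" using \<tau>(1)[of i] \<tau>L[of i] by auto
            from le_Suc_ex[OF this(2)] obtain b where b: "\<tau> i = l + b" by blast
            then have "b < n - l" "m + b < m + n - l" using \<open>\<tau> i < n\<close> by simp_all
            then show ?thesis using 2 b p lv by (simp add: T_def E_def nth_append nl_def)
          next
            case 3
            then have "i \<notin> L" "i \<notin> ?W" using L by auto
            then show ?thesis using 3 p by (simp add: T_def E_def nl_def nth_append)
          qed
        qed
        then show ?thesis by simp
      qed
      then have "{v \<in> Gpow (n - l). nl (p @ v) \<in> {e. T e \<in> B'}} = ?\<Lambda>" by blast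
      ultimately show ?thesis by simp
    qed
    moreover have "fiber B p = cart_prod (Hpow l) ?\<Lambda>"
    proof -
      have key: "E p (u @ v) \<in> B' \<longleftrightarrow> u \<in> Hpow l \<and> E p (replicate l 0 @ v) \<in> B'" 
        if len: "length u = l" "length v = n - l" for u v
      proof -
        have out: "E p (u @ v) i = E p (u' @ v) i" if "length u' = l" "i \<notin> L" for u' i
          using that len \<tau>L[of i] by (simp add: E_def nth_append)
        have inL: "E p (u' @ v) i = u' ! \<tau> i" "\<tau> i < l" if "length u' = l" "i \<in> L" for u' i
          using that \<tau>L[of i] L by (auto simp: E_def nth_append)
        show ?thesis
        proof (intro iffI conjI)
          assume uv: "E p (u @ v) \<in> B'"
          show "u \<in> Hpow l"
            unfolding Hpow_def Gpow_def
          proof (intro CollectI conjI allI impI)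
            fix j assume j: "j < l"
            then have "\<sigma> j \<in> L" "\<tau> (\<sigma> j) = j" using \<sigma>(2)[of j] \<tau>\<sigma>[of j] ln by auto
            then show "0 \<le> u ! j" using boxD(1)[OF box uv] inL[OF len(1)] by fastforce
          qed (use len in simp)
          show "E p (replicate l 0 @ v) \<in> B'"
            by (rule box_free[OF box finL uv]) (use out[of "replicate l 0"] inL[of "replicate l 0"] in auto)
        next
          assume uv: "u \<in> Hpow l \<and> E p (replicate l 0 @ v) \<in> B'"
          show "E p (u @ v) \<in> B'"
          proof (rule box_free[OF box finL conjunct2[OF uv]])
            show "E p (u @ v) i = E p (replicate l 0 @ v) i" if "i \<notin> L" for i using out that by simp
            show "0 \<le> E p (u @ v) i" if "i \<in> L" for i using inL[OF len(1) that] uv by (simp add: Hpow_def)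
          qed
        qed
      qed
      show ?thesis
      proof (intro set_eqI iffI)
        fix y assume "y \<in> fiber B p"
        then have y: "length y = n" "E p y \<in> B'" using fibB[OF p] by auto
        have len: "length (take l y) = l" "length (drop l y) = n - l" using y ln by auto
        have "take l y \<in> Hpow l" "drop l y \<in> ?\<Lambda>" using key[OF len] y len by (auto simp: Gpow_def)
        then show "y \<in> cart_prod (Hpow l) ?\<Lambda>" unfolding cart_prod_def
          by (metis (mono_tags, lifting) append_take_drop_id mem_Collect_eq)
      next
        fix y assume "y \<in> cart_prod (Hpow l) ?\<Lambda>"
        then obtain u v where uv: "y = u @ v" "u \<in> Hpow l" "v \<in> ?\<Lambda>" unfolding cart_prod_def by blast
        then have len: "length u = l" "length v = n - l" by (auto simp: Hpow_def Gpow_def)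
        then show "y \<in> fiber B p" using key[OF len] uv ln fibB[OF p] by simp
      qed
    qed
    ultimately show "\<exists>\<Lambda>. gbounded (n - l) \<Lambda> \<and> definable p (n - l) \<Lambda> \<and> fiber B p = cart_prod (Hpow l) \<Lambda>" by blast
  qed
  show ?thesis using defA BG proj ln fam fibre by blast
qed

end

section \<open>Parametric rectilinearization\<close>

text \<open>\<open>W\<close> consists of the last \<open>n\<close> indices. The first
  \<open>m\<close> are parameters, which no isomorphism changes, so the construction is fibrewise
  and the projections of \<open>A\<close> and \<open>B\<close> agree.\<close>

theorem mainTheorem5:
  fixes X :: "'a::{linordered_ab_group_add,one} list set" and m n :: nat
  assumes "Z_group TYPE('a)"
    and "definable [] (m + n) X"
  shows "\<exists>P. finite P \<and> partition_on X P \<and>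
    (\<forall>A\<in>P. definable [] (m + n) A \<and>
      (\<exists>B l f. B \<subseteq> Gpow (m + n) \<and> proj_first m A = proj_first m B \<and> l \<le> n \<and>
        definable_family m n n A f \<and>
        (\<forall>p\<in>proj_first m A.
          linear_map_on n n (fiber A p) (f p) \<and>
          bij_betw (f p) (fiber A p) (fiber B p) \<and>
          (\<exists>\<Lambda>. gbounded (n - l) \<Lambda> \<and> definable p (n - l) \<Lambda> \<and>
             fiber B p = cart_prod (Hpow l) \<Lambda>))))"
proof -
  interpret zgroup "TYPE('a)" by (rule zgroup_if_Z_group[OF assms(1)])
  obtain X' :: "(nat \<Rightarrow> 'a) set" where X': "QF {..<m + n} X'" "X = {y \<in> Gpow (m + n). nl y \<in> X'}"
    using QF_if_definable[OF assms(2)] by blast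
  have "good {..<m + n} {m..<m + n} X'" by (rule good_QF) (use X' in auto)
  then obtain P' where P': "finite P'" "partition_on X' P'" "P' \<subseteq> (\<Union>d c. rect d c {..<m + n} {m..<m + n})"
    using fdu_partition by blast
  let ?S = "\<lambda>A. {z \<in> Gpow (m + n). nl z \<in> A}"
  \<comment> \<open>A partition in the sense of \<open>partition_on\<close> has no empty
    members.\<close>
  let ?P = "?S ` P' - {{}}"
  have "partition_on X ?P"
  proof (rule partition_onI)
    show "\<Union> ?P = X" using partition_onD1[OF P'(2)] unfolding X'(2) by auto
    fix A B assume AB: "A \<in> ?P" "B \<in> ?P" "A \<noteq> B"
    then obtain A' B' where "A = ?S A'" "B = ?S B'" "A' \<in> P'" "B' \<in> P'" "A' \<noteq> B'" by blast
    moreover from this have "A' \<inter> B' = {}" using disjointD[OF partition_onD2[OF P'(2)]] by blast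
    ultimately show "disjnt A B" unfolding disjnt_def by blast
  qed blast
  moreover have "finite ?P" using P'(1) by simp
  moreover have "\<forall>A\<in>?P. definable [] (m + n) A \<and>
      (\<exists>B l f. B \<subseteq> Gpow (m + n) \<and> proj_first m A = proj_first m B \<and> l \<le> n \<and>
        definable_family m n n A f \<and>
        (\<forall>p\<in>proj_first m A.
          linear_map_on n n (fiber A p) (f p) \<and>
          bij_betw (f p) (fiber A p) (fiber B p) \<and>
          (\<exists>\<Lambda>. gbounded (n - l) \<Lambda> \<and> definable p (n - l) \<Lambda> \<and>
             fiber B p = cart_prod (Hpow l) \<Lambda>)))"
  proof
    fix A assume "A \<in> ?P"
    then obtain A' where A': "A' \<in> P'" "A = ?S A'" by blast
    then obtain d c where "A' \<in> rect d c {..<m + n} {m..<m + n}" using P'(3) by blast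
    from rect_piece[OF this] show "definable [] (m + n) A \<and>
      (\<exists>B l f. B \<subseteq> Gpow (m + n) \<and> proj_first m A = proj_first m B \<and> l \<le> n \<and>
        definable_family m n n A f \<and>
        (\<forall>p\<in>proj_first m A.
          linear_map_on n n (fiber A p) (f p) \<and>
          bij_betw (f p) (fiber A p) (fiber B p) \<and>
          (\<exists>\<Lambda>. gbounded (n - l) \<Lambda> \<and> definable p (n - l) \<Lambda> \<and>
             fiber B p = cart_prod (Hpow l) \<Lambda>)))" unfolding A'(2) .
  qed
  ultimately show ?thesis by blast
qed

end
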